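(* Let $(x_j,f_j)_{j=1}^\infty$ be a shrinking Schauder frame for a Banach space $X$ such that the minimal associated basis is not shrinking. Then for each shrinking associated basis $(w_j)_{j=1}^\infty$ of $(x_j,f_j)_{j=1}^\infty$ there are increasing sequences of natural numbers $(k_i)_{i=1}^\infty$ and $(N_i)_{i=1}^\infty$, with $(N_i)$ admissible, and a set of (infinite) increasing sequences of natural numbers $(M_\alpha)_{\alpha\in\Delta}$, with $\Delta$ having the cardinality of the continuum, such that: \begin{enumerate} \item For each $\alpha\in\Delta$, the basis $(z_j^{(k_i)_{i\in M_\alpha}})_{j=1}^\infty$ of $Z_{(k_i)_{i\in M_\alpha},(N_i)}$ is a shrinking associated basis of $(x_j,f_j)_{j=1}^\infty$ which is dominated by $(w_j)_{j=1}^\infty$. \item For $\alpha\neq\beta$ in $\Delta$, the bases $(z_j^{(k_i)_{i\in M_\alpha}})_{j=1}^\infty$ and $(z_j^{(k_i)_{i\in M_\beta}})_{j=1}^\infty$ are incomparable. \end{enumerate}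
   Context: Let $X$ be a separable infinite dimensional Banach space. A sequence of pairs $(x_i,f_i)_{i=1}^\infty$ in $X\times X^*$ with $x_i\neq 0$ for all $i$ is a Schauder frame for $X$ if $x=\sum_{i=1}^\infty f_i(x)x_i$ (norm convergence) for all $x\in X$. It is shrinking if $(f_i,x_i)_{i=1}^\infty$ is a Schauder frame for $X^*$, i.e. $f=\sum_{i=1}^\infty f(x_i)f_i$ in norm for all $f\in X^*$ (the nonvanishing convention is only for the $x_i$). For $m\leqslant n$, $P_{[m,n]}:X\to X$ is $P_{[m,n]}(x)=\sum_{i=m}^n f_i(x)x_i$. A Banach space $Z$ with a Schauder basis $(z_i)$ is an associated space for $(x_i,f_i)$, and $(z_i)$ is an associated basis, if the maps $T:X\to Z$, $T(x)=\sum_i f_i(x)z_i$, and $S:Z\to X$, $S(\sum_i a_iz_i)=\sum_i a_ix_i$, are well defined and bounded. A Schauder basis is shrinking if its biorthogonal functionals form a Schauder basis of the dual space. The minimal associated basis of $(x_i,f_i)$ is the unit vector basis $(z_i)$ of $c_{00}$ (finitely supported scalar sequences) regarded as a basis of $Z_{\min}$, the completion of $c_{00}$ under $\|\sum a_iz_i\|_{\min}=\sup_{m\leqslant n}\|\sum_{m\leqslant i\leqslant n}a_ix_i\|$. An increasing sequence of natural numbers $(N_k)_{k=1}^\infty$ is called admissible (for the shrinking frame $(x_i,f_i)$) if for every $k\in\mathbb{N}$ and all $x\in X$, $$\sup_{\substack{m_0<n_0\leqslant k\\ N_k\leqslant m\leqslant n}}\|P_{[m_0,n_0]}P_{[m,n]}x\|\leqslant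 2^{-k}\|x\|.$$ For $z=\sum a_iz_i\in c_{00}$ and $k\in\mathbb{N}$ put $$\|z\|_{k}=\sup_{\substack{m_0\leqslant n_0\leqslant k\\ N_{k}\leqslant m\leqslant n}}2^{k}\Big\|P_{[m_0,n_0]}\sum_{m\leqslant i\leqslant n}a_ix_i\Big\|.$$ For an admissible $(N_j)$ and an increasing sequence $(k_j)$ of natural numbers, $Z_{(k_j),(N_j)}$ is the completion of $c_{00}$ under the norm $$\Big\|\sum a_iz_i^{(k_j)}\Big\|_{(k_j),(N_j)}=\max\Big\{\sup_{m\leqslant n}\Big\|\sum_{m\leqslant i\leqslant n}a_ix_i\Big\|,\ \sup_j\Big\|\sum a_iz_i\Big\|_{k_j}\Big\},$$ where $(z_i^{(k_j)})_{i=1}^\infty$ denotes the unit vector basis of $c_{00}$ viewed in this space. For infinite $M\subset\mathbb{N}$, $(k_i)_{i\in M}$ is the corresponding subsequence of $(k_i)$; an infinite increasing sequence is identified with its set of values. (Suprema over empty index sets are $0$.) A basis $(w_i)$ dominates a basis $(v_i)$ (equivalently, $(v_i)$ is dominated by $(w_i)$) if there is $K>0$ with $\|\sum a_iv_i\|\leqslant K\|\sum a_iw_i\|$ for all $(a_i)\in c_{00}$. Two bases are incomparable if neither dominates the other. *)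

theory Defs
  imports "HOL-Analysis.Analysis"
begin

text \<open>
  Scalars are real. All sequences are indexed by the natural numbers from \<open>1\<close> on; the value of a
  sequence of vectors, functionals or natural numbers at \<open>0\<close> is never used, and sequences of
  scalars are normalised to vanish at \<open>0\<close>.

  A Banach space is either a type of class \<^class>\<open>banach\<close> or a closed subspace \<open>Z\<close> of one. The
  latter is needed for completions with respect to norms that are quantified inside a formula. Such
  completions are realised in \<open>nat \<Rightarrow>\<^sub>C 'x\<close>, the space of all bounded sequences in \<open>'x\<close> with the
  supremum norm (\<open>nat\<close> is discrete). It has room for the completion of \<open>c00\<close> under every norm
  that is a supremum of countably many seminorms \<open>a \<mapsto> norm (L a)\<close> with \<open>L\<close> linear into \<open>'x\<close>.
\<close>

text \<open>The library states completeness only for bounded continuous functions on metric spaces.\<close>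

instance bcontfun :: (topological_space, complete_space) complete_space
proof
  fix g :: "nat \<Rightarrow> ('a, 'b) bcontfun"
  assume "Cauchy g"
  then have "uniformly_Cauchy_on UNIV (\<lambda>n. apply_bcontfun (g n))"
    unfolding uniformly_Cauchy_on_def Cauchy_def
    by (meson dist_fun_lt_imp_dist_val_lt)
  then obtain l where l: "uniform_limit UNIV (\<lambda>n. apply_bcontfun (g n)) l sequentially"
    using Cauchy_uniformly_convergent uniformly_convergent_on_def by blast
  obtain l' where "g \<longlonglongrightarrow> l'"
    by (rule uniform_limit_bcontfunE[OF l sequentially_bot])
  then show "convergent g"
    by (rule convergentI)
qed

instance bcontfun :: (topological_space, banach) banach ..

definition increasing_seq :: "(nat \<Rightarrow> nat) \<Rightarrow> bool" where
  "increasing_seq s \<longleftrightarrow> strict_mono_on {1..} s \<and> (\<forall>i\<ge>1. 1 \<le> s i)"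

definition infinite_dimensional :: "'a::real_vector itself \<Rightarrow> bool" where
  "infinite_dimensional _ \<longleftrightarrow> (\<nexists>B::'a set. finite B \<and> span B = UNIV)"


subsection \<open>Schauder frames\<close>

definition schauder_frame ::
    "(nat \<Rightarrow> 'a::banach) \<Rightarrow> (nat \<Rightarrow> 'a \<Rightarrow>\<^sub>L real) \<Rightarrow> bool" where
  "schauder_frame x f \<longleftrightarrow>
     (\<forall>i\<ge>1. x i \<noteq> 0) \<and>
     (\<forall>v. (\<lambda>n. \<Sum>i=1..n. blinfun_apply (f i) v *\<^sub>R x i) \<longlonglongrightarrow> v)"

definition shrinking_frame ::
    "(nat \<Rightarrow> 'a::banach) \<Rightarrow> (nat \<Rightarrow> 'a \<Rightarrow>\<^sub>L real) \<Rightarrow> bool" where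
  "shrinking_frame x f \<longleftrightarrow>
     schauder_frame x f \<and>
     (\<forall>g :: 'a \<Rightarrow>\<^sub>L real. (\<lambda>n. \<Sum>i=1..n. blinfun_apply g (x i) *\<^sub>R f i) \<longlonglongrightarrow> g)"

definition frame_proj ::
    "(nat \<Rightarrow> 'a::banach) \<Rightarrow> (nat \<Rightarrow> 'a \<Rightarrow>\<^sub>L real) \<Rightarrow> nat \<Rightarrow> nat \<Rightarrow> 'a \<Rightarrow> 'a" where
  "frame_proj x f m n v = (\<Sum>i=m..n. blinfun_apply (f i) v *\<^sub>R x i)"


subsection \<open>Schauder bases of closed subspaces\<close>

definition bounded_linear_on ::
    "'b::real_normed_vector set \<Rightarrow> ('b \<Rightarrow> 'c::real_normed_vector) \<Rightarrow> bool" where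
  "bounded_linear_on Z g \<longleftrightarrow>
     (\<forall>u\<in>Z. \<forall>v\<in>Z. g (u + v) = g u + g v) \<and>
     (\<forall>c. \<forall>v\<in>Z. g (c *\<^sub>R v) = c *\<^sub>R g v) \<and>
     (\<exists>K. \<forall>v\<in>Z. norm (g v) \<le> K * norm v)"

definition basis_expansion :: "(nat \<Rightarrow> 'b::real_normed_vector) \<Rightarrow> 'b \<Rightarrow> (nat \<Rightarrow> real) \<Rightarrow> bool" where
  "basis_expansion z v a \<longleftrightarrow> a 0 = 0 \<and> (\<lambda>n. \<Sum>i=1..n. a i *\<^sub>R z i) \<longlonglongrightarrow> v"

definition schauder_basis :: "'b::banach set \<Rightarrow> (nat \<Rightarrow> 'b) \<Rightarrow> bool" where
  "schauder_basis Z z \<longleftrightarrow>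
     subspace Z \<and> closed Z \<and> (\<forall>i\<ge>1. z i \<in> Z) \<and> (\<forall>v\<in>Z. \<exists>!a. basis_expansion z v a)"

text \<open>The functionals biorthogonal to a Schauder basis of \<open>Z\<close>; meaningful on \<open>Z\<close> only.\<close>

definition biorthogonal :: "(nat \<Rightarrow> 'b::banach) \<Rightarrow> nat \<Rightarrow> 'b \<Rightarrow> real" where
  "biorthogonal z i v = (THE a. basis_expansion z v a) i"

text \<open>
  The elements of the dual of \<open>Z\<close> are the functions \<open>h\<close> with \<open>bounded_linear_on Z h\<close>, considered
  on \<open>Z\<close> only; \<open>dual_norm Z\<close> is the norm of the dual space and ignores values outside of \<open>Z\<close>.
\<close>

definition dual_norm :: "'b::banach set \<Rightarrow> ('b \<Rightarrow> real) \<Rightarrow> real" where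
  "dual_norm Z h = (SUP v\<in>{v \<in> Z. norm v \<le> 1}. \<bar>h v\<bar>)"

definition schauder_basis_of_dual :: "'b::banach set \<Rightarrow> (nat \<Rightarrow> 'b \<Rightarrow> real) \<Rightarrow> bool" where
  "schauder_basis_of_dual Z g \<longleftrightarrow>
     (\<forall>i\<ge>1. bounded_linear_on Z (g i)) \<and>
     (\<forall>h. bounded_linear_on Z h \<longrightarrow>
        (\<exists>!a. a 0 = 0 \<and> (\<lambda>n. dual_norm Z (\<lambda>v. h v - (\<Sum>i=1..n. a i * g i v))) \<longlonglongrightarrow> 0))"

definition shrinking_basis :: "'b::banach set \<Rightarrow> (nat \<Rightarrow> 'b) \<Rightarrow> bool" where
  "shrinking_basis Z z \<longleftrightarrow> schauder_basis Z z \<and> schauder_basis_of_dual Z (biorthogonal z)"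

text \<open>\<open>T\<close> and \<open>S\<close> are the analysis and the synthesis operator.\<close>

definition associated_basis ::
    "(nat \<Rightarrow> 'a::banach) \<Rightarrow> (nat \<Rightarrow> 'a \<Rightarrow>\<^sub>L real) \<Rightarrow> 'b::banach set \<Rightarrow> (nat \<Rightarrow> 'b) \<Rightarrow> bool" where
  "associated_basis x f Z z \<longleftrightarrow>
     schauder_basis Z z \<and>
     (\<exists>T. bounded_linear T \<and>
        (\<forall>v. T v \<in> Z \<and> (\<lambda>n. \<Sum>i=1..n. blinfun_apply (f i) v *\<^sub>R z i) \<longlonglongrightarrow> T v)) \<and>
     (\<exists>S. bounded_linear_on Z S \<and>
        (\<forall>v\<in>Z. \<forall>a. basis_expansion z v a \<longrightarrow> (\<lambda>n. \<Sum>i=1..n. a i *\<^sub>R x i) \<longlonglongrightarrow> S v))"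


subsection \<open>Norms on finitely supported sequences and their completions\<close>

definition c00 :: "(nat \<Rightarrow> real) set" where
  "c00 = {a. a 0 = 0 \<and> finite {i. a i \<noteq> 0}}"

definition lin_comb :: "(nat \<Rightarrow> real) \<Rightarrow> (nat \<Rightarrow> 'b::real_vector) \<Rightarrow> 'b" where
  "lin_comb a z = (\<Sum>i | a i \<noteq> 0. a i *\<^sub>R z i)"

text \<open>
  \<open>Z\<close> is a completion of \<open>c00\<close> under the norm \<open>p\<close>, the unit vectors of \<open>c00\<close> being mapped to
  \<open>z 1, z 2, \<dots>\<close>: the induced linear map from \<open>c00\<close> to the Banach space \<open>Z\<close> is isometric with
  dense range. This determines \<open>Z\<close> and \<open>z\<close> up to an isometric isomorphism.
\<close>

definition completion_of ::
    "((nat \<Rightarrow> real) \<Rightarrow> real) \<Rightarrow> 'b::banach set \<Rightarrow> (nat \<Rightarrow> 'b) \<Rightarrow> bool" where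
  "completion_of p Z z \<longleftrightarrow>
     (\<forall>a\<in>c00. norm (lin_comb a z) = p a) \<and> Z = closure (span (z ` {1..}))"

definition dominates ::
    "(nat \<Rightarrow> 'b::real_normed_vector) \<Rightarrow> (nat \<Rightarrow> 'c::real_normed_vector) \<Rightarrow> bool" where
  "dominates w v \<longleftrightarrow> (\<exists>K>0. \<forall>a\<in>c00. norm (lin_comb a v) \<le> K * norm (lin_comb a w))"

definition incomparable ::
    "(nat \<Rightarrow> 'b::real_normed_vector) \<Rightarrow> (nat \<Rightarrow> 'c::real_normed_vector) \<Rightarrow> bool" where
  "incomparable v w \<longleftrightarrow> \<not> dominates v w \<and> \<not> dominates w v"

text \<open>
  The suprema below are over nonempty index sets; for \<open>a \<in> c00\<close> and increasing \<open>N\<close> and \<open>ks\<close> they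
  are over bounded sets of reals (in \<open>Z_norm\<close> because \<open>level_norm x f N k a = 0\<close> as soon as \<open>N k\<close>
  exceeds the support of \<open>a\<close>).
\<close>

definition min_norm :: "(nat \<Rightarrow> 'a::banach) \<Rightarrow> (nat \<Rightarrow> real) \<Rightarrow> real" where
  "min_norm x a = (SUP (m, n)\<in>{(m, n). 1 \<le> m \<and> m \<le> n}. norm (\<Sum>i=m..n. a i *\<^sub>R x i))"

definition level_norm ::
    "(nat \<Rightarrow> 'a::banach) \<Rightarrow> (nat \<Rightarrow> 'a \<Rightarrow>\<^sub>L real) \<Rightarrow> (nat \<Rightarrow> nat) \<Rightarrow> nat \<Rightarrow> (nat \<Rightarrow> real) \<Rightarrow> real" where
  "level_norm x f N k a =
     (SUP (m0, n0, m, n)\<in>{(m0, n0, m, n). 1 \<le> m0 \<and> m0 \<le> n0 \<and> n0 \<le> k \<and> N k \<le> m \<and> m \<le> n}.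
        2 ^ k * norm (frame_proj x f m0 n0 (\<Sum>i=m..n. a i *\<^sub>R x i)))"

definition Z_norm ::
    "(nat \<Rightarrow> 'a::banach) \<Rightarrow> (nat \<Rightarrow> 'a \<Rightarrow>\<^sub>L real) \<Rightarrow> (nat \<Rightarrow> nat) \<Rightarrow> (nat \<Rightarrow> nat) \<Rightarrow>
     (nat \<Rightarrow> real) \<Rightarrow> real" where
  "Z_norm x f ks N a = max (min_norm x a) (SUP j\<in>{1..}. level_norm x f N (ks j) a)"

text \<open>Bounding every term by \<open>1 / 2 ^ k\<close> also covers \<open>k = 1\<close>, where the index set is empty.\<close>

definition admissible ::
    "(nat \<Rightarrow> 'a::banach) \<Rightarrow> (nat \<Rightarrow> 'a \<Rightarrow>\<^sub>L real) \<Rightarrow> (nat \<Rightarrow> nat) \<Rightarrow> bool" where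
  "admissible x f N \<longleftrightarrow>
     increasing_seq N \<and>
     (\<forall>k\<ge>1. \<forall>v m0 n0 m n. 1 \<le> m0 \<and> m0 < n0 \<and> n0 \<le> k \<and> N k \<le> m \<and> m \<le> n \<longrightarrow>
        norm (frame_proj x f m0 n0 (frame_proj x f m n v)) \<le> 1 / 2 ^ k * norm v)"

end

theory Submission
  imports Defs
begin

text \<open>
  A basis whose partial sum projections are contractive is shrinking as soon as every functional
  is small on finitely supported unit vectors far out. If a functional \<open>h\<close> is not, it is bounded
  below on a block sequence \<open>u l\<close> in the unit ball. When the coordinates \<open>f i\<close> of
  \<open>y l = S (u l)\<close> tend to \<open>0\<close>, the sequence \<open>y l\<close> is weakly null because the frame is shrinking, so
  Mazur's lemma gives convex combinations of small norm and small coefficients. If the blocks are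
  sparse enough, these are small also in the norm of the basis, which contradicts the bound on \<open>h\<close>.
  The level norms force the coordinates to \<open>0\<close>, hence every space \<open>Z\<close> is shrinking. Conversely,
  since the minimal basis is not shrinking, some coordinate \<open>f i\<close> stays away from \<open>0\<close> on vectors
  supported arbitrarily far out in the minimal unit ball.

  Since \<open>w\<close> is shrinking, \<open>N\<close> can be chosen so large that all level norms are bounded by the norm
  of \<open>w\<close>; this gives admissibility and domination. If \<open>k\<close> grows fast, such a vector
  supported between \<open>N (k n)\<close> and \<open>N (k (n + 1))\<close> has norm at least of the order \<open>2 ^ k n\<close> when
  \<open>n\<close> belongs to the index set, and at most of the order \<open>2 ^ k (n - 1)\<close> otherwise. Hence index
  sets with infinite differences in both directions yield incomparable bases, and an almost
  disjoint family has continuum many of them.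
\<close>

subsection \<open>Hahn--Banach and Mazur\<close>

text \<open>The shrinking criterion is proved for an abstract set \<open>L\<close> of levels because
  it serves twice: with \<open>L\<close> the chosen levels it yields the spaces \<open>Z\<close>,
  and with \<open>L = {}\<close> its contrapositive yields the witnesses in the minimal space. In a
  level norm, flat coefficients alone do not help, since a segment may meet arbitrarily many blocks
  and each can contribute a term of size 1. Sparseness cures this: between consecutive blocks lies
  the threshold \<open>N K\<close> of a much higher level \<open>K\<close>, and the bound known at
  level \<open>K\<close> gains the factor \<open>2 ^ k / 2 ^ K\<close> at level \<open>k\<close>.
  That \<open>w\<close> is shrinking enters through the functionals \<open>f i\<close> composed with
  the synthesis operator: they are small on tails of \<open>w\<close>, and level \<open>k\<close>
  involves only the finitely many \<open>i \<le> k\<close>. So \<open>N k\<close> can be fixed level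
  by level, before any levels are selected, and one \<open>N\<close> serves all index sets. Only
  then is \<open>k\<close> built, from the supports of the witnesses. Norms are handled through
  their upper bounds, which avoids suprema until the very end. Hahn--Banach is needed only for
  Mazur's lemma, Baire category only for the basis constant of \<open>w\<close>.\<close>

definition sublinear :: "('a::real_vector \<Rightarrow> real) \<Rightarrow> bool" where
  "sublinear p \<longleftrightarrow> (\<forall>u v. p (u + v) \<le> p u + p v) \<and> (\<forall>c>0. \<forall>v. p (c *\<^sub>R v) \<le> c * p v)"

lemma sublinear_add: "sublinear p \<Longrightarrow> p (u + v) \<le> p u + p v"
  and sublinear_scale_le: "sublinear p \<Longrightarrow> 0 < c \<Longrightarrow> p (c *\<^sub>R v) \<le> c * p v"
  by (auto simp: sublinear_def)

text \<open>Positive homogeneity is assumed only as an inequality; using it with a scalar and with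
  its inverse gives equality, here with 2 and 1/2.\<close>

lemma sublinear_0:
  assumes "sublinear p"
  shows "p 0 = 0"
  using sublinear_scale_le[OF assms, of 2 0] sublinear_scale_le[OF assms, of "1/2" 0] by simp

lemma sublinear_ge_minus:
  assumes "sublinear p"
  shows "- p (- v) \<le> p v"
  using sublinear_add[OF assms, of v "- v"] sublinear_0[OF assms] by simp

lemma sublinear_diff_ge:
  assumes "sublinear p"
  shows "p k - p (- v) \<le> p (v + k)"
  using sublinear_add[OF assms, of "v + k" "- v"] by simp

text \<open>\<open>R\<close> is a convex cone of demands: (k, r) asks a functional to be at least r
  at k. The infimum of \<open>p (v + k) - r\<close> encodes them, since a linear g below q satisfies
  \<open>g (- k) \<le> q (- k) \<le> p 0 - r = - r\<close>. Compatibility of the demands with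
  \<open>p\<close> keeps the infimum finite.\<close>

lemma sublinear_INF_cone:
  fixes p :: "'a::real_vector \<Rightarrow> real"
  assumes p: "sublinear p"
    and R0: "(0, 0) \<in> R"
    and Radd: "\<And>k r k' r'. (k, r) \<in> R \<Longrightarrow> (k', r') \<in> R \<Longrightarrow> (k + k', r + r') \<in> R"
    and Rscale: "\<And>c k r. 0 < c \<Longrightarrow> (k, r) \<in> R \<Longrightarrow> (c *\<^sub>R k, c * r) \<in> R"
    and Rle: "\<And>k r. (k, r) \<in> R \<Longrightarrow> r \<le> p k"
  obtains q where "sublinear q" "\<And>v. q v \<le> p v" "\<And>v k r. (k, r) \<in> R \<Longrightarrow> q v \<le> p (v + k) - r"
proof -
  define q where "q v = (INF (k, r)\<in>R. p (v + k) - r)" for v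
  have bdd: "bdd_below ((\<lambda>(k, r). p (v + k) - r) ` R)" for v
  proof (rule bdd_belowI2[where m = "- p (- v)"])
    fix kr assume "kr \<in> R"
    then show "- p (- v) \<le> (case kr of (k, r) \<Rightarrow> p (v + k) - r)"
      using sublinear_diff_ge[OF p, of "fst kr" v] Rle[of "fst kr" "snd kr"]
      by (auto split: prod.splits)
  qed
  have lower: "q v \<le> p (v + k) - r" if "(k, r) \<in> R" for v k r
    unfolding q_def using cINF_lower[OF bdd that] by simp
  have greatest: "B \<le> q v" if "\<And>k r. (k, r) \<in> R \<Longrightarrow> B \<le> p (v + k) - r" for B v
    unfolding q_def using R0 that by (intro cINF_greatest) auto
  have "q (u + v) \<le> q u + q v" for u v
  proof -
    have "q (u + v) - q u \<le> p (v + k) - r" if kr: "(k, r) \<in> R" for k r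
    proof -
      have "q (u + v) - (p (v + k) - r) \<le> q u"
      proof (rule greatest)
        fix k' r' assume "(k', r') \<in> R"
        then have "q (u + v) \<le> p ((u + k') + (v + k)) - (r' + r)"
          using lower[OF Radd[OF _ kr], of k' r' "u + v"] by (simp add: algebra_simps)
        then show "q (u + v) - (p (v + k) - r) \<le> p (u + k') - r'"
          using sublinear_add[OF p, of "u + k'" "v + k"] by simp
      qed
      then show ?thesis by simp
    qed
    then show ?thesis using greatest[of "q (u + v) - q u" v] by simp
  qed
  moreover have "q (c *\<^sub>R v) \<le> c * q v" if c: "0 < c" for c v
  proof -
    have "q (c *\<^sub>R v) / c \<le> q v"
    proof (rule greatest)
      fix k r assume "(k, r) \<in> R"
      then have "q (c *\<^sub>R v) \<le> p (c *\<^sub>R (v + k)) - c * r"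
        using lower[OF Rscale[OF c], of k r "c *\<^sub>R v"] by (simp add: algebra_simps)
      also have "\<dots> \<le> c * (p (v + k) - r)"
        using sublinear_scale_le[OF p c, of "v + k"] by (simp add: algebra_simps)
      finally show "q (c *\<^sub>R v) / c \<le> p (v + k) - r"
        using c by (simp add: field_simps)
    qed
    then show ?thesis using c by (simp add: field_simps)
  qed
  ultimately have "sublinear q" by (simp add: sublinear_def)
  moreover have "q v \<le> p v" for v using lower[OF R0, of v] by simp
  ultimately show thesis using lower that by blast
qed

text \<open>The infimum stays subadditive because one of any two members of a chain lies below the
  other, so different choices at u and v can be merged. The bound by \<open>p\<close> keeps it
  finite, through \<open>q v \<ge> - q (- v) \<ge> - p (- v)\<close>.\<close>

lemma sublinear_INF_chain:
  assumes ne: "C \<noteq> {}" and C: "\<And>q. q \<in> C \<Longrightarrow> sublinear q" "\<And>q v. q \<in> C \<Longrightarrow> q v \<le> p v"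
    and chain: "\<And>q q'. q \<in> C \<Longrightarrow> q' \<in> C \<Longrightarrow> (\<forall>v. q v \<le> q' v) \<or> (\<forall>v. q' v \<le> q v)"
  obtains q where "sublinear q" "\<And>q' v. q' \<in> C \<Longrightarrow> q v \<le> q' v"
proof -
  define q where "q v = (INF q'\<in>C. q' v)" for v
  have bdd: "bdd_below ((\<lambda>q'. q' v) ` C)" for v
  proof (rule bdd_belowI2[where m = "- p (- v)"])
    fix q assume "q \<in> C"
    then show "- p (- v) \<le> q v"
      using sublinear_ge_minus[OF C(1), of q v] C(2)[of q "- v"] by linarith
  qed
  have lower: "q v \<le> q' v" if "q' \<in> C" for q' v
    unfolding q_def using cINF_lower[OF bdd that] .
  have greatest: "B \<le> q v" if "\<And>q'. q' \<in> C \<Longrightarrow> B \<le> q' v" for B v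
    unfolding q_def using ne that by (rule cINF_greatest)
  have "q (u + v) \<le> q u + q v" for u v
  proof -
    have "q (u + v) - q u \<le> q2 v" if q2: "q2 \<in> C" for q2
    proof -
      have "q (u + v) - q2 v \<le> q u"
      proof (rule greatest)
        fix q1 assume q1: "q1 \<in> C"
        obtain q3 where q3: "q3 \<in> C" "\<And>v. q3 v \<le> q1 v" "\<And>v. q3 v \<le> q2 v"
          using chain[OF q1 q2] q1 q2 by blast
        show "q (u + v) - q2 v \<le> q1 u"
          using lower[OF q3(1), of "u + v"] sublinear_add[OF C(1)[OF q3(1)], of u v]
            q3(2)[of u] q3(3)[of v] by linarith
      qed
      then show ?thesis by simp
    qed
    then show ?thesis using greatest[of "q (u + v) - q u" v] by simp
  qed
  moreover have "q (c *\<^sub>R v) \<le> c * q v" if c: "0 < c" for c v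
  proof -
    have "q (c *\<^sub>R v) / c \<le> q v"
    proof (rule greatest)
      fix q' assume q': "q' \<in> C"
      show "q (c *\<^sub>R v) / c \<le> q' v"
        using lower[OF q', of "c *\<^sub>R v"] sublinear_scale_le[OF C(1)[OF q'] c, of v] c
        by (simp add: field_simps)
    qed
    then show ?thesis using c by (simp add: field_simps)
  qed
  ultimately have "sublinear q" by (simp add: sublinear_def)
  then show thesis using lower that by blast
qed

text \<open>
  If \<open>q\<close> is minimal, then replacing it by \<open>v \<mapsto> inf {q (v + t w) - t q w | t \<ge> 0}\<close> changes nothing,
  and \<open>t = 1\<close> shows that \<open>q\<close> is superadditive.
\<close>

lemma minimal_sublinear_linear:
  assumes q: "sublinear q"
    and min: "\<And>q'. sublinear q' \<Longrightarrow> (\<And>v. q' v \<le> q v) \<Longrightarrow> q' = q"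
  shows "linear q"
proof -
  have ge: "q v + q w \<le> q (v + w)" for v w
  proof -
    define R where "R = {(t *\<^sub>R w, t * q w) | t. 0 \<le> t}"
    have R_I: "(k, r) \<in> R" if "0 \<le> t" "k = t *\<^sub>R w" "r = t * q w" for t k r
      using that by (auto simp: R_def)
    have scale: "t * q w \<le> q (t *\<^sub>R w)" if "0 \<le> t" for t
    proof (cases "t = 0")
      case False
      then show ?thesis
        using that sublinear_scale_le[OF q, of "inverse t" "t *\<^sub>R w"] by (simp add: field_simps)
    qed (simp add: sublinear_0[OF q])
    obtain q' where q': "sublinear q'" "\<And>v. q' v \<le> q v"
        "\<And>v k r. (k, r) \<in> R \<Longrightarrow> q' v \<le> q (v + k) - r"
    proof (rule sublinear_INF_cone[OF q, of R])
      show "(0, 0) \<in> R" by (rule R_I[of 0]) auto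
    next
      fix k r k' r' assume "(k, r) \<in> R" "(k', r') \<in> R"
      then obtain t t' where t: "0 \<le> t" "k = t *\<^sub>R w" "r = t * q w" "0 \<le> t'" "k' = t' *\<^sub>R w" "r' = t' * q w"
        by (auto simp: R_def)
      show "(k + k', r + r') \<in> R"
        using t by (intro R_I[of "t + t'"]) (auto simp: algebra_simps)
    next
      fix c :: real and k r assume "0 < c" "(k, r) \<in> R"
      then obtain t where t: "0 \<le> t" "k = t *\<^sub>R w" "r = t * q w"
        by (auto simp: R_def)
      then show "(c *\<^sub>R k, c * r) \<in> R"
        using \<open>0 < c\<close> by (intro R_I[of "c * t"]) auto
    next
      fix k r assume "(k, r) \<in> R"
      then show "r \<le> q k" using scale by (auto simp: R_def)
    qed auto
    have "(w, q w) \<in> R" by (rule R_I[of 1]) auto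
    then show ?thesis using q'(3)[of w "q w" v] min[OF q'(1,2)] by simp
  qed
  have add: "q (v + w) = q v + q w" for v w
    using ge[of v w] sublinear_add[OF q, of v w] by simp
  have minus: "q (- v) = - q v" for v
    using add[of v "- v"] sublinear_0[OF q] by simp
  have pos: "q (c *\<^sub>R v) = c * q v" if "0 < c" for c v
    using that sublinear_scale_le[OF q, of c v] sublinear_scale_le[OF q, of "inverse c" "c *\<^sub>R v"]
    by (simp add: field_simps)
  have "q (c *\<^sub>R v) = c * q v" for c v
  proof -
    consider "0 < c" | "c = 0" | "0 < - c" by linarith
    then show ?thesis
      by cases (use pos[of c v] pos[of "- c" v] minus[of "c *\<^sub>R v"] sublinear_0[OF q] in auto)
  qed
  with add show ?thesis by (auto intro: linearI)
qed

theorem hahn_banach_sublinear: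
  fixes p :: "'a::real_vector \<Rightarrow> real"
  assumes p: "sublinear p"
  obtains g where "linear g" "\<And>v. g v \<le> p v"
proof -
  define A where "A = {q. sublinear q \<and> (\<forall>v. q v \<le> p v)}"
  have "\<exists>m\<in>A. \<forall>a\<in>A. (\<forall>v. a v \<le> m v) \<longrightarrow> a = m"
  proof (rule predicate_Zorn)
    \<comment> \<open>The order is reversed, so that the maximal element of Zorn's lemma is a
      pointwise minimal sublinear functional.\<close>
    show "partial_order_on A (relation_of (\<lambda>m a. \<forall>v. a v \<le> m v) A)"
    proof (rule partial_order_on_relation_ofI)
      show "a = b" if "\<forall>v. b v \<le> a v" "\<forall>v. a v \<le> b v" for a b :: "'a \<Rightarrow> real"
        using that by (intro ext antisym) auto
    qed (auto intro: order_trans)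
  next
    fix C assume C: "C \<in> Chains (relation_of (\<lambda>m a. \<forall>v. a v \<le> m v) A)"
    show "\<exists>u\<in>A. \<forall>a\<in>C. \<forall>v. u v \<le> a v"
    proof (cases "C = {}")
      case True
      then show ?thesis using p by (auto simp: A_def)
    next
      case False
      have CA: "C \<subseteq> A" using C by (auto simp: Chains_def relation_of_def)
      obtain q where q: "sublinear q" "\<And>q' v. q' \<in> C \<Longrightarrow> q v \<le> q' v"
      proof (rule sublinear_INF_chain[OF False])
        show "(\<forall>v. q v \<le> q' v) \<or> (\<forall>v. q' v \<le> q v)" if "q \<in> C" "q' \<in> C" for q q'
          using C that by (auto simp: Chains_def relation_of_def)
      qed (use CA in \<open>auto simp: A_def\<close>)
      obtain q0 where "q0 \<in> C" using False by blast
      then have "q v \<le> p v" for v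
        using q(2)[of q0 v] CA by (force simp: A_def intro: order_trans)
      with q show ?thesis by (auto simp: A_def)
    qed
  qed
  then obtain m where m: "m \<in> A" "\<And>a. a \<in> A \<Longrightarrow> (\<And>v. a v \<le> m v) \<Longrightarrow> a = m" by blast
  then have "linear m"
    by (intro minimal_sublinear_linear) (auto simp: A_def intro: order_trans)
  then show thesis using m that by (auto simp: A_def)
qed

text \<open>This is separation of the convex hull of the \<open>y l\<close> from a ball of radius
  \<delta>. The demands form the cone generated by the pairs (y l, \<delta>); normalising
  coefficients turns \<open>far\<close> into their compatibility with the norm.\<close>

lemma mazur_sequence:
  fixes y :: "nat \<Rightarrow> 'a::real_normed_vector"
  assumes far: "\<And>c n. (\<And>l. 0 \<le> c l) \<Longrightarrow> (\<Sum>l<n. c l) = 1 \<Longrightarrow> \<delta> \<le> norm (\<Sum>l<n. c l *\<^sub>R y l)"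
  obtains g where "bounded_linear g" "\<And>l. \<delta> \<le> g (y l)"
proof -
  define R where "R = {(\<Sum>l<n. c l *\<^sub>R y l, \<delta> * (\<Sum>l<n. c l)) | c n. \<forall>l. 0 \<le> c l}"
  have R_I: "(k, r) \<in> R" if "\<forall>l. 0 \<le> c l" "k = (\<Sum>l<n. c l *\<^sub>R y l)" "r = \<delta> * (\<Sum>l<n. c l)" for k r c n
    using that by (auto simp: R_def)
  have sub: "sublinear (norm :: 'a \<Rightarrow> real)"
    by (auto simp: sublinear_def norm_triangle_ineq)
  obtain q where q: "sublinear q" "\<And>v. q v \<le> norm v" "\<And>v k r. (k, r) \<in> R \<Longrightarrow> q v \<le> norm (v + k) - r"
  proof (rule sublinear_INF_cone[OF sub, of R])
    show "(0, 0) \<in> R" by (rule R_I[where c = "\<lambda>_. 0" and n = 0]) auto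
  next
    fix k r k' r' assume "(k, r) \<in> R" "(k', r') \<in> R"
    then obtain c n c' n' where c: "\<forall>l. 0 \<le> c l" "k = (\<Sum>l<n. c l *\<^sub>R y l)" "r = \<delta> * (\<Sum>l<n. c l)"
      and c': "\<forall>l. 0 \<le> c' l" "k' = (\<Sum>l<n'. c' l *\<^sub>R y l)" "r' = \<delta> * (\<Sum>l<n'. c' l)"
      by (auto simp: R_def)
    define d where "d l = (if l < n then c l else 0) + (if l < n' then c' l else 0)" for l
    have ext: "(\<Sum>l<max n n'. if l < n then g l else 0) = (\<Sum>l<n. g l)"
      "(\<Sum>l<max n n'. if l < n' then g l else 0) = (\<Sum>l<n'. g l)" for g :: "nat \<Rightarrow> 'b::comm_monoid_add"
      by (rule sum.mono_neutral_cong_right; auto)+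
    have "(\<Sum>l<max n n'. d l) = (\<Sum>l<n. c l) + (\<Sum>l<n'. c' l)"
      by (simp add: d_def sum.distrib ext)
    moreover have "(\<Sum>l<max n n'. d l *\<^sub>R y l) = (\<Sum>l<max n n'. (if l < n then c l *\<^sub>R y l else 0) + (if l < n' then c' l *\<^sub>R y l else 0))"
      by (rule sum.cong) (auto simp: d_def algebra_simps)
    then have "(\<Sum>l<max n n'. d l *\<^sub>R y l) = k + k'"
      by (simp add: sum.distrib ext c c')
    ultimately show "(k + k', r + r') \<in> R"
      using c c' by (intro R_I[where c = d and n = "max n n'"]) (auto simp: d_def algebra_simps)
  next
    fix t :: real and k r assume t: "0 < t" and "(k, r) \<in> R"
    then obtain c n where c: "\<forall>l. 0 \<le> c l" "k = (\<Sum>l<n. c l *\<^sub>R y l)" "r = \<delta> * (\<Sum>l<n. c l)"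
      by (auto simp: R_def)
    show "(t *\<^sub>R k, t * r) \<in> R"
      using c t by (intro R_I[where c = "\<lambda>l. t * c l" and n = n])
        (auto simp: scaleR_sum_right sum_distrib_left mult_ac)
  next
    fix k r assume "(k, r) \<in> R"
    then obtain c n where c: "\<forall>l. 0 \<le> c l" "k = (\<Sum>l<n. c l *\<^sub>R y l)" "r = \<delta> * (\<Sum>l<n. c l)"
      by (auto simp: R_def)
    define s where "s = (\<Sum>l<n. c l)"
    have "0 \<le> s" using c by (auto simp: s_def intro: sum_nonneg)
    show "r \<le> norm k"
    proof (cases "s = 0")
      case True
      then show ?thesis using c by (simp add: s_def)
    next
      case False
      have "\<delta> \<le> norm (\<Sum>l<n. (c l / s) *\<^sub>R y l)"
        using c \<open>0 \<le> s\<close> False by (intro far) (auto simp: s_def simp flip: sum_divide_distrib)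
      also have "(\<Sum>l<n. (c l / s) *\<^sub>R y l) = (1 / s) *\<^sub>R k"
        by (simp add: c scaleR_sum_right)
      finally show ?thesis using c False \<open>0 \<le> s\<close> by (simp add: s_def field_simps)
    qed
  qed auto
  obtain g where g: "linear g" "\<And>v. g v \<le> q v" using hahn_banach_sublinear[OF q(1)] by blast
  have "\<bar>g v\<bar> \<le> norm v * 1" for v
    using g(2)[of v] g(2)[of "- v"] q(2)[of v] q(2)[of "- v"] linear_neg[OF g(1), of v] by auto
  then have "bounded_linear g"
    using g(1) by (auto intro!: bounded_linear_intro[where K = 1] simp: linear_add linear_scale)
  moreover have "\<delta> \<le> g (y l)" for l
  proof -
    have "(y l, \<delta>) \<in> R"
    proof (rule R_I[where c = "\<lambda>i. if i = l then 1 else 0" and n = "Suc l"])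
      have "(\<Sum>i<Suc l. (if i = l then 1 else 0) *\<^sub>R y i) = (\<Sum>i<Suc l. if i = l then y i else 0)"
        by (rule sum.cong) auto
      then show "y l = (\<Sum>i<Suc l. (if i = l then 1 else 0) *\<^sub>R y i)" by simp
    qed auto
    \<comment> \<open>At \<open>- y l\<close> the demand (y l, \<delta>) reads
      \<open>q (- y l) \<le> norm 0 - \<delta>\<close>.\<close>
    from q(3)[OF this, of "- y l"] g(2)[of "- y l"] show ?thesis
      by (simp add: linear_neg[OF g(1)])
  qed
  ultimately show thesis using that by blast
qed

text \<open>
  Mazur's lemma is applied to the pairs of \<open>y l\<close> and the \<open>l\<close>-th unit sequence. The unit sequences
  are weakly null because the sum of any number of them has norm \<open>1\<close>, and the second component of
  a convex combination consists of its coefficients.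
\<close>

lemma flat_convex_combination:
  fixes y :: "nat \<Rightarrow> 'a::real_normed_vector"
  assumes weak: "\<And>g :: 'a \<Rightarrow> real. bounded_linear g \<Longrightarrow> (\<lambda>l. g (y l)) \<longlonglongrightarrow> 0" and \<delta>: "0 < \<delta>"
  shows "\<exists>c n. (\<forall>l. 0 \<le> c l) \<and> (\<Sum>l<n. c l) = 1 \<and> norm (\<Sum>l<n. c l *\<^sub>R y l) < \<delta> \<and> (\<forall>l<n. c l < \<delta>)"
proof -
  define E :: "nat \<Rightarrow> (nat \<Rightarrow>\<^sub>C real)" where "E l = Bcontfun (\<lambda>i. if i = l then 1 else 0)" for l
  have E: "apply_bcontfun (E l) i = (if i = l then 1 else 0)" for l i
    unfolding E_def by (subst Bcontfun_inverse) (auto intro!: bcontfun_normI[where b = 1])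
  have ev: "apply_bcontfun (\<Sum>l\<in>A. c l *\<^sub>R E l) i = (if i \<in> A then c i else 0)"
    if "finite A" for A c i
    using that
  proof (induction A rule: finite_induct)
    case (insert l A)
    then show ?case by (auto simp: plus_bcontfun.rep_eq scaleR_bcontfun.rep_eq E)
  qed (simp add: zero_bcontfun.rep_eq)
  have "\<exists>c n. (\<forall>l. 0 \<le> c l) \<and> (\<Sum>l<n. c l) = 1 \<and> norm (\<Sum>l<n. c l *\<^sub>R (y l, E l)) < \<delta>"
  proof (rule ccontr)
    assume "\<not> ?thesis"
    then have "\<And>c n. (\<And>l. 0 \<le> c l) \<Longrightarrow> (\<Sum>l<n. c l) = 1 \<Longrightarrow> \<delta> \<le> norm (\<Sum>l<n. c l *\<^sub>R (y l, E l))"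
      by (meson not_le)
    then obtain g where g: "bounded_linear g" and ge: "\<And>l. \<delta> \<le> g (y l, E l)"
      using mazur_sequence[of \<delta> "\<lambda>l. (y l, E l)"] by blast
    interpret g: bounded_linear g by (rule g)
    \<comment> \<open>The part of \<open>g\<close> on the first component tends to 0 along
      \<open>y\<close>, so from some index on the unit sequences alone must carry at least
      \<open>\<delta> / 2\<close>.\<close>
    have "bounded_linear (\<lambda>v. g (v, 0))"
      by (rule bounded_linear_compose[OF g]) (simp add: bounded_linear_Pair bounded_linear_ident bounded_linear_zero)
    from LIMSEQ_D[OF weak[OF this], of "\<delta> / 2"] \<delta> obtain L where
      L: "\<And>l. L \<le> l \<Longrightarrow> \<bar>g (y l, 0)\<bar> < \<delta> / 2" by auto
    have half: "\<delta> / 2 \<le> g (0, E l)" if "L \<le> l" for l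
    proof -
      have "g (y l, E l) = g (y l, 0) + g (0, E l)" using g.add[of "(y l, 0)" "(0, E l)"] by simp
      then show ?thesis using ge[of l] L[OF that] by linarith
    qed
    obtain K where K: "0 < K" "\<And>v. norm (g v) \<le> norm v * K" using g.pos_bounded by blast
    obtain m where m: "2 * K / \<delta> < real m" using reals_Archimedean2 by blast
    let ?A = "{L..<L + m}"
    have "real m * (\<delta> / 2) \<le> (\<Sum>l\<in>?A. g (0, E l))"
      using sum_mono[of ?A "\<lambda>_. \<delta> / 2"] half by simp
    also have "\<dots> = g (\<Sum>l\<in>?A. (0, E l))" by (simp add: g.sum)
    also have "(\<Sum>l\<in>?A. (0, E l)) = (0, \<Sum>l\<in>?A. E l)"
      by (simp add: prod_eq_iff fst_sum snd_sum)
    also have "g (0, \<Sum>l\<in>?A. E l) \<le> norm (\<Sum>l\<in>?A. E l) * K"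
      using K(2)[of "(0, \<Sum>l\<in>?A. E l)"] by (simp add: norm_Pair)
    also have "norm (\<Sum>l\<in>?A. E l) \<le> 1"
      by (rule norm_bound) (use ev[of ?A "\<lambda>_. 1"] in auto)
    then have "norm (\<Sum>l\<in>?A. E l) * K \<le> K" using K(1) by simp
    finally show False using m \<delta> by (simp add: field_simps)
  qed
  then obtain c n where c: "\<And>l. 0 \<le> c l" "(\<Sum>l<n. c l) = 1" "norm (\<Sum>l<n. c l *\<^sub>R (y l, E l)) < \<delta>"
    by blast
  have split: "(\<Sum>l<n. c l *\<^sub>R (y l, E l)) = (\<Sum>l<n. c l *\<^sub>R y l, \<Sum>l<n. c l *\<^sub>R E l)"
    by (simp add: prod_eq_iff fst_sum snd_sum)
  have "norm (\<Sum>l<n. c l *\<^sub>R y l) < \<delta>"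
    using c(3) norm_fst_le[of "\<Sum>l<n. c l *\<^sub>R y l" "\<Sum>l<n. c l *\<^sub>R E l"] unfolding split by linarith
  moreover have "c l < \<delta>" if "l < n" for l
  proof -
    have "c l = apply_bcontfun (\<Sum>l<n. c l *\<^sub>R E l) l" using that by (simp add: ev)
    also have "\<dots> \<le> norm (\<Sum>l<n. c l *\<^sub>R E l)" using norm_bounded[of "\<Sum>l<n. c l *\<^sub>R E l" l] by simp
    also have "\<dots> < \<delta>"
      using c(3) norm_snd_le[of "\<Sum>l<n. c l *\<^sub>R E l" "\<Sum>l<n. c l *\<^sub>R y l"] unfolding split by linarith
    finally show ?thesis .
  qed
  ultimately show ?thesis using c(1,2) by (intro exI[of _ c] exI[of _ n]) simp
qed

subsection \<open>Finitely supported sequences\<close>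

definition trunc :: "nat \<Rightarrow> nat \<Rightarrow> (nat \<Rightarrow> real) \<Rightarrow> nat \<Rightarrow> real" where
  "trunc m n a i = (if m \<le> i \<and> i \<le> n then a i else 0)"

lemma c00_0: "a \<in> c00 \<Longrightarrow> a 0 = 0"
  by (simp add: c00_def)

lemma c00I: "a 0 = 0 \<Longrightarrow> (\<And>i. n < i \<Longrightarrow> a i = 0) \<Longrightarrow> a \<in> c00"
  unfolding c00_def using finite_subset[of "{i. a i \<noteq> 0}" "{..n}"]
  by (auto simp: not_le[symmetric])

lemma c00_bound:
  assumes "a \<in> c00"
  obtains n where "\<And>i. n < i \<Longrightarrow> a i = 0"
proof -
  have "finite {i. a i \<noteq> 0}" using assms by (simp add: c00_def)
  then obtain n where "\<forall>i\<in>{i. a i \<noteq> 0}. i \<le> n" using finite_nat_set_iff_bounded_le by blast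
  then show thesis by (intro that[of n]) (force simp: not_le[symmetric])
qed

lemma trunc_c00: "1 \<le> m \<Longrightarrow> trunc m n a \<in> c00"
  by (rule c00I[of _ n]) (auto simp: trunc_def)

lemma lin_comb_eq_sum:
  assumes "finite A" "\<And>i. a i \<noteq> 0 \<Longrightarrow> i \<in> A"
  shows "lin_comb a z = (\<Sum>i\<in>A. a i *\<^sub>R z i)"
  unfolding lin_comb_def using assms by (intro sum.mono_neutral_left) auto

lemma lin_comb_upto:
  assumes "a \<in> c00" "\<And>i. n < i \<Longrightarrow> a i = 0"
  shows "lin_comb a z = (\<Sum>i=1..n. a i *\<^sub>R z i)"
proof (rule lin_comb_eq_sum)
  fix i assume "a i \<noteq> 0"
  then show "i \<in> {1..n}" using assms(2)[of i] c00_0[OF assms(1)] by (cases "i = 0"; cases "n < i") auto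
qed simp

lemma lin_comb_trunc: "lin_comb (trunc m n a) z = (\<Sum>i=m..n. a i *\<^sub>R z i)"
proof -
  have "lin_comb (trunc m n a) z = (\<Sum>i=m..n. trunc m n a i *\<^sub>R z i)"
    by (rule lin_comb_eq_sum) (auto simp: trunc_def split: if_splits)
  then show ?thesis by (simp add: trunc_def)
qed

lemma c00_sum: "finite L \<Longrightarrow> (\<And>l. l \<in> L \<Longrightarrow> u l \<in> c00) \<Longrightarrow> (\<lambda>i. \<Sum>l\<in>L. c l * u l i) \<in> c00"
proof (induction L rule: finite_induct)
  case empty
  then show ?case by (simp add: c00_def)
next
  case (insert l L)
  then have u: "u l \<in> c00" and S: "(\<lambda>i. \<Sum>l\<in>L. c l * u l i) \<in> c00" by auto
  obtain m where m: "\<And>i. m < i \<Longrightarrow> u l i = 0" using c00_bound[OF u] by blast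
  obtain n where n: "\<And>i. n < i \<Longrightarrow> (\<Sum>l\<in>L. c l * u l i) = 0" using c00_bound[OF S] by blast
  show ?case
    using insert(1,2) c00_0[OF u] c00_0[OF S] m n
    by (intro c00I[of _ "max m n"]) auto
qed

lemma lin_comb_sum:
  assumes "finite L" "\<And>l. l \<in> L \<Longrightarrow> u l \<in> c00"
  shows "lin_comb (\<lambda>i. \<Sum>l\<in>L. c l * u l i) z = (\<Sum>l\<in>L. c l *\<^sub>R lin_comb (u l) z)"
proof -
  define A where "A = (\<Union>l\<in>L. {i. u l i \<noteq> 0})"
  have A: "finite A" using assms by (auto simp: A_def c00_def)
  have "lin_comb (\<lambda>i. \<Sum>l\<in>L. c l * u l i) z = (\<Sum>i\<in>A. (\<Sum>l\<in>L. c l * u l i) *\<^sub>R z i)"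
  proof (rule lin_comb_eq_sum[OF A])
    fix i assume "(\<Sum>l\<in>L. c l * u l i) \<noteq> 0"
    then obtain l where "l \<in> L" "c l * u l i \<noteq> 0" by (rule sum.not_neutral_contains_not_neutral)
    then show "i \<in> A" by (auto simp: A_def)
  qed
  also have "\<dots> = (\<Sum>l\<in>L. \<Sum>i\<in>A. (c l * u l i) *\<^sub>R z i)"
    by (subst sum.swap) (simp add: scaleR_sum_left)
  also have "\<dots> = (\<Sum>l\<in>L. c l *\<^sub>R lin_comb (u l) z)"
  proof (rule sum.cong)
    fix l assume "l \<in> L"
    then have "lin_comb (u l) z = (\<Sum>i\<in>A. u l i *\<^sub>R z i)"
      using A by (intro lin_comb_eq_sum) (auto simp: A_def)
    then show "(\<Sum>i\<in>A. (c l * u l i) *\<^sub>R z i) = c l *\<^sub>R lin_comb (u l) z"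
      by (simp add: scaleR_sum_right)
  qed simp
  finally show ?thesis .
qed

lemma lin_comb_diff:
  assumes "a \<in> c00" "b \<in> c00"
  shows "(\<lambda>i. a i - b i) \<in> c00" "lin_comb (\<lambda>i. a i - b i) z = lin_comb a z - lin_comb b z"
proof -
  \<comment> \<open>Summing over the two truth values makes the difference an instance of the lemmas
    on finite sums.\<close>
  define u where "u l = (if l then a else b)" for l
  define c where "c l = (if l then 1 else - 1 :: real)" for l
  have eq: "(\<lambda>i. a i - b i) = (\<lambda>i. \<Sum>l\<in>UNIV. c l * u l i)"
    by (auto simp: UNIV_bool c_def u_def)
  have u: "\<And>l. l \<in> UNIV \<Longrightarrow> u l \<in> c00" using assms by (simp add: u_def)
  show "(\<lambda>i. a i - b i) \<in> c00" unfolding eq by (rule c00_sum[OF _ u]) simp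
  have "lin_comb (\<lambda>i. a i - b i) z = (\<Sum>l\<in>UNIV. c l *\<^sub>R lin_comb (u l) z)"
    unfolding eq by (rule lin_comb_sum[OF _ u]) simp
  then show "lin_comb (\<lambda>i. a i - b i) z = lin_comb a z - lin_comb b z"
    by (simp add: UNIV_bool c_def u_def)
qed

lemma c00_scale: "a \<in> c00 \<Longrightarrow> (\<lambda>i. c * a i) \<in> c00"
  by (cases "c = 0") (auto simp: c00_def)

lemma lin_comb_scale: "lin_comb (\<lambda>i. c * a i) z = c *\<^sub>R lin_comb a z"
  by (cases "c = 0") (auto simp: lin_comb_def scaleR_sum_right)

lemma span_eq_lin_comb: "v \<in> span (z ` {1..}) \<longleftrightarrow> (\<exists>a\<in>c00. v = lin_comb a z)"
proof
  assume "v \<in> span (z ` {1..})"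
  then show "\<exists>a\<in>c00. v = lin_comb a z"
  proof (induction rule: span_induct_alt)
    case base
    have "(\<lambda>_. 0) \<in> c00" "lin_comb (\<lambda>_. 0) z = 0" by (auto simp: c00_def lin_comb_def)
    then show ?case by metis
  next
    case (step c x y)
    then obtain j a where j: "1 \<le> j" "x = z j" and a: "a \<in> c00" "y = lin_comb a z" by auto
    \<comment> \<open>The minus sign turns adding \<open>c *\<^sub>R x\<close> into a difference, so
      that \<open>lin_comb_diff\<close> applies.\<close>
    define e where "e i = (if i = j then - c else 0)" for i
    have e: "e \<in> c00" using j by (intro c00I[of _ j]) (auto simp: e_def)
    have "lin_comb e z = (\<Sum>i\<in>{j}. e i *\<^sub>R z i)"
      by (rule lin_comb_eq_sum) (auto simp: e_def split: if_splits)
    then have "c *\<^sub>R x + y = lin_comb (\<lambda>i. a i - e i) z"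
      using lin_comb_diff(2)[OF a(1) e, of z] by (simp add: e_def a j)
    then show ?case using lin_comb_diff(1)[OF a(1) e] by blast
  qed
next
  assume "\<exists>a\<in>c00. v = lin_comb a z"
  then obtain a where a: "a \<in> c00" "v = lin_comb a z" by blast
  show "v \<in> span (z ` {1..})"
    unfolding a(2) lin_comb_def
  proof (intro span_sum span_scale span_base imageI)
    fix i assume "i \<in> {i. a i \<noteq> 0}"
    then show "i \<in> {1..}" using c00_0[OF a(1)] by (cases "i = 0") auto
  qed
qed

subsection \<open>Schauder bases\<close>

lemma basis_expansion_lin_comb:
  assumes "a \<in> c00"
  shows "basis_expansion z (lin_comb a z) a"
proof -
  obtain n where n: "\<And>i. n < i \<Longrightarrow> a i = 0" using c00_bound[OF assms] by blast
  have "(\<Sum>i=1..m. a i *\<^sub>R z i) = lin_comb a z" if "n \<le> m" for m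
    using lin_comb_upto[OF assms, of m z] n that by auto
  then have "\<forall>\<^sub>F m in sequentially. (\<Sum>i=1..m. a i *\<^sub>R z i) = lin_comb a z"
    using eventually_sequentially by blast
  then show ?thesis
    using c00_0[OF assms] by (auto simp: basis_expansion_def intro: tendsto_eventually)
qed

lemma basis_expansion_add:
  "basis_expansion z v a \<Longrightarrow> basis_expansion z w b \<Longrightarrow> basis_expansion z (v + w) (\<lambda>i. a i + b i)"
  by (auto simp: basis_expansion_def algebra_simps sum.distrib dest: tendsto_add)

lemma basis_expansion_scale:
  "basis_expansion z v a \<Longrightarrow> basis_expansion z (c *\<^sub>R v) (\<lambda>i. c * a i)"
  unfolding basis_expansion_def scaleR_scaleR[symmetric] scaleR_sum_right[symmetric]
  by (simp add: tendsto_scaleR)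

lemma basis_expansion_diff:
  "basis_expansion z v a \<Longrightarrow> basis_expansion z w b \<Longrightarrow> basis_expansion z (v - w) (\<lambda>i. a i - b i)"
  by (auto simp: basis_expansion_def algebra_simps sum_subtractf dest: tendsto_diff)

lemma biorthogonal_eq:
  assumes "schauder_basis Z z" "v \<in> Z" "basis_expansion z v a"
  shows "biorthogonal z i v = a i"
  unfolding biorthogonal_def using assms by (metis schauder_basis_def the1_equality)

lemma biorthogonal_expansion:
  assumes "schauder_basis Z z" "v \<in> Z"
  shows "basis_expansion z v (\<lambda>i. biorthogonal z i v)"
proof -
  obtain a where a: "basis_expansion z v a" using assms by (metis schauder_basis_def)
  then have "(\<lambda>i. biorthogonal z i v) = a" using biorthogonal_eq[OF assms] by blast
  with a show ?thesis by simp
qed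

text \<open>Otherwise 0 would have two expansions, the zero sequence and a unit sequence.\<close>

lemma schauder_basis_nonzero:
  assumes "schauder_basis Z z" "1 \<le> i"
  shows "z i \<noteq> 0"
proof
  assume z: "z i = 0"
  define e where "e j = (if j = i then 1 else 0 :: real)" for j
  have e: "e \<in> c00" using assms by (intro c00I[of _ i]) (auto simp: e_def)
  have "lin_comb e z = (\<Sum>j\<in>{i}. e j *\<^sub>R z j)"
    by (rule lin_comb_eq_sum) (auto simp: e_def split: if_splits)
  then have "basis_expansion z 0 e" using basis_expansion_lin_comb[OF e, of z] z by simp
  moreover have "basis_expansion z 0 (\<lambda>_. 0)" by (simp add: basis_expansion_def)
  moreover have "0 \<in> Z" using assms by (auto simp: schauder_basis_def subspace_0)
  ultimately have "e = (\<lambda>_. 0)" using assms(1) unfolding schauder_basis_def by metis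
  then have "e i = 0" by metis
  then show False by (simp add: e_def)
qed

lemma lin_comb_in_basis:
  assumes "schauder_basis Z z" "a \<in> c00"
  shows "lin_comb a z \<in> Z"
  unfolding lin_comb_def
proof (intro subspace_sum subspace_scale)
  fix i assume "i \<in> {i. a i \<noteq> 0}"
  then have "1 \<le> i" using c00_0[OF assms(2)] by (cases "i = 0") auto
  then show "z i \<in> Z" using assms by (auto simp: schauder_basis_def)
qed (use assms in \<open>auto simp: schauder_basis_def\<close>)

lemma norm_coefficient_le:
  fixes z :: "nat \<Rightarrow> 'a::real_normed_vector"
  assumes "\<And>n. norm (\<Sum>i=1..n. a i *\<^sub>R z i) \<le> B" "1 \<le> i"
  shows "\<bar>a i\<bar> * norm (z i) \<le> 2 * B"
proof -
  obtain j where j: "i = Suc j" using assms(2) by (cases i) auto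
  have "a i *\<^sub>R z i = (\<Sum>i=1..i. a i *\<^sub>R z i) - (\<Sum>i=1..j. a i *\<^sub>R z i)"
    by (simp add: j)
  then have "norm (a i *\<^sub>R z i) \<le> norm (\<Sum>i=1..i. a i *\<^sub>R z i) + norm (\<Sum>i=1..j. a i *\<^sub>R z i)"
    by (metis norm_triangle_ineq4)
  then show ?thesis using assms(1)[of i] assms(1)[of j] by simp
qed

text \<open>The uniformity in \<open>n\<close> of the Cauchy condition does the work: it makes every
  coordinate converge, because \<open>z i \<noteq> 0\<close>, and it lets the limits in
  \<open>l\<close> and \<open>n\<close> be exchanged. This works where partial sums are not known to
  depend continuously on the vector.\<close>

lemma basis_expansion_limit:
  fixes z :: "nat \<Rightarrow> 'a::real_normed_vector"
  assumes nz: "\<And>i. 1 \<le> i \<Longrightarrow> z i \<noteq> 0"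
    and exp: "\<And>l. basis_expansion z (v l) (a l)"
    and lim: "v \<longlonglongrightarrow> v'"
    and cauchy: "\<And>e. 0 < e \<Longrightarrow> \<exists>L. \<forall>l\<ge>L. \<forall>l'\<ge>L. \<forall>n. norm (\<Sum>i=1..n. (a l i - a l' i) *\<^sub>R z i) \<le> e"
  shows "\<exists>b. basis_expansion z v' b \<and> (\<forall>i. (\<lambda>l. a l i) \<longlonglongrightarrow> b i)"
proof -
  have "Cauchy (\<lambda>l. a l i)" for i
  proof (cases "i = 0")
    case True
    then show ?thesis using exp by (simp add: basis_expansion_def Cauchy_def)
  next
    case False
    then have i: "1 \<le> i" by simp
    show ?thesis
    proof (rule metric_CauchyI)
      fix e :: real assume "0 < e"
      then have "0 < e * norm (z i) / 4" using nz[OF i] by simp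
      from cauchy[OF this] obtain L where
        L: "\<And>l l' n. L \<le> l \<Longrightarrow> L \<le> l' \<Longrightarrow> norm (\<Sum>i=1..n. (a l i - a l' i) *\<^sub>R z i) \<le> e * norm (z i) / 4"
        by blast
      have "dist (a l i) (a l' i) < e" if "L \<le> l" "L \<le> l'" for l l'
        using norm_coefficient_le[OF L[OF that] i] nz[OF i] \<open>0 < e\<close>
        by (simp add: dist_real_def field_simps)
      then show "\<exists>L. \<forall>l\<ge>L. \<forall>l'\<ge>L. dist (a l i) (a l' i) < e" by blast
    qed
  qed
  then have "\<forall>i. \<exists>b. (\<lambda>l. a l i) \<longlonglongrightarrow> b"
    unfolding Cauchy_convergent_iff convergent_def by blast
  then obtain b where b: "\<And>i. (\<lambda>l. a l i) \<longlonglongrightarrow> b i"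
    by metis
  have "(\<lambda>n. \<Sum>i=1..n. b i *\<^sub>R z i) \<longlonglongrightarrow> v'"
  proof (rule LIMSEQ_I)
    fix e :: real assume e: "0 < e"
    then obtain L where
      L: "\<And>l l' n. L \<le> l \<Longrightarrow> L \<le> l' \<Longrightarrow> norm (\<Sum>i=1..n. (a l i - a l' i) *\<^sub>R z i) \<le> e / 4"
      using cauchy[of "e / 4"] by auto
    obtain L' where L': "\<And>l. L' \<le> l \<Longrightarrow> norm (v l - v') < e / 4"
      using LIMSEQ_D[OF lim, of "e / 4"] e by auto
    define l where "l = max L L'"
    have bl: "norm (\<Sum>i=1..n. (a l i - b i) *\<^sub>R z i) \<le> e / 4" for n
    proof (rule tendsto_upperbound)
      show "(\<lambda>l'. norm (\<Sum>i=1..n. (a l i - a l' i) *\<^sub>R z i)) \<longlonglongrightarrow> norm (\<Sum>i=1..n. (a l i - b i) *\<^sub>R z i)"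
        by (intro tendsto_intros b)
      show "\<forall>\<^sub>F l' in sequentially. norm (\<Sum>i=1..n. (a l i - a l' i) *\<^sub>R z i) \<le> e / 4"
        using L[of l] by (auto simp: l_def eventually_sequentially)
    qed simp
    have "(\<lambda>n. \<Sum>i=1..n. a l i *\<^sub>R z i) \<longlonglongrightarrow> v l" using exp[of l] by (simp add: basis_expansion_def)
    from LIMSEQ_D[OF this, of "e / 4"] e obtain n0 where
      n0: "\<And>n. n0 \<le> n \<Longrightarrow> norm ((\<Sum>i=1..n. a l i *\<^sub>R z i) - v l) < e / 4" by auto
    have "norm ((\<Sum>i=1..n. b i *\<^sub>R z i) - v') < e" if "n0 \<le> n" for n
    proof -
      let ?A = "(\<Sum>i=1..n. a l i *\<^sub>R z i) - v l" and ?B = "v l - v'"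
        and ?C = "\<Sum>i=1..n. (a l i - b i) *\<^sub>R z i"
      have eq: "(\<Sum>i=1..n. b i *\<^sub>R z i) - v' = ?A + ?B - ?C"
        by (simp add: algebra_simps sum_subtractf)
      have "norm ((\<Sum>i=1..n. b i *\<^sub>R z i) - v') \<le> norm ?A + norm ?B + norm ?C"
        unfolding eq using norm_triangle_ineq4[of "?A + ?B" ?C] norm_triangle_ineq[of ?A ?B] by linarith
      then show ?thesis using n0[OF that] L'[of l] bl[of n] e by (simp add: l_def)
    qed
    then show "\<exists>n0. \<forall>n\<ge>n0. norm ((\<Sum>i=1..n. b i *\<^sub>R z i) - v') < e" by blast
  qed
  moreover have "b 0 = 0"
    using b[of 0] exp by (simp add: basis_expansion_def LIMSEQ_const_iff)
  ultimately show ?thesis using b by (auto simp: basis_expansion_def)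
qed

lemma biorthogonal_add:
  assumes "schauder_basis Z z" "u \<in> Z" "v \<in> Z"
  shows "biorthogonal z i (u + v) = biorthogonal z i u + biorthogonal z i v"
  using assms basis_expansion_add[OF biorthogonal_expansion biorthogonal_expansion, of Z z u Z v]
  by (intro biorthogonal_eq[of Z]) (auto simp: schauder_basis_def subspace_add)

lemma biorthogonal_diff:
  assumes "schauder_basis Z z" "u \<in> Z" "v \<in> Z"
  shows "biorthogonal z i (u - v) = biorthogonal z i u - biorthogonal z i v"
  using assms basis_expansion_diff[OF biorthogonal_expansion biorthogonal_expansion, of Z z u Z v]
  by (intro biorthogonal_eq[of Z]) (auto simp: schauder_basis_def subspace_diff)

lemma biorthogonal_scale:
  assumes "schauder_basis Z z" "v \<in> Z"
  shows "biorthogonal z i (c *\<^sub>R v) = c * biorthogonal z i v"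
  using assms basis_expansion_scale[OF biorthogonal_expansion, of Z z v c]
  by (intro biorthogonal_eq[of Z]) (auto simp: schauder_basis_def subspace_scale)

lemma biorthogonal_lin_comb:
  assumes "schauder_basis Z z" "a \<in> c00"
  shows "biorthogonal z i (lin_comb a z) = a i"
  using assms by (intro biorthogonal_eq lin_comb_in_basis basis_expansion_lin_comb)

lemma subspace_closure:
  fixes S :: "'a::real_normed_vector set"
  assumes "subspace S"
  shows "subspace (closure S)"
proof (rule subspaceI)
  show "0 \<in> closure S" using subspace_0[OF assms] closure_subset by blast
next
  fix u v assume "u \<in> closure S" "v \<in> closure S"
  then obtain s t where "\<And>n. s n \<in> S" "s \<longlonglongrightarrow> u" "\<And>n. t n \<in> S" "t \<longlonglongrightarrow> v"
    unfolding closure_sequential by blast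
  then have "\<And>n. s n + t n \<in> S" "(\<lambda>n. s n + t n) \<longlonglongrightarrow> u + v"
    by (auto intro: subspace_add[OF assms] tendsto_add)
  then show "u + v \<in> closure S" unfolding closure_sequential by (intro exI[of _ "\<lambda>n. s n + t n"]) auto
next
  fix c u assume "u \<in> closure S"
  then obtain s where "\<And>n. s n \<in> S" "s \<longlonglongrightarrow> u" unfolding closure_sequential by blast
  then have "\<And>n. c *\<^sub>R s n \<in> S" "(\<lambda>n. c *\<^sub>R s n) \<longlonglongrightarrow> c *\<^sub>R u"
    by (auto intro: subspace_scale[OF assms] tendsto_intros)
  then show "c *\<^sub>R u \<in> closure S" unfolding closure_sequential by (intro exI[of _ "\<lambda>n. c *\<^sub>R s n"]) auto
qed

section \<open>The basis constant via Baire category\<close>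

lemma Baire_ball:
  fixes A :: "nat \<Rightarrow> 'a::banach set"
  assumes "(\<Union>M. A M) = UNIV"
  obtains M x0 r where "0 < r" "ball x0 r \<subseteq> closure (A M)"
proof -
  have "\<exists>M. interior (closure (A M)) \<noteq> {}"
  proof (rule ccontr)
    assume "\<not> ?thesis"
    then have "euclidean interior_of \<Union>(range (\<lambda>M. closure (A M))) = {}"
      by (intro Baire_category_alt) (auto simp: completely_metrizable_space_euclidean)
    moreover have "\<Union>(range (\<lambda>M. closure (A M))) = UNIV"
      using assms closure_subset by blast
    ultimately show False by simp
  qed
  then show thesis using that by (metis ex_in_conv mem_interior)
qed

text \<open>Baire is applied to the sets \<open>A M\<close> of vectors whose partial sums are all
  bounded by M. These need not be closed, so one of them is only found to be dense in a ball;
  differences of its elements approximate every small vector, and rescaling gives the relative error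
  1/2.\<close>

lemma schauder_basis_approx:
  fixes w :: "nat \<Rightarrow> 'w::banach"
  assumes w: "schauder_basis UNIV w"
  obtains C where "0 \<le> C" "\<And>v. \<exists>u. (\<forall>n. norm (\<Sum>i=1..n. biorthogonal w i u *\<^sub>R w i) \<le> C * norm v) \<and>
    norm (v - u) \<le> norm v / 2"
proof -
  define Q where "Q n v = (\<Sum>i=1..n. biorthogonal w i v *\<^sub>R w i)" for n v
  have Qdiff: "Q n (u - v) = Q n u - Q n v" for n u v
    by (simp add: Q_def biorthogonal_diff[OF w] algebra_simps sum_subtractf)
  have Qscale: "Q n (c *\<^sub>R v) = c *\<^sub>R Q n v" for n c v
    by (simp add: Q_def biorthogonal_scale[OF w] scaleR_sum_right)
  define A where "A M = {v. \<forall>n. norm (Q n v) \<le> real M}" for M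
  have "\<exists>M. v \<in> A M" for v
  proof -
    have "(\<lambda>n. Q n v) \<longlonglongrightarrow> v"
      using biorthogonal_expansion[OF w, of v] by (simp add: basis_expansion_def Q_def)
    then have "Bseq (\<lambda>n. Q n v)" by (intro convergent_imp_Bseq convergentI)
    then obtain B where B: "\<forall>n. norm (Q n v) \<le> B" by (rule BseqE)
    obtain M where "B \<le> real M" using real_arch_simple by blast
    then have "norm (Q n v) \<le> real M" for n using B order_trans by blast
    then show ?thesis by (auto simp: A_def)
  qed
  then have "(\<Union>M. A M) = UNIV" by blast
  then obtain M x0 r where r: "0 < r" "ball x0 r \<subseteq> closure (A M)"
    by (rule Baire_ball)
  have near: "\<exists>u. (\<forall>n. norm (Q n u) \<le> 2 * real M) \<and> norm (v - u) \<le> r / 4" if "norm v < r" for v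
  proof -
    have "x0 + v \<in> closure (A M)" "x0 \<in> closure (A M)"
      using r that by (auto simp: dist_norm intro!: subsetD[OF r(2)])
    then obtain a1 a2 where a: "a1 \<in> A M" "dist a1 (x0 + v) < r / 8" "a2 \<in> A M" "dist a2 x0 < r / 8"
      using r(1) unfolding closure_approachable by (metis divide_pos_pos zero_less_numeral)
    have "norm (Q n (a1 - a2)) \<le> 2 * real M" for n
    proof -
      have "norm (Q n a1) \<le> real M" "norm (Q n a2) \<le> real M" using a by (auto simp: A_def)
      then show ?thesis unfolding Qdiff using norm_triangle_ineq4[of "Q n a1" "Q n a2"] by linarith
    qed
    moreover have "norm (v - (a1 - a2)) \<le> r / 4"
    proof -
      have eq: "v - (a1 - a2) = (a2 - x0) - (a1 - (x0 + v))" by simp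
      show ?thesis unfolding eq
        using norm_triangle_ineq4[of "a2 - x0" "a1 - (x0 + v)"] a by (simp add: dist_norm)
    qed
    ultimately show ?thesis by blast
  qed
  have "\<exists>u. (\<forall>n. norm (Q n u) \<le> (4 * real M / r) * norm v) \<and> norm (v - u) \<le> norm v / 2" for v
  proof (cases "v = 0")
    case True
    have "Q n 0 = 0" for n using Qscale[of n 0 0] by simp
    then show ?thesis using True by (intro exI[of _ 0]) auto
  next
    case False
    \<comment> \<open>Scales \<open>v\<close> to norm \<open>r / 2\<close>; the error
      \<open>r / 4\<close> then scales back to \<open>norm v / 2\<close>.\<close>
    define s where "s = r / (2 * norm v)"
    have s: "0 < s" using False r(1) by (simp add: s_def)
    have "norm (s *\<^sub>R v) < r" using False r(1) by (simp add: s_def)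
    from near[OF this] obtain u where u: "\<And>n. norm (Q n u) \<le> 2 * real M" "norm (s *\<^sub>R v - u) \<le> r / 4"
      by blast
    have "v - (1 / s) *\<^sub>R u = (1 / s) *\<^sub>R (s *\<^sub>R v - u)" using s by (simp add: algebra_simps)
    then have "norm (v - (1 / s) *\<^sub>R u) = norm (s *\<^sub>R v - u) / s" using s by simp
    also have "\<dots> \<le> (r / 4) / s" using u(2) s by (intro divide_right_mono) auto
    also have "\<dots> = norm v / 2" using r(1) False by (simp add: s_def)
    finally have "norm (v - (1 / s) *\<^sub>R u) \<le> norm v / 2" .
    moreover have "norm (Q n ((1 / s) *\<^sub>R u)) \<le> (4 * real M / r) * norm v" for n
    proof -
      have "norm (Q n ((1 / s) *\<^sub>R u)) = norm (Q n u) / s" using s by (simp add: Qscale)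
      also have "\<dots> \<le> 2 * real M / s" using u(1) s by (intro divide_right_mono) auto
      also have "\<dots> = (4 * real M / r) * norm v" using r(1) False by (simp add: s_def)
      finally show ?thesis .
    qed
    ultimately show ?thesis by blast
  qed
  then show thesis using that[of "4 * real M / r"] r(1) by (auto simp: Q_def)
qed

text \<open>
  The partial sum operators are not known to be continuous yet. Iterating the approximation writes
  \<open>v\<close> as a series of vectors with geometrically decreasing bounds on all their partial sums, and
  uniqueness of the expansion identifies the partial sums of \<open>v\<close> with those of the series.
\<close>

theorem schauder_basis_constant:
  fixes w :: "nat \<Rightarrow> 'w::banach"
  assumes w: "schauder_basis UNIV w"
  obtains K where "0 < K" "\<And>v n. norm (\<Sum>i=1..n. biorthogonal w i v *\<^sub>R w i) \<le> K * norm v"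
proof -
  define Q where "Q n v = (\<Sum>i=1..n. biorthogonal w i v *\<^sub>R w i)" for n v
  obtain C where C: "0 \<le> C" and ex: "\<And>v. \<exists>u. (\<forall>n. norm (Q n u) \<le> C * norm v) \<and> norm (v - u) \<le> norm v / 2"
    using schauder_basis_approx[OF w] unfolding Q_def by blast
  have "\<exists>U. \<forall>v. (\<forall>n. norm (Q n (U v)) \<le> C * norm v) \<and> norm (v - U v) \<le> norm v / 2"
    by (rule choice) (use ex in blast)
  then obtain U where U: "\<And>v n. norm (Q n (U v)) \<le> C * norm v" "\<And>v. norm (v - U v) \<le> norm v / 2"
    by blast
  have Qdiff: "Q n (u - v) = Q n u - Q n v" for n u v
    by (simp add: Q_def biorthogonal_diff[OF w] algebra_simps sum_subtractf)
  have Qadd: "Q n (u + v) = Q n u + Q n v" for n u v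
    by (simp add: Q_def biorthogonal_add[OF w] algebra_simps sum.distrib)
  have "norm (Q n v) \<le> 2 * C * norm v" for n v
  proof -
    \<comment> \<open>\<open>R j\<close> is the remainder after j approximation steps, so
      \<open>R l - R (l + d)\<close> is the sum of \<open>U (R j)\<close> over
      \<open>l \<le> j < l + d\<close>.\<close>
    define R where "R = rec_nat v (\<lambda>_ r. r - U r)"
    have R0: "R 0 = v" and RS: "R (Suc j) = R j - U (R j)" for j by (simp_all add: R_def)
    have R: "norm (R j) \<le> norm v / 2 ^ j" for j
    proof (induction j)
      case (Suc j)
      have "norm (R (Suc j)) \<le> norm (R j) / 2" using U(2)[of "R j"] by (simp add: RS)
      then show ?case using Suc by simp
    qed (simp add: R0)
    have Q0: "Q n 0 = 0" for n using Qdiff[of n 0 0] by simp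
    \<comment> \<open>The last factor is the closed form of the sum of \<open>1 / 2 ^ j\<close> over
      \<open>l \<le> j < l + d\<close>.\<close>
    have QR: "norm (Q n (R l - R (l + d))) \<le> C * norm v * (2 / 2 ^ l - 2 / 2 ^ (l + d))" for n l d
    proof (induction d)
      case (Suc d)
      have eq: "R l - R (l + Suc d) = (R l - R (l + d)) + U (R (l + d))" by (simp add: RS)
      have "norm (Q n (R l - R (l + Suc d))) \<le> norm (Q n (R l - R (l + d))) + norm (Q n (U (R (l + d))))"
        unfolding eq Qadd by (rule norm_triangle_ineq)
      also have "norm (Q n (U (R (l + d)))) \<le> C * (norm v / 2 ^ (l + d))"
        using U(1)[of n "R (l + d)"] mult_left_mono[OF R[of "l + d"] C] by linarith
      finally have "norm (Q n (R l - R (l + Suc d))) \<le> norm (Q n (R l - R (l + d))) + C * (norm v / 2 ^ (l + d))"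
        by simp
      moreover have "C * norm v * (2 / 2 ^ l - 2 / 2 ^ (l + Suc d)) =
          C * norm v * (2 / 2 ^ l - 2 / 2 ^ (l + d)) + C * (norm v / 2 ^ (l + d))"
        by (simp add: field_simps)
      ultimately show ?case using Suc by linarith
    qed (simp add: Q0)
    have QR': "norm (Q n (R l - R l')) \<le> C * norm v * (2 / 2 ^ l)" if "l \<le> l'" for n l l'
    proof -
      have "C * norm v * (2 / 2 ^ l - 2 / 2 ^ (l + (l' - l))) \<le> C * norm v * (2 / 2 ^ l)"
        using C by (intro mult_left_mono) auto
      then show ?thesis using QR[of n l "l' - l"] that by simp
    qed
    have lim: "(\<lambda>l. norm v / 2 ^ l) \<longlonglongrightarrow> 0"
      using LIMSEQ_divide_realpow_zero[of 2 "norm v"] by simp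
    have "R \<longlonglongrightarrow> 0"
      by (rule Lim_null_comparison[OF _ lim]) (use R in auto)
    then have V: "(\<lambda>l. v - R l) \<longlonglongrightarrow> v" using tendsto_diff[OF tendsto_const[of v]] by force
    have "\<exists>b. basis_expansion w v b \<and> (\<forall>i. (\<lambda>l. biorthogonal w i (v - R l)) \<longlonglongrightarrow> b i)"
    proof (rule basis_expansion_limit[OF schauder_basis_nonzero[OF w] _ V])
      show "basis_expansion w (v - R l) (\<lambda>i. biorthogonal w i (v - R l))" for l
        by (rule biorthogonal_expansion[OF w]) simp
      fix e :: real assume "0 < e"
      have "(\<lambda>l. C * norm v * (2 / 2 ^ l)) \<longlonglongrightarrow> 0"
        using tendsto_mult[OF tendsto_const[of "2 * C"] lim] by (simp add: mult_ac)
      from LIMSEQ_D[OF this \<open>0 < e\<close>] C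
      obtain L where L: "\<And>l. L \<le> l \<Longrightarrow> C * norm v * (2 / 2 ^ l) < e" by auto
      have "norm (\<Sum>i=1..n. (biorthogonal w i (v - R l) - biorthogonal w i (v - R l')) *\<^sub>R w i) \<le> e"
        if "L \<le> l" "L \<le> l'" for l l' n
      proof -
        have "(\<Sum>i=1..n. (biorthogonal w i (v - R l) - biorthogonal w i (v - R l')) *\<^sub>R w i) = Q n (R l' - R l)"
          by (simp add: Q_def biorthogonal_diff[OF w] algebra_simps sum_subtractf)
        moreover have "norm (Q n (R l' - R l)) \<le> e"
        proof (cases "l \<le> l'")
          case True
          then show ?thesis using QR'[OF True, of n] L[OF that(1)]
            by (simp add: Qdiff norm_minus_commute)
        next
          case False
          then show ?thesis using QR'[of l' l n] L[OF that(2)] by simp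
        qed
        ultimately show ?thesis by simp
      qed
      then show "\<exists>L. \<forall>l\<ge>L. \<forall>l'\<ge>L. \<forall>n. norm (\<Sum>i=1..n.
          (biorthogonal w i (v - R l) - biorthogonal w i (v - R l')) *\<^sub>R w i) \<le> e" by blast
    qed
    then obtain b where b: "basis_expansion w v b" "\<And>i. (\<lambda>l. biorthogonal w i (v - R l)) \<longlonglongrightarrow> b i"
      by blast
    have "biorthogonal w i v = b i" for i using biorthogonal_eq[OF w _ b(1)] by simp
    then have "(\<lambda>l. Q n (v - R l)) \<longlonglongrightarrow> Q n v"
      using b(2) unfolding Q_def by (auto intro!: tendsto_intros)
    then have "(\<lambda>l. norm (Q n (v - R l))) \<longlonglongrightarrow> norm (Q n v)" by (rule tendsto_norm)
    then show "norm (Q n v) \<le> 2 * C * norm v"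
    proof (rule tendsto_upperbound)
      show "\<forall>\<^sub>F l in sequentially. norm (Q n (v - R l)) \<le> 2 * C * norm v"
        using QR'[of 0 _ n] by (simp add: R0 mult_ac)
    qed simp
  qed
  \<comment> \<open>Adding 1 keeps the constant positive when \<open>C = 0\<close>.\<close>
  then have "norm (Q n v) \<le> (2 * C + 1) * norm v" for n v
    by (rule order_trans) (simp add: algebra_simps)
  moreover have "0 < 2 * C + 1" using C by simp
  ultimately show thesis using that unfolding Q_def by blast
qed

subsection \<open>Monotone bases and shrinking bases\<close>

lemma bounded_linear_on_sum:
  assumes g: "bounded_linear_on Z g" and Z: "subspace Z" and "finite L" "\<And>l. l \<in> L \<Longrightarrow> u l \<in> Z"
  shows "g (\<Sum>l\<in>L. c l *\<^sub>R u l) = (\<Sum>l\<in>L. c l *\<^sub>R g (u l))"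
  using assms(3,4)
proof (induction L rule: finite_induct)
  case empty
  have "g (0 *\<^sub>R 0) = 0 *\<^sub>R g 0"
    using g subspace_0[OF Z] unfolding bounded_linear_on_def by blast
  then show ?case by simp
next
  case (insert l L)
  then have "c l *\<^sub>R u l \<in> Z" "(\<Sum>l\<in>L. c l *\<^sub>R u l) \<in> Z" "u l \<in> Z"
    using Z by (auto intro!: subspace_sum subspace_scale)
  then show ?case using g insert by (simp add: bounded_linear_on_def)
qed

lemma bounded_linear_on_diff:
  assumes "bounded_linear_on Z g" "subspace Z" "u \<in> Z" "v \<in> Z"
  shows "g (u - v) = g u - g v"
proof -
  have "(-1) *\<^sub>R v \<in> Z" using assms subspace_scale by blast
  moreover have "g ((-1) *\<^sub>R v) = (-1) *\<^sub>R g v" using assms(1,4) unfolding bounded_linear_on_def by blast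
  moreover have "g (u + w) = g u + g w" if "w \<in> Z" for w
    using assms(1,3) that unfolding bounded_linear_on_def by blast
  ultimately have "g (u + (-1) *\<^sub>R v) = g u + (-1) *\<^sub>R g v" by metis
  then show ?thesis by simp
qed

lemma bounded_linear_on_tendsto:
  assumes g: "bounded_linear_on Z g" and Z: "subspace Z" and "\<And>n. u n \<in> Z" "v \<in> Z" "u \<longlonglongrightarrow> v"
  shows "(\<lambda>n. g (u n)) \<longlonglongrightarrow> g v"
proof -
  obtain K where K: "\<And>v. v \<in> Z \<Longrightarrow> norm (g v) \<le> K * norm v"
    using g unfolding bounded_linear_on_def by blast
  have le: "norm (g (u n) - g v) \<le> norm (K * norm (u n - v))" for n
    using K[of "u n - v"] bounded_linear_on_diff[OF g Z, of "u n" v] assms subspace_diff[OF Z, of "u n" v]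
    by auto
  have "(\<lambda>n. K * norm (u n - v)) \<longlonglongrightarrow> 0"
    using assms(5) by (intro tendsto_mult_right_zero tendsto_norm_zero LIM_zero)
  then have "(\<lambda>n. g (u n) - g v) \<longlonglongrightarrow> 0"
    by (rule Lim_null_comparison[rotated, OF tendsto_norm_zero]) (use le in auto)
  then show ?thesis by (rule LIM_zero_cancel)
qed

lemma dual_norm_le:
  assumes "0 \<in> Z" "\<And>v. v \<in> Z \<Longrightarrow> norm v \<le> 1 \<Longrightarrow> \<bar>g v\<bar> \<le> B"
  shows "dual_norm Z g \<le> B"
  unfolding dual_norm_def
proof (rule cSUP_least)
  show "{v \<in> Z. norm v \<le> 1} \<noteq> {}" using assms(1) by force
qed (use assms in auto)

lemma abs_le_dual_norm:
  assumes g: "bounded_linear_on Z g" and Z: "subspace Z" and v: "v \<in> Z"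
  shows "\<bar>g v\<bar> \<le> dual_norm Z g * norm v"
proof (cases "v = 0")
  case True
  have "g (0 *\<^sub>R v) = 0 *\<^sub>R g v" using g v unfolding bounded_linear_on_def by blast
  then show ?thesis using True by simp
next
  case False
  obtain K where K: "\<And>v. v \<in> Z \<Longrightarrow> norm (g v) \<le> K * norm v"
    using g unfolding bounded_linear_on_def by blast
  have "bdd_above ((\<lambda>v. \<bar>g v\<bar>) ` {v \<in> Z. norm v \<le> 1})"
  proof (rule bdd_aboveI2)
    fix u assume "u \<in> {v \<in> Z. norm v \<le> 1}"
    \<comment> \<open>\<open>bounded_linear_on\<close> does not fix the sign of \<open>K\<close>,
      hence the absolute value.\<close>
    then show "\<bar>g u\<bar> \<le> \<bar>K\<bar>"
      using K[of u] mult_right_mono[OF abs_ge_self norm_ge_zero, of K u] mult_left_mono[of "norm u" 1 "\<bar>K\<bar>"] by auto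
  qed
  moreover have u: "(1 / norm v) *\<^sub>R v \<in> Z" "norm ((1 / norm v) *\<^sub>R v) \<le> 1"
    using v Z False by (auto intro: subspace_scale)
  ultimately have "\<bar>g ((1 / norm v) *\<^sub>R v)\<bar> \<le> dual_norm Z g"
    unfolding dual_norm_def by (intro cSUP_upper) auto
  moreover have "g ((1 / norm v) *\<^sub>R v) = (1 / norm v) * g v"
    using g v unfolding bounded_linear_on_def by simp
  ultimately show ?thesis using False by (simp add: field_simps abs_mult)
qed

lemma bounded_linear_on_diff_sum:
  assumes h: "bounded_linear_on Z h" and g: "\<And>i. i \<in> I \<Longrightarrow> bounded_linear_on Z (g i)" and I: "finite I"
  shows "bounded_linear_on Z (\<lambda>v. h v - (\<Sum>i\<in>I. a i * g i v :: real))"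
proof -
  obtain K where K: "\<And>v. v \<in> Z \<Longrightarrow> norm (h v) \<le> K * norm v"
    using h unfolding bounded_linear_on_def by blast
  have "\<exists>L. \<forall>i. i \<in> I \<longrightarrow> (\<forall>v\<in>Z. norm (g i v) \<le> L i * norm v)"
    by (rule choice) (use g in \<open>auto simp: bounded_linear_on_def\<close>)
  then obtain L where L: "\<And>i v. i \<in> I \<Longrightarrow> v \<in> Z \<Longrightarrow> norm (g i v) \<le> L i * norm v" by blast
  have "norm (h v - (\<Sum>i\<in>I. a i * g i v)) \<le> (K + (\<Sum>i\<in>I. \<bar>a i\<bar> * L i)) * norm v" if v: "v \<in> Z" for v
  proof -
    have "norm (\<Sum>i\<in>I. a i * g i v) \<le> (\<Sum>i\<in>I. \<bar>a i\<bar> * (L i * norm v))"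
      using L v by (intro sum_norm_le) (auto simp: abs_mult intro: mult_left_mono)
    then show ?thesis
      using K[OF v] norm_triangle_ineq4[of "h v" "\<Sum>i\<in>I. a i * g i v"]
      by (simp add: algebra_simps sum_distrib_left)
  qed
  moreover have "g i (u + v) = g i u + g i v" "g i (c *\<^sub>R v) = c * g i v"
    if "i \<in> I" "u \<in> Z" "v \<in> Z" for i u v c
    using g[OF that(1)] that by (auto simp: bounded_linear_on_def)
  moreover have "h (u + v) = h u + h v" "h (c *\<^sub>R v) = c * h v" if "u \<in> Z" "v \<in> Z" for u v c
    using h that by (auto simp: bounded_linear_on_def)
  ultimately show ?thesis
    unfolding bounded_linear_on_def
    by (intro conjI exI[of _ "K + (\<Sum>i\<in>I. \<bar>a i\<bar> * L i)"] ballI allI)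
      (auto simp: algebra_simps sum.distrib sum_distrib_left)
qed

text \<open>For some n the expansion of \<open>h\<close> in the dual basis leaves a remainder of
  dual norm below \<open>e\<close>. On combinations supported beyond n it coincides with
  \<open>h\<close>, because the first n biorthogonal functionals vanish there.\<close>

lemma shrinking_basis_tail:
  assumes z: "shrinking_basis Z z" and h: "bounded_linear_on Z h" and e: "0 < e"
  obtains N where "\<And>a. a \<in> c00 \<Longrightarrow> (\<And>i. i < N \<Longrightarrow> a i = 0) \<Longrightarrow> \<bar>h (lin_comb a z)\<bar> \<le> e * norm (lin_comb a z)"
proof -
  have basis: "schauder_basis Z z" and dual: "schauder_basis_of_dual Z (biorthogonal z)"
    using z by (auto simp: shrinking_basis_def)
  obtain b where b: "(\<lambda>n. dual_norm Z (\<lambda>v. h v - (\<Sum>i=1..n. b i * biorthogonal z i v))) \<longlonglongrightarrow> 0"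
    using dual h unfolding schauder_basis_of_dual_def by blast
  from LIMSEQ_D[OF b e] obtain n where
    n: "norm (dual_norm Z (\<lambda>v. h v - (\<Sum>i=1..n. b i * biorthogonal z i v)) - 0) < e" by blast
  define g where "g v = h v - (\<Sum>i=1..n. b i * biorthogonal z i v)" for v
  have g: "bounded_linear_on Z g"
    unfolding g_def using dual h by (intro bounded_linear_on_diff_sum) (auto simp: schauder_basis_of_dual_def)
  have "\<bar>h (lin_comb a z)\<bar> \<le> e * norm (lin_comb a z)" if a: "a \<in> c00" "\<And>i. i < Suc n \<Longrightarrow> a i = 0" for a
  proof -
    have "g (lin_comb a z) = h (lin_comb a z)"
      using a by (simp add: g_def biorthogonal_lin_comb[OF basis])
    then have "\<bar>h (lin_comb a z)\<bar> \<le> dual_norm Z g * norm (lin_comb a z)"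
      using abs_le_dual_norm[OF g _ lin_comb_in_basis[OF basis a(1)]] basis
      by (simp add: schauder_basis_def)
    also have "\<dots> \<le> e * norm (lin_comb a z)"
      using n by (intro mult_right_mono) (auto simp: g_def[abs_def])
    finally show ?thesis .
  qed
  then show thesis by (rule that)
qed

text \<open>Only finite combinations are constrained, since the norm of a completion is known
  explicitly on \<open>c00\<close> only; the lemmas below carry monotonicity over to the
  closure.\<close>

locale monotone_basic_sequence =
  fixes z :: "nat \<Rightarrow> 'b::banach"
  assumes nz: "\<And>i. 1 \<le> i \<Longrightarrow> z i \<noteq> 0"
    and mono: "\<And>a n. a \<in> c00 \<Longrightarrow> norm (\<Sum>i=1..n. a i *\<^sub>R z i) \<le> norm (lin_comb a z)"
begin

abbreviation Z where "Z \<equiv> closure (span (z ` {1..}))"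

lemma partial_sum_le:
  assumes "basis_expansion z v a"
  shows "norm (\<Sum>i=1..n. a i *\<^sub>R z i) \<le> norm v"
proof (rule tendsto_lowerbound)
  show "(\<lambda>m. norm (\<Sum>i=1..m. a i *\<^sub>R z i)) \<longlonglongrightarrow> norm v"
    using assms by (auto simp: basis_expansion_def intro: tendsto_norm)
  have "norm (\<Sum>i=1..n. a i *\<^sub>R z i) \<le> norm (\<Sum>i=1..m. a i *\<^sub>R z i)" if "n \<le> m" for m
  proof -
    have "(\<Sum>i=1..n. trunc 1 m a i *\<^sub>R z i) = (\<Sum>i=1..n. a i *\<^sub>R z i)"
      using that by (intro sum.cong) (auto simp: trunc_def)
    then show ?thesis
      using mono[OF trunc_c00[of 1 m a], of n] by (simp add: lin_comb_trunc)
  qed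
  then show "\<forall>\<^sub>F m in sequentially. norm (\<Sum>i=1..n. a i *\<^sub>R z i) \<le> norm (\<Sum>i=1..m. a i *\<^sub>R z i)"
    by (auto simp: eventually_sequentially)
qed simp

lemma expansion_unique:
  assumes "basis_expansion z v a" "basis_expansion z v b"
  shows "a = b"
proof
  fix i
  have "basis_expansion z 0 (\<lambda>i. a i - b i)" using basis_expansion_diff[OF assms] by simp
  have "\<bar>a i - b i\<bar> = 0" if "1 \<le> i"
    using norm_coefficient_le[OF partial_sum_le[OF \<open>basis_expansion z 0 _\<close>] that] nz[OF that]
    by (simp add: mult_le_0_iff)
  moreover have "a 0 = b 0" using assms by (simp add: basis_expansion_def)
  ultimately show "a i = b i" by (cases "i = 0") auto
qed

lemma expansion_exists:
  assumes "v \<in> Z"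
  obtains a where "basis_expansion z v a"
proof -
  obtain s where s: "\<And>l. s l \<in> span (z ` {1..})" "s \<longlonglongrightarrow> v"
    using assms unfolding closure_sequential by blast
  have "\<forall>l. \<exists>a. a \<in> c00 \<and> s l = lin_comb a z" using s(1) unfolding span_eq_lin_comb by blast
  then obtain a where a: "\<And>l. a l \<in> c00" "\<And>l. s l = lin_comb (a l) z" by metis
  have "\<exists>b. basis_expansion z v b \<and> (\<forall>i. (\<lambda>l. a l i) \<longlonglongrightarrow> b i)"
  proof (rule basis_expansion_limit[OF nz _ s(2)])
    show "basis_expansion z (s l) (a l)" for l using basis_expansion_lin_comb a by metis
    fix e :: real assume "0 < e"
    moreover have "Cauchy s" using s(2) by (rule LIMSEQ_imp_Cauchy)
    ultimately obtain L where L: "\<And>l l'. L \<le> l \<Longrightarrow> L \<le> l' \<Longrightarrow> norm (s l - s l') < e"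
      unfolding Cauchy_def dist_norm by blast
    have "norm (\<Sum>i=1..n. (a l i - a l' i) *\<^sub>R z i) \<le> e" if "L \<le> l" "L \<le> l'" for l l' n
      using mono[OF lin_comb_diff(1)[OF a(1)[of l] a(1)[of l']], of n] L[OF that]
      by (simp add: lin_comb_diff(2)[OF a(1) a(1)] a(2))
    then show "\<exists>L. \<forall>l\<ge>L. \<forall>l'\<ge>L. \<forall>n. norm (\<Sum>i=1..n. (a l i - a l' i) *\<^sub>R z i) \<le> e" by blast
  qed
  then show thesis using that by blast
qed

lemma schauder_basis: "schauder_basis Z z"
  unfolding schauder_basis_def
proof (intro conjI allI ballI impI)
  fix v assume "v \<in> Z"
  then show "\<exists>!a. basis_expansion z v a" using expansion_exists expansion_unique by metis
next
  fix i :: nat assume "1 \<le> i"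
  then show "z i \<in> Z" by (intro subsetD[OF closure_subset] span_base) auto
qed (simp_all add: subspace_span subspace_closure)

text \<open>The sum is the value of \<open>h\<close> at the n-th partial sum of \<open>v\<close>. By
  monotonicity this partial sum differs from \<open>v\<close> by at most \<open>2 * norm v\<close>,
  hence the factor 2.\<close>

lemma norm_tail_le:
  assumes "v \<in> Z" "1 \<le> n"
    and h: "bounded_linear_on Z h"
    and tail: "\<And>a. a \<in> c00 \<Longrightarrow> (\<And>i. i < n \<Longrightarrow> a i = 0) \<Longrightarrow> \<bar>h (lin_comb a z)\<bar> \<le> e * norm (lin_comb a z)"
    and e: "0 \<le> e"
  shows "\<bar>h v - (\<Sum>i=1..n. h (z i) * biorthogonal z i v)\<bar> \<le> 2 * e * norm v"
proof -
  define b where "b i = biorthogonal z i v" for i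
  have b: "basis_expansion z v b"
    using biorthogonal_expansion[OF schauder_basis assms(1)] by (simp add: b_def[abs_def])
  have Z: "subspace Z" and zZ: "\<And>i. 1 \<le> i \<Longrightarrow> z i \<in> Z" using schauder_basis by (auto simp: schauder_basis_def)
  let ?Q = "\<lambda>m. \<Sum>i=1..m. b i *\<^sub>R z i"
  have QZ: "?Q m \<in> Z" for m using zZ by (intro subspace_sum[OF Z] subspace_scale[OF Z]) auto
  have Q: "?Q \<longlonglongrightarrow> v" using b by (simp add: basis_expansion_def)
  have le: "\<bar>h (?Q m - ?Q n)\<bar> \<le> e * norm (?Q m - ?Q n)" if "n \<le> m" for m
  proof -
    have eq: "?Q m - ?Q n = lin_comb (trunc (Suc n) m b) z"
      unfolding lin_comb_trunc using that sum.ub_add_nat[of 1 n "\<lambda>i. b i *\<^sub>R z i" "m - n"] by simp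
    show ?thesis unfolding eq by (rule tail) (auto simp: trunc_c00 trunc_def)
  qed
  have "(\<lambda>m. h (?Q m - ?Q n)) \<longlonglongrightarrow> h (v - ?Q n)"
    by (intro bounded_linear_on_tendsto[OF h Z] subspace_diff[OF Z] QZ assms(1) tendsto_intros Q)
  then have "(\<lambda>m. \<bar>h (?Q m - ?Q n)\<bar>) \<longlonglongrightarrow> \<bar>h (v - ?Q n)\<bar>" by (rule tendsto_rabs)
  moreover have "(\<lambda>m. e * norm (?Q m - ?Q n)) \<longlonglongrightarrow> e * norm (v - ?Q n)"
    using Q by (intro tendsto_intros)
  ultimately have "\<bar>h (v - ?Q n)\<bar> \<le> e * norm (v - ?Q n)"
    by (intro LIMSEQ_le) (use le in blast)+
  also have "\<dots> \<le> e * (norm v + norm v)"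
    using partial_sum_le[OF b, of n] norm_triangle_ineq4[of v "?Q n"] e by (intro mult_left_mono) auto
  finally have "\<bar>h (v - ?Q n)\<bar> \<le> 2 * e * norm v" by simp
  moreover have "h (v - ?Q n) = h v - (\<Sum>i=1..n. h (z i) * b i)"
    using bounded_linear_on_diff[OF h Z assms(1) QZ] bounded_linear_on_sum[OF h Z, of "{1..n}" z b] zZ
    by (simp add: mult.commute)
  ultimately show ?thesis by (simp add: b_def)
qed

lemma bounded_linear_on_biorthogonal:
  assumes "1 \<le> i"
  shows "bounded_linear_on Z (biorthogonal z i)"
proof -
  have "norm (biorthogonal z i v) \<le> 2 / norm (z i) * norm v" if "v \<in> Z" for v
    using norm_coefficient_le[OF partial_sum_le[OF biorthogonal_expansion[OF schauder_basis that]] assms] nz[OF assms]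
    by (simp add: field_simps)
  then show ?thesis
    unfolding bounded_linear_on_def
    using biorthogonal_add[OF schauder_basis] biorthogonal_scale[OF schauder_basis]
    by (intro conjI exI[of _ "2 / norm (z i)"]) auto
qed

text \<open>The only candidate for the coefficients is \<open>h (z i)\<close>: evaluation at
  \<open>z j\<close> shows that convergence in the dual norm forces it. That it works is
  \<open>norm_tail_le\<close>.\<close>

lemma shrinking_basisI:
  assumes tail: "\<And>h e. bounded_linear_on Z h \<Longrightarrow> 0 < e \<Longrightarrow>
    \<exists>N. \<forall>a\<in>c00. (\<forall>i<N. a i = 0) \<longrightarrow> \<bar>h (lin_comb a z)\<bar> \<le> e * norm (lin_comb a z)"
  shows "shrinking_basis Z z"
proof -
  have Z: "subspace Z" and zZ: "\<And>i. 1 \<le> i \<Longrightarrow> z i \<in> Z" using schauder_basis by (auto simp: schauder_basis_def)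
  have "\<exists>!a. a 0 = 0 \<and> (\<lambda>n. dual_norm Z (\<lambda>v. h v - (\<Sum>i=1..n. a i * biorthogonal z i v))) \<longlonglongrightarrow> 0"
    if h: "bounded_linear_on Z h" for h
  proof (rule ex1I)
    define b where "b i = (if i = 0 then 0 else h (z i))" for i
    have "(\<lambda>n. dual_norm Z (\<lambda>v. h v - (\<Sum>i=1..n. b i * biorthogonal z i v))) \<longlonglongrightarrow> 0"
    proof (rule LIMSEQ_I)
      fix e :: real assume e: "0 < e"
      then obtain N where N: "\<And>a. a \<in> c00 \<Longrightarrow> (\<And>i. i < N \<Longrightarrow> a i = 0) \<Longrightarrow>
          \<bar>h (lin_comb a z)\<bar> \<le> e / 4 * norm (lin_comb a z)"
        using tail[OF h, of "e / 4"] by auto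
      have "norm (dual_norm Z (\<lambda>v. h v - (\<Sum>i=1..n. b i * biorthogonal z i v)) - 0) < e"
        if n: "max 1 N \<le> n" for n
      proof -
        let ?g = "\<lambda>v. h v - (\<Sum>i=1..n. b i * biorthogonal z i v)"
        have "\<bar>?g v\<bar> \<le> e / 2" if v: "v \<in> Z" "norm v \<le> 1" for v
        proof -
          have "\<bar>h v - (\<Sum>i=1..n. h (z i) * biorthogonal z i v)\<bar> \<le> 2 * (e / 4) * norm v"
            by (rule norm_tail_le[OF v(1) _ h]) (use n e N in auto)
          also have "\<dots> \<le> e / 2" using v(2) e mult_left_mono[of "norm v" 1 "e / 2"] by simp
          finally show ?thesis by (simp add: b_def)
        qed
        then have "dual_norm Z ?g \<le> e / 2" using subspace_0[OF Z] by (intro dual_norm_le) auto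
        moreover have "bounded_linear_on Z ?g"
          by (intro bounded_linear_on_diff_sum h bounded_linear_on_biorthogonal) auto
        \<comment> \<open>Evaluating at the nonzero vector \<open>z 1\<close> shows that the dual
          norm is nonnegative.\<close>
        from abs_le_dual_norm[OF this Z zZ[of 1]] nz[of 1] have "0 \<le> dual_norm Z ?g"
          by (meson abs_ge_zero order_trans order_refl zero_le_mult_iff zero_less_norm_iff less_le_not_le)
        ultimately show ?thesis using e by simp
      qed
      then show "\<exists>n0. \<forall>n\<ge>n0. norm (dual_norm Z (\<lambda>v. h v - (\<Sum>i=1..n. b i * biorthogonal z i v)) - 0) < e"
        by blast
    qed
    then show "b 0 = 0 \<and> (\<lambda>n. dual_norm Z (\<lambda>v. h v - (\<Sum>i=1..n. b i * biorthogonal z i v))) \<longlonglongrightarrow> 0"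
      by (simp add: b_def)
    fix a assume a: "a 0 = 0 \<and> (\<lambda>n. dual_norm Z (\<lambda>v. h v - (\<Sum>i=1..n. a i * biorthogonal z i v))) \<longlonglongrightarrow> 0"
    have "a j = b j" if j: "1 \<le> j" for j
    proof -
      let ?g = "\<lambda>n v. h v - (\<Sum>i=1..n. a i * biorthogonal z i v)"
      define e where "e i = (if i = j then 1 else 0 :: real)" for i
      have e: "e \<in> c00" using j by (intro c00I[of _ j]) (auto simp: e_def)
      have "lin_comb e z = (\<Sum>i\<in>{j}. e i *\<^sub>R z i)"
        by (rule lin_comb_eq_sum) (auto simp: e_def split: if_splits)
      then have "biorthogonal z i (z j) = e i" for i
        using biorthogonal_lin_comb[OF schauder_basis e, of i] by (simp add: e_def)
      then have g: "?g n (z j) = h (z j) - a j" if "j \<le> n" for n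
        using that j by (simp add: e_def if_distrib[of "(*) _"] cong: if_cong)
      have bound: "\<bar>?g n (z j)\<bar> \<le> dual_norm Z (?g n) * norm (z j)" for n
        by (intro abs_le_dual_norm bounded_linear_on_diff_sum h bounded_linear_on_biorthogonal Z zZ j) auto
      have le: "\<bar>h (z j) - a j\<bar> \<le> dual_norm Z (?g n) * norm (z j)" if "j \<le> n" for n
        unfolding g[OF that, symmetric] by (rule bound)
      have "(\<lambda>n. dual_norm Z (?g n) * norm (z j)) \<longlonglongrightarrow> 0 * norm (z j)"
        using a by (intro tendsto_intros) auto
      then have "\<bar>h (z j) - a j\<bar> \<le> 0 * norm (z j)"
        by (rule tendsto_lowerbound) (use le in \<open>auto simp: eventually_sequentially\<close>)
      then show ?thesis using j by (simp add: b_def)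
    qed
    then show "a = b" using a by (auto simp: b_def fun_eq_iff)
  qed
  then show ?thesis
    unfolding shrinking_basis_def schauder_basis_of_dual_def
    using schauder_basis bounded_linear_on_biorthogonal by blast
qed

end

declare One_nat_def [simp del]

subsection \<open>Norms built from segments\<close>

definition seg :: "(nat \<Rightarrow> 'a::real_vector) \<Rightarrow> nat \<Rightarrow> nat \<Rightarrow> (nat \<Rightarrow> real) \<Rightarrow> 'a" where
  "seg x m n a = (\<Sum>i=m..n. a i *\<^sub>R x i)"

lemma seg_sum: "seg x m n (\<lambda>i. \<Sum>l\<in>A. c l * u l i) = (\<Sum>l\<in>A. c l *\<^sub>R seg x m n (u l))"
proof -
  have "seg x m n (\<lambda>i. \<Sum>l\<in>A. c l * u l i) = (\<Sum>i=m..n. \<Sum>l\<in>A. c l *\<^sub>R u l i *\<^sub>R x i)"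
    by (simp add: seg_def scaleR_sum_left)
  also have "\<dots> = (\<Sum>l\<in>A. c l *\<^sub>R seg x m n (u l))"
    by (subst sum.swap) (simp add: seg_def scaleR_sum_right)
  finally show ?thesis .
qed

lemma seg_eq_0: "(\<And>i. m \<le> i \<Longrightarrow> i \<le> n \<Longrightarrow> a i = 0) \<Longrightarrow> seg x m n a = 0"
  by (simp add: seg_def)

lemma seg_cong_start:
  assumes "m \<le> m'" "\<And>i. i < m' \<Longrightarrow> a i = 0"
  shows "seg x m n a = seg x m' n a"
  unfolding seg_def using assms by (intro sum.mono_neutral_right) auto

lemma seg_eq_lin_comb:
  assumes "\<And>i. a i \<noteq> 0 \<Longrightarrow> m \<le> i \<and> i \<le> n"
  shows "seg x m n a = lin_comb a x"
  unfolding seg_def using assms by (intro lin_comb_eq_sum[symmetric]) auto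

lemma seg_trunc: "seg x m n (trunc 1 p a) = seg x m (min n p) a" if "1 \<le> m"
  unfolding seg_def using that by (intro sum.mono_neutral_cong_right) (auto simp: trunc_def)

lemma linear_frame_proj: "linear (frame_proj x f m n)"
  by (rule linearI)
    (simp_all add: frame_proj_def blinfun.add_right blinfun.scaleR_right algebra_simps sum.distrib scaleR_sum_right)

lemma frame_proj_split:
  assumes "1 \<le> m" "m \<le> n"
  shows "frame_proj x f m n v = frame_proj x f 1 n v - frame_proj x f 1 (m - 1) v"
proof -
  have "frame_proj x f 1 (m - 1 + (n - (m - 1))) v = frame_proj x f 1 (m - 1) v + frame_proj x f (m - 1 + 1) (m - 1 + (n - (m - 1))) v"
    unfolding frame_proj_def by (rule sum.ub_add_nat) (use assms in simp)
  then show ?thesis using assms by simp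
qed

text \<open>Expresses, term by term, that the norm with level set \<open>L\<close> is at most
  \<open>B\<close>, so no supremum has to be known finite in advance. For \<open>L = {}\<close> it
  is the minimal norm; the levels form a set since only the values of the level sequence
  matter.\<close>

definition seg_bound ::
  "(nat \<Rightarrow> 'a::banach) \<Rightarrow> (nat \<Rightarrow> 'a \<Rightarrow>\<^sub>L real) \<Rightarrow> (nat \<Rightarrow> nat) \<Rightarrow> nat set \<Rightarrow> real \<Rightarrow> (nat \<Rightarrow> real) \<Rightarrow> bool" where
  "seg_bound x f N L B a \<longleftrightarrow>
     (\<forall>m n. 1 \<le> m \<and> m \<le> n \<longrightarrow> norm (seg x m n a) \<le> B) \<and>
     (\<forall>k\<in>L. \<forall>m0 n0 m n. 1 \<le> m0 \<and> m0 \<le> n0 \<and> n0 \<le> k \<and> N k \<le> m \<and> m \<le> n \<longrightarrow>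
        2 ^ k * norm (frame_proj x f m0 n0 (seg x m n a)) \<le> B)"

lemma seg_bound_nonneg: 
  assumes "seg_bound x f N L B a"
  shows "0 \<le> B"
proof -
  have "norm (seg x 1 1 a) \<le> B" using assms unfolding seg_bound_def by simp
  then show ?thesis using norm_ge_zero[of "seg x 1 1 a"] by linarith
qed

lemma seg_bound_segD: "seg_bound x f N L B a \<Longrightarrow> 1 \<le> m \<Longrightarrow> norm (seg x m n a) \<le> B"
  using seg_bound_nonneg[of x f N L B a] by (cases "m \<le> n") (auto simp: seg_bound_def seg_eq_0)

lemma seg_bound_levelD:
  "seg_bound x f N L B a \<Longrightarrow> k \<in> L \<Longrightarrow> 1 \<le> m0 \<Longrightarrow> m0 \<le> n0 \<Longrightarrow> n0 \<le> k \<Longrightarrow> N k \<le> m \<Longrightarrow>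
     2 ^ k * norm (frame_proj x f m0 n0 (seg x m n a)) \<le> B"
  using seg_bound_nonneg[of x f N L B a]
  by (cases "m \<le> n") (auto simp: seg_bound_def seg_eq_0 linear_0[OF linear_frame_proj])

text \<open>A segment of a truncated sequence is a possibly shorter segment of the sequence itself
  with the same start. This is the source of the monotonicity of the bases.\<close>

lemma seg_bound_trunc:
  assumes "seg_bound x f N L B a" "\<And>k. k \<in> L \<Longrightarrow> 1 \<le> N k"
  shows "seg_bound x f N L B (trunc 1 p a)"
  unfolding seg_bound_def
proof (intro conjI allI ballI impI)
  fix m n :: nat assume "1 \<le> m \<and> m \<le> n"
  then show "norm (seg x m n (trunc 1 p a)) \<le> B"
    using seg_bound_segD[OF assms(1), of m] by (simp add: seg_trunc)
next
  fix k m0 n0 m n assume *: "k \<in> L" "1 \<le> m0 \<and> m0 \<le> n0 \<and> n0 \<le> k \<and> N k \<le> m \<and> m \<le> n"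
  then have "1 \<le> m" using assms(2)[of k] by simp
  then show "2 ^ k * norm (frame_proj x f m0 n0 (seg x m n (trunc 1 p a))) \<le> B"
    using * seg_bound_levelD[OF assms(1), of k m0 n0 m] by (simp add: seg_trunc)
qed

text \<open>The uniform bound \<open>C\<close> on the projections is supplied in
  \<open>frame_exists\<close>, by factoring them through the space of \<open>w\<close>.\<close>

locale frame =
  fixes x :: "nat \<Rightarrow> 'x::banach" and f :: "nat \<Rightarrow> 'x \<Rightarrow>\<^sub>L real" and C :: real
  assumes shrinking: "shrinking_frame x f"
    and C: "0 \<le> C" and proj_le: "\<And>m n v. 1 \<le> m \<Longrightarrow> norm (frame_proj x f m n v) \<le> C * norm v"
begin

lemma x_nonzero: "1 \<le> i \<Longrightarrow> x i \<noteq> 0"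
  and frame_lim: "(\<lambda>n. frame_proj x f 1 n v) \<longlonglongrightarrow> v"
  using shrinking by (auto simp: shrinking_frame_def schauder_frame_def frame_proj_def)

text \<open>By the shrinking property \<open>g\<close> is, up to small dual norm, a finite
  combination of the \<open>f i\<close>; boundedness of \<open>y\<close> controls the error. In
  \<open>B + 1\<close> the 1 keeps the denominator positive.\<close>

lemma weakly_null:
  assumes coord: "\<And>i. 1 \<le> i \<Longrightarrow> (\<lambda>l. f i (y l)) \<longlonglongrightarrow> 0" and bdd: "\<And>l :: nat. norm (y l) \<le> B"
    and g: "bounded_linear g"
  shows "(\<lambda>l. g (y l) :: real) \<longlonglongrightarrow> 0"
proof (rule LIMSEQ_I)
  fix e :: real assume e: "0 < e"
  define G where "G = Blinfun g"
  have G: "blinfun_apply G = g" using g by (simp add: G_def bounded_linear_Blinfun_apply)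
  have B: "0 \<le> B" using bdd[of 0] norm_ge_zero[of "y 0"] by linarith
  have "(\<lambda>n. \<Sum>i=1..n. G (x i) *\<^sub>R f i) \<longlonglongrightarrow> G" using shrinking by (auto simp: shrinking_frame_def)
  from LIMSEQ_D[OF this, of "e / (2 * (B + 1))"] e B
  obtain n where n: "norm ((\<Sum>i=1..n. G (x i) *\<^sub>R f i) - G) < e / (2 * (B + 1))" by auto
  have "(\<lambda>l. \<Sum>i=1..n. G (x i) * f i (y l)) \<longlonglongrightarrow> (\<Sum>i=1..n. G (x i) * 0)"
    by (intro tendsto_intros coord) auto
  from LIMSEQ_D[OF this, of "e / 2"] e
  obtain L where L: "\<And>l. L \<le> l \<Longrightarrow> \<bar>\<Sum>i=1..n. G (x i) * f i (y l)\<bar> < e / 2" by auto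
  have "norm (g (y l) - 0) < e" if l: "L \<le> l" for l
  proof -
    let ?D = "(\<Sum>i=1..n. G (x i) *\<^sub>R f i) - G"
    have "blinfun_apply ?D (y l) = (\<Sum>i=1..n. G (x i) * f i (y l)) - g (y l)"
      by (simp add: G blinfun.diff_left blinfun.sum_left blinfun.scaleR_left)
    moreover have "\<bar>blinfun_apply ?D (y l)\<bar> \<le> norm ?D * norm (y l)" using norm_blinfun[of ?D "y l"] by simp
    moreover have "norm ?D * norm (y l) \<le> e / (2 * (B + 1)) * (B + 1)"
      using n bdd[of l] B e by (intro mult_mono) auto
    moreover have "e / (2 * (B + 1)) * (B + 1) = e / 2" using B by (simp add: field_simps)
    ultimately have "\<bar>(\<Sum>i=1..n. G (x i) * f i (y l)) - g (y l)\<bar> \<le> e / 2" by linarith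
    then show ?thesis using L[OF l] unfolding real_norm_def by linarith
  qed
  then show "\<exists>L. \<forall>l\<ge>L. norm (g (y l) - 0) < e" by blast
qed

end

section \<open>Convex combinations of sparse blocks\<close>

lemma sum_of_bool_disjoint_le:
  fixes c :: "nat \<Rightarrow> real"
  assumes "mono s" "\<And>l. l < n \<Longrightarrow> 0 \<le> c l \<and> c l \<le> \<delta>" "0 \<le> \<delta>"
  shows "(\<Sum>l<n. c l * of_bool (s l < m \<and> m \<le> s (Suc l))) \<le> \<delta>"
proof (cases "\<exists>l<n. s l < m \<and> m \<le> s (Suc l)")
  case True
  then obtain l0 where l0: "l0 < n" "s l0 < m" "m \<le> s (Suc l0)" by blast
  \<comment> \<open>The half-open intervals are disjoint, so the end point \<open>m\<close> selects
    at most one term.\<close>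
  have uniq: "l = l0" if "s l < m" "m \<le> s (Suc l)" for l
    using that l0 monoD[OF assms(1), of "Suc l" l0] monoD[OF assms(1), of "Suc l0" l]
    by (cases l l0 rule: linorder_cases) auto
  have "(\<Sum>l<n. c l * of_bool (s l < m \<and> m \<le> s (Suc l))) = (\<Sum>l\<in>{l0}. c l * of_bool (s l < m \<and> m \<le> s (Suc l)))"
  proof (rule sum.mono_neutral_right)
    show "\<forall>l\<in>{..<n} - {l0}. c l * of_bool (s l < m \<and> m \<le> s (Suc l)) = 0"
    proof
      fix l assume "l \<in> {..<n} - {l0}"
      then show "c l * of_bool (s l < m \<and> m \<le> s (Suc l)) = 0" using uniq[of l] by auto
    qed
  qed (use l0 in auto)
  then show ?thesis using assms(2)[OF l0(1)] l0 by simp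
next
  case False
  then have "(\<Sum>l<n. c l * of_bool (s l < m \<and> m \<le> s (Suc l))) = 0" by (intro sum.neutral) auto
  then show ?thesis using assms(3) by simp
qed

text \<open>The exact remainder on the right strengthens the bound 2 so that the induction closes;
  for \<open>n < l1\<close> truncated subtraction makes the right side 0.\<close>

lemma sum_half_powers_le: "(\<Sum>l<n. if l < l1 then 0 else (1 / 2) ^ (l - l1)) \<le> 2 - 2 * (1 / 2 :: real) ^ (n - l1)"
proof (induction n)
  case (Suc n)
  then show ?case by (cases "n < l1") (auto simp: Suc_diff_le not_less)
qed simp

text \<open>Treats the minimal space (\<open>L = {}\<close>) and the spaces with levels together,
  which is why unboundedness is asked only of a nonempty \<open>L\<close>.\<close>

locale segment_basis = frame x f C for x :: "nat \<Rightarrow> 'x::banach" and f C +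
  fixes N :: "nat \<Rightarrow> nat" and L :: "nat set" and z :: "nat \<Rightarrow> 'z::banach"
  assumes N_ge: "\<And>k. k \<in> L \<Longrightarrow> 1 \<le> N k \<and> k \<le> N k"
    and L_unbounded: "\<And>n. L \<noteq> {} \<Longrightarrow> \<exists>k\<in>L. n < k"
    and norm_le_iff: "\<And>a B. a \<in> c00 \<Longrightarrow> norm (lin_comb a z) \<le> B \<longleftrightarrow> seg_bound x f N L B a"
begin

lemma seg_bound_norm: "a \<in> c00 \<Longrightarrow> seg_bound x f N L (norm (lin_comb a z)) a"
  using norm_le_iff by blast

lemma norm_seg_le: "a \<in> c00 \<Longrightarrow> 1 \<le> m \<Longrightarrow> norm (seg x m n a) \<le> norm (lin_comb a z)"
  by (rule seg_bound_segD[OF seg_bound_norm])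

lemma norm_lin_comb_le: 
  assumes "a \<in> c00" shows "norm (lin_comb a x) \<le> norm (lin_comb a z)"
proof -
  obtain n where "\<And>i. n < i \<Longrightarrow> a i = 0" using c00_bound[OF assms] by blast
  then have "lin_comb a x = seg x 1 n a" unfolding seg_def by (rule lin_comb_upto[OF assms])
  then show ?thesis using norm_seg_le[OF assms, of 1 n] by simp
qed

sublocale monotone_basic_sequence z
proof
  fix a n assume a: "a \<in> c00"
  have "norm (lin_comb (trunc 1 n a) z) \<le> norm (lin_comb a z)"
    using seg_bound_trunc[OF seg_bound_norm[OF a]] N_ge by (simp add: norm_le_iff trunc_c00)
  then show "norm (\<Sum>i=1..n. a i *\<^sub>R z i) \<le> norm (lin_comb a z)" by (simp add: lin_comb_trunc)
next
  fix i :: nat assume i: "1 \<le> i"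
  have "norm (x i) \<le> norm (z i)"
    using norm_lin_comb_le[OF trunc_c00[OF i], of i "\<lambda>_. 1"] by (simp add: lin_comb_trunc)
  then show "z i \<noteq> 0" using x_nonzero[OF i] by auto
qed

lemma frame_proj_seg_le:
  assumes a: "a \<in> c00" and k: "k \<in> L" "1 \<le> m0" "m0 \<le> n0" "n0 \<le> k" "N k \<le> m"
  shows "2 ^ k * norm (frame_proj x f m0 n0 (seg x m n a)) \<le> norm (lin_comb a z)"
  using seg_bound_levelD[OF seg_bound_norm[OF a] k] .

end

text \<open>
  The frame nearly supports \<open>y l\<close> on the interval from \<open>s l\<close> to \<open>s (Suc l)\<close>. A segment of a convex
  combination of the \<open>u l\<close> therefore differs little from a frame projection of the whole
  combination, except for the at most two blocks containing an end point of the segment. In a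
  level norm, \<open>level\<close> makes the contributions of successive blocks decay geometrically.
\<close>

locale block_sequence = segment_basis x f C N L z
  for x :: "nat \<Rightarrow> 'x::banach" and f C N L and z :: "nat \<Rightarrow> 'z::banach" +
  fixes u :: "nat \<Rightarrow> nat \<Rightarrow> real" and s :: "nat \<Rightarrow> nat" and \<eta> :: real
  assumes u: "\<And>l. u l \<in> c00" and norm_u: "\<And>l. norm (lin_comb (u l) z) \<le> 1"
    and s0: "s 0 = 0" and s_less: "\<And>l. s l < s (Suc l)"
    and supp: "\<And>l i. u l i \<noteq> 0 \<Longrightarrow> s l < i \<and> i \<le> s (Suc l)"
    and head: "\<And>l t. t \<le> s l \<Longrightarrow> norm (frame_proj x f 1 t (lin_comb (u l) x)) \<le> \<eta>"
    and tail: "\<And>l t. s (Suc l) \<le> t \<Longrightarrow> norm (frame_proj x f 1 t (lin_comb (u l) x) - lin_comb (u l) x) \<le> \<eta>"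
    and level: "\<And>l. L \<noteq> {} \<Longrightarrow> \<exists>K\<in>L. s l < K \<and> N K \<le> s (Suc l)"
begin

lemma s_strict: "strict_mono s" using s_less by (simp add: strict_mono_Suc_iff)

lemma s_add: "s l + d \<le> s (l + d)"
proof (induction d)
  case (Suc d)
  then show ?case using s_less[of "l + d"] by simp
qed simp

lemma eta_nonneg: "0 \<le> \<eta>"
  using head[of 0 0] norm_ge_zero order_trans by blast

abbreviation y where "y l \<equiv> lin_comb (u l) x"

lemma norm_y: "norm (y l) \<le> 1"
  using norm_lin_comb_le[OF u] norm_u by (rule order_trans)

text \<open>If the block lies inside or outside the segment, \<open>head\<close> and
  \<open>tail\<close> say that the frame projection acts on \<open>y l\<close> nearly as the segment
  does, and each of its two partial projections costs \<open>\<eta>\<close>. If an end point cuts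
  the block, only the crude bound \<open>1 + C\<close> is left, paid for by the indicator
  terms.\<close>

lemma seg_approx:
  assumes m: "1 \<le> m" "m \<le> n"
  shows "norm (seg x m n (u l) - frame_proj x f m n (y l)) \<le>
    2 * \<eta> + (1 + C) * of_bool (s l < m \<and> m \<le> s (Suc l)) + (1 + C) * of_bool (s l < n \<and> n \<le> s (Suc l))"
    (is "?lhs \<le> ?rhs")
proof -
  let ?P = "\<lambda>t. frame_proj x f 1 t (y l)"
  have P: "frame_proj x f m n (y l) = ?P n - ?P (m - 1)" by (rule frame_proj_split[OF m])
  have eta: "0 \<le> \<eta>" by (rule eta_nonneg)
  have tri: "norm (a - b) \<le> \<eta> + \<eta>" if "norm a \<le> \<eta>" "norm b \<le> \<eta>" for a b :: 'x
    using norm_triangle_ineq4[of a b] that by linarith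
  consider "s l < m \<and> m \<le> s (Suc l) \<or> s l < n \<and> n \<le> s (Suc l)" | "s (Suc l) < m" | "n \<le> s l"
    | "m \<le> s l" "s (Suc l) < n" by linarith
  then show ?thesis
  proof cases
    case 1
    have "norm (seg x m n (u l)) \<le> 1" using norm_seg_le[OF u m(1)] norm_u by (rule order_trans)
    moreover have "norm (frame_proj x f m n (y l)) \<le> C"
      using proj_le[OF m(1), of n "y l"] mult_left_mono[OF norm_y C] by (simp add: order_trans)
    ultimately have "?lhs \<le> 1 + C" using norm_triangle_ineq4[of "seg x m n (u l)"] by (smt (verit))
    also have "\<dots> \<le> ?rhs" using 1 eta C by auto
    finally show ?thesis .
  next
    case 2
    have "seg x m n (u l) = 0" using 2 supp[of l] by (intro seg_eq_0) force
    then have "?lhs = norm ((?P (m - 1) - y l) - (?P n - y l))" by (simp add: P)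
    also have "\<dots> \<le> \<eta> + \<eta>" by (intro tri tail) (use 2 m in auto)
    finally show ?thesis using C by simp
  next
    case 3
    have "seg x m n (u l) = 0" using 3 supp[of l] by (intro seg_eq_0) force
    then have "?lhs = norm (?P (m - 1) - ?P n)" by (simp add: P)
    also have "\<dots> \<le> \<eta> + \<eta>" by (intro tri head) (use 3 m in auto)
    finally show ?thesis using C by simp
  next
    case 4
    have "seg x m n (u l) = y l" using 4 supp[of l] by (intro seg_eq_lin_comb) force
    then have "?lhs = norm (?P (m - 1) - (?P n - y l))" by (simp add: P algebra_simps)
    also have "\<dots> \<le> \<eta> + \<eta>" by (intro tri tail head) (use 4 m in auto)
    finally show ?thesis using C by simp
  qed
qed

text \<open>The segment starts in block \<open>l1\<close>, so earlier blocks vanish, and for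
  \<open>l1\<close> and its successor the trivial bound 1 suffices. For a later block,
  \<open>level\<close> provides a higher level \<open>K\<close> whose threshold lies before the
  block; its bound \<open>1 / 2 ^ K\<close> beats the weight \<open>2 ^ k\<close>.\<close>

lemma level_term_le:
  assumes k: "k \<in> L" "1 \<le> m0" "m0 \<le> n0" "n0 \<le> k" "N k \<le> m" and l1: "s l1 < m" "m \<le> s (Suc l1)"
  shows "2 ^ k * norm (frame_proj x f m0 n0 (seg x m n (u l))) \<le> 2 * (if l < l1 then 0 else (1 / 2) ^ (l - l1))"
proof -
  have le1: "2 ^ k * norm (frame_proj x f m0 n0 (seg x m n (u l))) \<le> 1"
    using frame_proj_seg_le[OF u k] norm_u by (rule order_trans)
  consider "l < l1" | "l = l1" | "l = Suc l1" | d where "l = Suc (Suc l1 + d)"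
    using less_imp_Suc_add[of "Suc l1" l] by fastforce
  then show ?thesis
  proof cases
    case 1
    then have "s (Suc l) \<le> s l1" using strict_mono_less_eq[OF s_strict] by simp
    then have "seg x m n (u l) = 0" using l1 supp[of l] by (intro seg_eq_0) force
    then show ?thesis by (simp add: linear_0[OF linear_frame_proj] 1)
  next
    case 4
    obtain K where K: "K \<in> L" "s (Suc l1 + d) < K" "N K \<le> s l" using level[of "Suc l1 + d"] k(1) 4 by auto
    \<comment> \<open>Combines \<open>k \<le> N k \<le> m \<le> s (Suc l1)\<close> with the growth
      of \<open>s\<close> by at least one per block.\<close>
    have kK: "k + d < K" using s_add[of "Suc l1" d] N_ge[OF k(1)] k(5) l1(2) K(2) by linarith
    have "seg x m n (u l) = seg x (max m (N K)) n (u l)"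
      by (rule seg_cong_start) (use supp[of l] K(3) s_strict l1(2) 4 strict_mono_less_eq[OF s_strict, of "Suc l1" l] in force)+
    moreover have "2 ^ K * norm (frame_proj x f m0 n0 (seg x (max m (N K)) n (u l))) \<le> 1"
      using frame_proj_seg_le[OF u K(1), of m0 n0 "max m (N K)" n l] k kK norm_u[of l] by simp
    ultimately have "norm (frame_proj x f m0 n0 (seg x m n (u l))) \<le> 1 / 2 ^ K" by (simp add: field_simps)
    then have "2 ^ k * norm (frame_proj x f m0 n0 (seg x m n (u l))) \<le> 2 ^ k * (1 / 2 ^ K)" by (intro mult_left_mono) auto
    also have "\<dots> \<le> 2 ^ k * (1 / 2 ^ (k + Suc d))"
      using kK by (intro mult_left_mono divide_left_mono power_increasing) auto
    also have "\<dots> = 2 * (1 / 2) ^ (l - l1)" using 4 by (simp add: power_add power_divide)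
    finally show ?thesis using 4 by simp
  qed (use le1 in auto)
qed

text \<open>Plain segments cost \<open>2 * \<eta>\<close> for the approximation,
  \<open>2 * (1 + C) * \<delta>\<close> for the blocks cut by the end points and
  \<open>C * \<delta>\<close> for projecting the small combination of the \<open>y l\<close>. Level
  terms cost \<open>4 * \<delta>\<close> by the geometric series. The stated bound covers
  both.\<close>

theorem convex_combination_bound:
  assumes c: "\<And>l. 0 \<le> c l" "(\<Sum>l<n. c l) = 1" "\<And>l. l < n \<Longrightarrow> c l \<le> \<delta>" "0 \<le> \<delta>"
    and y: "norm (\<Sum>l<n. c l *\<^sub>R y l) \<le> \<delta>"
  shows "norm (\<Sum>l<n. c l *\<^sub>R lin_comb (u l) z) \<le> 2 * \<eta> + (3 * C + 4) * \<delta>"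
proof -
  define v where "v i = (\<Sum>l<n. c l * u l i)" for i
  have v: "v \<in> c00" unfolding v_def using u by (intro c00_sum) auto
  have mono: "mono s" using s_strict by (rule strict_mono_mono)
  have "seg_bound x f N L (2 * \<eta> + (3 * C + 4) * \<delta>) v"
    unfolding seg_bound_def
  proof (intro conjI allI ballI impI)
    fix m p :: nat assume "1 \<le> m \<and> m \<le> p"
    then have m: "1 \<le> m" "m \<le> p" by auto
    let ?a = "\<lambda>l. of_bool (s l < m \<and> m \<le> s (Suc l)) :: real" and ?b = "\<lambda>l. of_bool (s l < p \<and> p \<le> s (Suc l)) :: real"
    have "seg x m p v = (\<Sum>l<n. c l *\<^sub>R seg x m p (u l))"
      unfolding v_def by (rule seg_sum)
    also have "\<dots> = (\<Sum>l<n. c l *\<^sub>R (seg x m p (u l) - frame_proj x f m p (y l))) + frame_proj x f m p (\<Sum>l<n. c l *\<^sub>R y l)"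
      by (simp add: linear_sum[OF linear_frame_proj] linear_scale[OF linear_frame_proj] algebra_simps sum_subtractf)
    finally have eq: "seg x m p v = \<dots>" .
    have expand: "(\<Sum>l<n. c l * (A + B * \<alpha> l + B * \<beta> l)) =
        A * (\<Sum>l<n. c l) + B * (\<Sum>l<n. c l * \<alpha> l) + B * (\<Sum>l<n. c l * \<beta> l)" for A B \<alpha> \<beta>
      by (simp add: sum_distrib_left sum.distrib algebra_simps)
    have "norm (\<Sum>l<n. c l *\<^sub>R (seg x m p (u l) - frame_proj x f m p (y l))) \<le>
        (\<Sum>l<n. c l * (2 * \<eta> + (1 + C) * ?a l + (1 + C) * ?b l))"
    proof (rule sum_norm_le)
      fix l
      show "norm (c l *\<^sub>R (seg x m p (u l) - frame_proj x f m p (y l))) \<le> c l * (2 * \<eta> + (1 + C) * ?a l + (1 + C) * ?b l)"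
        using mult_left_mono[OF seg_approx[OF m, of l] c(1)[of l]] c(1)[of l] by simp
    qed
    also have "\<dots> = 2 * \<eta> * (\<Sum>l<n. c l) + (1 + C) * (\<Sum>l<n. c l * ?a l) + (1 + C) * (\<Sum>l<n. c l * ?b l)"
      by (rule expand)
    also have "\<dots> \<le> 2 * \<eta> * 1 + (1 + C) * \<delta> + (1 + C) * \<delta>"
      using C c eta_nonneg by (intro add_mono mult_left_mono sum_of_bool_disjoint_le[OF mono]) auto
    finally have "norm (\<Sum>l<n. c l *\<^sub>R (seg x m p (u l) - frame_proj x f m p (y l))) \<le> 2 * \<eta> + 2 * (1 + C) * \<delta>"
      by (simp add: algebra_simps)
    moreover have "norm (frame_proj x f m p (\<Sum>l<n. c l *\<^sub>R y l)) \<le> C * \<delta>"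
      using proj_le[OF m(1)] mult_left_mono[OF y C] by (rule order_trans)
    ultimately have "norm (seg x m p v) \<le> 2 * \<eta> + 2 * (1 + C) * \<delta> + C * \<delta>"
      unfolding eq by (intro order_trans[OF norm_triangle_ineq add_mono])
    then show "norm (seg x m p v) \<le> 2 * \<eta> + (3 * C + 4) * \<delta>" using c(4) by (simp add: algebra_simps)
  next
    fix k m0 n0 m p assume kL: "k \<in> L" and "1 \<le> m0 \<and> m0 \<le> n0 \<and> n0 \<le> k \<and> N k \<le> m \<and> m \<le> p"
    then have k: "k \<in> L" "1 \<le> m0" "m0 \<le> n0" "n0 \<le> k" "N k \<le> m" by auto
    have "1 \<le> m" using N_ge[OF kL] k(5) by simp
    have "m \<le> s (Suc m)" using s_add[of 0 "Suc m"] s0 by simp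
    \<comment> \<open>The block interval containing \<open>m\<close>; it exists because these
      intervals start at \<open>s 0 = 0\<close> and exhaust the positive integers.\<close>
    define l1 where "l1 = (LEAST l. m \<le> s (Suc l))"
    have l1: "m \<le> s (Suc l1)" unfolding l1_def by (rule LeastI) fact
    moreover have "s l1 < m"
    proof (cases l1)
      case 0
      then show ?thesis using s0 \<open>1 \<le> m\<close> by simp
    next
      case (Suc j)
      then have "\<not> m \<le> s (Suc j)" unfolding l1_def by (intro not_less_Least) simp
      then show ?thesis using Suc by simp
    qed
    ultimately have term_le: "2 ^ k * norm (frame_proj x f m0 n0 (seg x m p (u l))) \<le> 2 * (if l < l1 then 0 else (1 / 2) ^ (l - l1))" for l
      by (intro level_term_le[OF k])
    have "frame_proj x f m0 n0 (seg x m p v) = (\<Sum>l<n. c l *\<^sub>R frame_proj x f m0 n0 (seg x m p (u l)))"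
      unfolding v_def seg_sum by (simp add: linear_sum[OF linear_frame_proj] linear_scale[OF linear_frame_proj])
    then have "2 ^ k * norm (frame_proj x f m0 n0 (seg x m p v)) \<le> 2 ^ k * (\<Sum>l<n. c l * norm (frame_proj x f m0 n0 (seg x m p (u l))))"
      using c(1) by (auto intro!: mult_left_mono sum_norm_le)
    also have "\<dots> = (\<Sum>l<n. c l * (2 ^ k * norm (frame_proj x f m0 n0 (seg x m p (u l)))))"
      by (simp add: sum_distrib_left mult_ac)
    also have "\<dots> \<le> (\<Sum>l<n. \<delta> * (2 * (if l < l1 then 0 else (1 / 2) ^ (l - l1))))"
    proof (rule sum_mono)
      fix l assume "l \<in> {..<n}"
      then show "c l * (2 ^ k * norm (frame_proj x f m0 n0 (seg x m p (u l)))) \<le>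
          \<delta> * (2 * (if l < l1 then 0 else (1 / 2) ^ (l - l1)))"
        using c by (intro mult_mono[OF _ term_le]) auto
    qed
    also have "\<dots> = 2 * \<delta> * (\<Sum>l<n. if l < l1 then 0 else (1 / 2) ^ (l - l1))"
      by (simp add: sum_distrib_left mult_ac)
    also have "\<dots> \<le> 2 * \<delta> * 2"
      using c(4) by (intro mult_left_mono order_trans[OF sum_half_powers_le]) auto
    also have "\<dots> \<le> 2 * \<eta> + (3 * C + 4) * \<delta>" using c(4) C eta_nonneg by (simp add: algebra_simps)
    finally show "2 ^ k * norm (frame_proj x f m0 n0 (seg x m p v)) \<le> 2 * \<eta> + (3 * C + 4) * \<delta>" .
  qed
  then have "norm (lin_comb v z) \<le> 2 * \<eta> + (3 * C + 4) * \<delta>" using norm_le_iff[OF v] by blast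
  moreover have "lin_comb v z = (\<Sum>l<n. c l *\<^sub>R lin_comb (u l) z)"
    unfolding v_def by (rule lin_comb_sum) (use u in auto)
  ultimately show ?thesis by simp
qed

end

section \<open>The gliding hump argument\<close>

context segment_basis
begin

lemma norming_tail_vector:
  assumes h: "bounded_linear_on Z h" and e: "0 < e"
    and not_small: "\<And>M. \<exists>a\<in>c00. (\<forall>i<M. a i = 0) \<and> e * norm (lin_comb a z) < \<bar>h (lin_comb a z)\<bar>"
  shows "\<exists>a\<in>c00. (\<forall>i<M. a i = 0) \<and> norm (lin_comb a z) \<le> 1 \<and> e \<le> h (lin_comb a z)"
proof -
  obtain a where a: "a \<in> c00" "\<forall>i<M. a i = 0" "e * norm (lin_comb a z) < \<bar>h (lin_comb a z)\<bar>"
    using not_small by blast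
  have Z: "lin_comb a z \<in> Z" by (rule lin_comb_in_basis[OF schauder_basis a(1)])
  have scale: "h (c *\<^sub>R lin_comb a z) = c * h (lin_comb a z)" for c
    using h Z unfolding bounded_linear_on_def by simp
  define t where "t = sgn (h (lin_comb a z)) / norm (lin_comb a z)"
  have "lin_comb a z \<noteq> 0" using a(3) scale[of 0] by auto
  then have nz: "0 < norm (lin_comb a z)" by simp
  have "norm (lin_comb (\<lambda>i. t * a i) z) \<le> 1"
    unfolding lin_comb_scale using nz by (simp add: t_def abs_mult abs_sgn_eq)
  moreover have "h (lin_comb (\<lambda>i. t * a i) z) = \<bar>h (lin_comb a z)\<bar> / norm (lin_comb a z)"
    unfolding lin_comb_scale scale by (simp add: t_def abs_sgn mult_ac)
  moreover have "e \<le> \<bar>h (lin_comb a z)\<bar> / norm (lin_comb a z)"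
    using a(3) nz by (simp add: pos_le_divide_eq)
  ultimately show ?thesis using a c00_scale[OF a(1)] by (intro bexI[of _ "\<lambda>i. t * a i"]) simp_all
qed

text \<open>One step of a gliding hump, from an arbitrary position \<open>s\<close>; vector and new
  end point form a pair so that one choice function can be iterated. Smallness of the coordinates
  far out controls the projections up to \<open>s\<close>, convergence of the frame expansion those
  beyond the new end.\<close>

lemma block_step:
  assumes h: "bounded_linear_on Z h" and e: "0 < e" and \<eta>: "0 < \<eta>"
    and coord: "\<And>i d. 1 \<le> i \<Longrightarrow> 0 < d \<Longrightarrow>
      \<exists>M. \<forall>a\<in>c00. (\<forall>j<M. a j = 0) \<longrightarrow> norm (lin_comb a z) \<le> 1 \<longrightarrow> \<bar>f i (lin_comb a x)\<bar> \<le> d"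
    and not_small: "\<And>M. \<exists>a\<in>c00. (\<forall>i<M. a i = 0) \<and> e * norm (lin_comb a z) < \<bar>h (lin_comb a z)\<bar>"
  shows "\<exists>us. fst us \<in> c00 \<and> norm (lin_comb (fst us) z) \<le> 1 \<and> e \<le> h (lin_comb (fst us) z) \<and> s < snd us \<and>
    (\<forall>i. fst us i \<noteq> 0 \<longrightarrow> s < i \<and> i \<le> snd us) \<and>
    (\<forall>t\<le>s. norm (frame_proj x f 1 t (lin_comb (fst us) x)) \<le> \<eta>) \<and>
    (\<forall>t\<ge>snd us. norm (frame_proj x f 1 t (lin_comb (fst us) x) - lin_comb (fst us) x) \<le> \<eta>) \<and>
    (L \<noteq> {} \<longrightarrow> (\<exists>K\<in>L. s < K \<and> N K \<le> snd us))"
proof -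
  \<comment> \<open>Coordinates of size at most \<open>\<eta> / D\<close> keep all partial
    projections up to \<open>s\<close> below \<open>\<eta>\<close>; the 1 keeps \<open>D\<close>
    positive.\<close>
  define D where "D = (\<Sum>i=1..s. norm (x i)) + 1"
  have D: "0 < D" by (auto simp: D_def intro!: add_nonneg_pos sum_nonneg)
  have "\<exists>M. \<forall>i. 1 \<le> i \<longrightarrow> (\<forall>a\<in>c00. (\<forall>j<M i. a j = 0) \<longrightarrow> norm (lin_comb a z) \<le> 1 \<longrightarrow> \<bar>f i (lin_comb a x)\<bar> \<le> \<eta> / D)"
    by (rule choice) (use coord[of _ "\<eta> / D"] \<eta> D in auto)
  then obtain M where M: "\<And>i a. 1 \<le> i \<Longrightarrow> a \<in> c00 \<Longrightarrow> (\<And>j. j < M i \<Longrightarrow> a j = 0) \<Longrightarrow> norm (lin_comb a z) \<le> 1 \<Longrightarrow>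
      \<bar>f i (lin_comb a x)\<bar> \<le> \<eta> / D" by blast
  define M' where "M' = Suc s + (\<Sum>i=1..s. M i)"
  have M': "M i \<le> M'" if "1 \<le> i" "i \<le> s" for i
    using member_le_sum[of i "{1..s}" M] that by (simp add: M'_def)
  obtain a where a: "a \<in> c00" "\<And>i. i < M' \<Longrightarrow> a i = 0" "norm (lin_comb a z) \<le> 1" "e \<le> h (lin_comb a z)"
    using norming_tail_vector[OF h e not_small, of M'] by blast
  obtain n where n: "\<And>i. n < i \<Longrightarrow> a i = 0" using c00_bound[OF a(1)] by blast
  let ?y = "lin_comb a x"
  from LIMSEQ_D[OF frame_lim[of ?y] \<eta>] obtain n1 where
    n1: "\<And>t. n1 \<le> t \<Longrightarrow> norm (frame_proj x f 1 t ?y - ?y) < \<eta>" by blast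
  obtain K where K: "L \<noteq> {} \<Longrightarrow> K \<in> L \<and> s < K" using L_unbounded[of s] by blast
  \<comment> \<open>The summands put the end beyond \<open>s\<close>, the support of
    \<open>a\<close>, the onset of frame convergence and the threshold of a level above
    \<open>s\<close>.\<close>
  define s' where "s' = Suc s + n + n1 + N K"
  have "norm (frame_proj x f 1 t ?y) \<le> \<eta>" if t: "t \<le> s" for t
  proof -
    have "norm (frame_proj x f 1 t ?y) \<le> (\<Sum>i=1..t. \<eta> / D * norm (x i))"
      unfolding frame_proj_def
    proof (rule sum_norm_le)
      fix i assume i: "i \<in> {1..t}"
      have "\<bar>f i ?y\<bar> \<le> \<eta> / D"
        using i t M'[of i] a(2) by (intro M a(1,3)) auto
      from mult_right_mono[OF this norm_ge_zero[of "x i"]]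
      show "norm (f i ?y *\<^sub>R x i) \<le> \<eta> / D * norm (x i)" by simp
    qed
    also have "\<dots> \<le> (\<Sum>i=1..s. \<eta> / D * norm (x i))"
      using t \<eta> D by (intro sum_mono2) auto
    also have "\<dots> = \<eta> / D * (D - 1)" by (simp add: D_def sum_distrib_left)
    also have "\<dots> \<le> \<eta>" using \<eta> D by (simp add: field_simps)
    finally show ?thesis .
  qed
  moreover have "s < i \<and> i \<le> s'" if "a i \<noteq> 0" for i
    using a(2)[of i] n[of i] that by (cases "i < M'"; cases "n < i") (auto simp: M'_def s'_def)
  moreover have "norm (frame_proj x f 1 t ?y - ?y) \<le> \<eta>" if "s' \<le> t" for t
    using n1[of t] that by (simp add: s'_def)
  moreover have "L \<noteq> {} \<longrightarrow> (\<exists>K\<in>L. s < K \<and> N K \<le> s')"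
    by (intro impI bexI[of _ K]) (use K in \<open>simp_all add: s'_def\<close>)
  moreover have "s < s'" by (simp add: s'_def)
  ultimately show ?thesis using a by (intro exI[of _ "(a, s')"]) auto
qed

theorem shrinking_basis:
  assumes coord: "\<And>i d. 1 \<le> i \<Longrightarrow> 0 < d \<Longrightarrow>
      \<exists>M. \<forall>a\<in>c00. (\<forall>j<M. a j = 0) \<longrightarrow> norm (lin_comb a z) \<le> 1 \<longrightarrow> \<bar>f i (lin_comb a x)\<bar> \<le> d"
  shows "shrinking_basis Z z"
proof (rule shrinking_basisI, rule ccontr)
  fix h and e :: real
  assume h: "bounded_linear_on Z h" and e: "0 < e"
    and neg: "\<not> (\<exists>M. \<forall>a\<in>c00. (\<forall>i<M. a i = 0) \<longrightarrow> \<bar>h (lin_comb a z)\<bar> \<le> e * norm (lin_comb a z))"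
  have not_small: "\<exists>a\<in>c00. (\<forall>i<M. a i = 0) \<and> e * norm (lin_comb a z) < \<bar>h (lin_comb a z)\<bar>" for M
    using neg by (auto simp: not_le)
  obtain H where H: "0 < H" "\<And>v. v \<in> Z \<Longrightarrow> norm (h v) \<le> H * norm v"
  proof -
    obtain H where H: "\<And>v. v \<in> Z \<Longrightarrow> norm (h v) \<le> H * norm v" using h unfolding bounded_linear_on_def by blast
    have "norm (h v) \<le> (\<bar>H\<bar> + 1) * norm v" if "v \<in> Z" for v
      by (rule order_trans[OF H[OF that]]) (intro mult_right_mono, auto)
    then show thesis using that[of "\<bar>H\<bar> + 1"] by auto
  qed
  \<comment> \<open>With \<open>\<eta> = \<delta>\<close> the convex combination has norm at most
    \<open>(3 * C + 6) * \<delta>\<close>, strictly below \<open>e / H\<close>, whereas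
    \<open>h\<close> is at least \<open>e\<close> on it.\<close>
  define \<delta> where "\<delta> = e / (H * (3 * C + 8))"
  have \<delta>: "0 < \<delta>" using e H(1) C by (simp add: \<delta>_def)
  have "\<exists>us. \<forall>s. fst (us s) \<in> c00 \<and> norm (lin_comb (fst (us s)) z) \<le> 1 \<and> e \<le> h (lin_comb (fst (us s)) z) \<and> s < snd (us s) \<and>
    (\<forall>i. fst (us s) i \<noteq> 0 \<longrightarrow> s < i \<and> i \<le> snd (us s)) \<and>
    (\<forall>t\<le>s. norm (frame_proj x f 1 t (lin_comb (fst (us s)) x)) \<le> \<delta>) \<and>
    (\<forall>t\<ge>snd (us s). norm (frame_proj x f 1 t (lin_comb (fst (us s)) x) - lin_comb (fst (us s)) x) \<le> \<delta>) \<and>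
    (L \<noteq> {} \<longrightarrow> (\<exists>K\<in>L. s < K \<and> N K \<le> snd (us s)))"
    by (rule choice) (use block_step[OF h e \<delta> coord not_small] in blast)
  then obtain us where us: "\<And>s. fst (us s) \<in> c00" "\<And>s. norm (lin_comb (fst (us s)) z) \<le> 1"
      "\<And>s. e \<le> h (lin_comb (fst (us s)) z)" "\<And>s. s < snd (us s)"
      "\<And>s i. fst (us s) i \<noteq> 0 \<Longrightarrow> s < i \<and> i \<le> snd (us s)"
      "\<And>s t. t \<le> s \<Longrightarrow> norm (frame_proj x f 1 t (lin_comb (fst (us s)) x)) \<le> \<delta>"
      "\<And>s t. snd (us s) \<le> t \<Longrightarrow> norm (frame_proj x f 1 t (lin_comb (fst (us s)) x) - lin_comb (fst (us s)) x) \<le> \<delta>"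
      "\<And>s. L \<noteq> {} \<Longrightarrow> \<exists>K\<in>L. s < K \<and> N K \<le> snd (us s)"
    by blast
  \<comment> \<open>Each block starts where the preceding one ends.\<close>
  define s where "s = rec_nat 0 (\<lambda>_ s. snd (us s))"
  have s: "s 0 = 0" "s (Suc l) = snd (us (s l))" for l by (simp_all add: s_def)
  define u where "u l = fst (us (s l))" for l
  interpret block_sequence x f C N L z u s \<delta>
    by unfold_locales (use us in \<open>auto simp: u_def s\<close>)
  have null: "(\<lambda>l. g (y l)) \<longlonglongrightarrow> 0" if g: "bounded_linear g" for g :: "'x \<Rightarrow> real"
  proof (rule weakly_null[OF _ norm_y g])
    fix i :: nat assume i: "1 \<le> i"
    show "(\<lambda>l. f i (y l)) \<longlonglongrightarrow> 0"
    proof (rule LIMSEQ_I)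
      fix r :: real assume r: "0 < r"
      then obtain M where M: "\<And>a. a \<in> c00 \<Longrightarrow> (\<And>j. j < M \<Longrightarrow> a j = 0) \<Longrightarrow> norm (lin_comb a z) \<le> 1 \<Longrightarrow>
          \<bar>f i (lin_comb a x)\<bar> \<le> r / 2" using coord[OF i, of "r / 2"] by auto
      have "norm (f i (y l) - 0) < r" if "M \<le> l" for l
      proof -
        have "u l j = 0" if "j < M" for j
        proof (rule ccontr)
          assume "u l j \<noteq> 0"
          then have "s l < j" using supp by blast
          then show False using s_add[of 0 l] that \<open>M \<le> l\<close> by simp
        qed
        then show ?thesis using M[OF u _ norm_u, of l] r by simp
      qed
      then show "\<exists>M. \<forall>l\<ge>M. norm (f i (y l) - 0) < r" by blast
    qed
  qed
  obtain c n where c: "\<And>l. 0 \<le> c l" "(\<Sum>l<n. c l) = 1" "norm (\<Sum>l<n. c l *\<^sub>R y l) < \<delta>" "\<And>l. l < n \<Longrightarrow> c l < \<delta>"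
    using flat_convex_combination[where y = y, OF null \<delta>] by blast
  define v where "v = (\<Sum>l<n. c l *\<^sub>R lin_comb (u l) z)"
  have Z: "subspace Z" using schauder_basis by (simp add: schauder_basis_def)
  have uZ: "lin_comb (u l) z \<in> Z" for l by (rule lin_comb_in_basis[OF schauder_basis u])
  have vZ: "v \<in> Z" unfolding v_def using uZ by (intro subspace_sum[OF Z] subspace_scale[OF Z])
  have "norm v \<le> 2 * \<delta> + (3 * C + 4) * \<delta>"
    unfolding v_def using c \<delta> by (intro convex_combination_bound) (auto intro: less_imp_le)
  then have "H * norm v \<le> H * (2 * \<delta> + (3 * C + 4) * \<delta>)" using H(1) by (intro mult_left_mono) auto
  also have "\<dots> < H * ((3 * C + 8) * \<delta>)" using H(1) \<delta> by (intro mult_strict_left_mono) (simp_all add: algebra_simps)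
  also have "\<dots> = H * (3 * C + 8) * \<delta>" by simp
  also have "\<dots> = e"
  proof -
    have "3 * C + 8 \<noteq> 0" using C by linarith
    then show ?thesis unfolding \<delta>_def using H(1) by simp
  qed
  finally have "H * norm v < e" .
  moreover have "e = (\<Sum>l<n. c l * e)" using c(2) by (simp add: sum_distrib_right[symmetric])
  moreover have "(\<Sum>l<n. c l * e) \<le> (\<Sum>l<n. c l * h (lin_comb (u l) z))"
    using c(1) us(3) by (intro sum_mono mult_left_mono) (auto simp: u_def)
  moreover have "\<dots> = h v" unfolding v_def using bounded_linear_on_sum[OF h Z, of "{..<n}" "\<lambda>l. lin_comb (u l) z" c] uZ by simp
  moreover have "h v \<le> H * norm v" using H(2)[OF vZ] by simp
  ultimately show False by linarith
qed

end

section \<open>From suprema to upper bounds\<close>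

lemma min_norm_le_iff:
  assumes a: "a \<in> c00"
  shows "min_norm x a \<le> B \<longleftrightarrow> seg_bound x f N {} B a"
proof -
  have "norm (seg x m n a) \<le> (\<Sum>i | a i \<noteq> 0. norm (a i *\<^sub>R x i))" for m n
  proof -
    have "norm (seg x m n a) \<le> (\<Sum>i=m..n. norm (a i *\<^sub>R x i))" unfolding seg_def by (rule norm_sum)
    also have "\<dots> = (\<Sum>i\<in>{m..n} \<inter> {i. a i \<noteq> 0}. norm (a i *\<^sub>R x i))" by (intro sum.mono_neutral_right) auto
    also have "\<dots> \<le> (\<Sum>i | a i \<noteq> 0. norm (a i *\<^sub>R x i))"
      using a by (intro sum_mono2) (auto simp: c00_def)
    finally show ?thesis .
  qed
  then have "bdd_above ((\<lambda>(m, n). norm (\<Sum>i=m..n. a i *\<^sub>R x i)) ` {(m, n). 1 \<le> m \<and> m \<le> n})"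
    by (intro bdd_aboveI2[where M = "\<Sum>i | a i \<noteq> 0. norm (a i *\<^sub>R x i)"]) (auto simp: seg_def)
  moreover have "(1, 1) \<in> {(m, n). 1 \<le> m \<and> m \<le> (n :: nat)}" by simp
  then have "{(m, n). 1 \<le> m \<and> m \<le> (n :: nat)} \<noteq> {}" by blast
  ultimately show ?thesis
    unfolding min_norm_def by (subst cSUP_le_iff) (auto simp: seg_bound_def seg_def)
qed

lemma level_norm_le_iff:
  assumes bdd: "seg_bound x f N L B0 a" and k: "k \<in> L" "1 \<le> k"
  shows "level_norm x f N k a \<le> B \<longleftrightarrow> (\<forall>m0 n0 m n. 1 \<le> m0 \<and> m0 \<le> n0 \<and> n0 \<le> k \<and> N k \<le> m \<and> m \<le> n \<longrightarrow>
     2 ^ k * norm (frame_proj x f m0 n0 (seg x m n a)) \<le> B)"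
proof -
  let ?I = "{(m0, n0, m, n). 1 \<le> m0 \<and> m0 \<le> n0 \<and> n0 \<le> k \<and> N k \<le> m \<and> m \<le> n}"
  have "bdd_above ((\<lambda>(m0, n0, m, n). 2 ^ k * norm (frame_proj x f m0 n0 (\<Sum>i=m..n. a i *\<^sub>R x i))) ` ?I)"
    using seg_bound_levelD[OF bdd k(1)] by (intro bdd_aboveI2[where M = B0]) (auto simp: seg_def)
  moreover have "(1, 1, N k, N k) \<in> ?I" using k by simp
  then have "?I \<noteq> {}" by blast
  ultimately show ?thesis
    unfolding level_norm_def by (subst cSUP_le_iff) (auto simp: seg_def)
qed

text \<open>The bound \<open>B0\<close>, whatever its size, makes the suprema meaningful, since a
  supremum of reals says nothing over an unbounded set. In the application it comes from domination
  by \<open>w\<close>.\<close>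

lemma Z_norm_le_iff:
  assumes a: "a \<in> c00" and bdd: "seg_bound x f N (ks ` {1..}) B0 a" and ks: "\<And>j. 1 \<le> j \<Longrightarrow> 1 \<le> ks j"
  shows "Z_norm x f ks N a \<le> B \<longleftrightarrow> seg_bound x f N (ks ` {1..}) B a"
proof -
  have lev: "level_norm x f N (ks j) a \<le> B \<longleftrightarrow> (\<forall>m0 n0 m n. 1 \<le> m0 \<and> m0 \<le> n0 \<and> n0 \<le> ks j \<and> N (ks j) \<le> m \<and> m \<le> n \<longrightarrow>
     2 ^ ks j * norm (frame_proj x f m0 n0 (seg x m n a)) \<le> B)" if "1 \<le> j" for j B
    using that by (intro level_norm_le_iff[OF bdd] ks) auto
  have "level_norm x f N (ks j) a \<le> B0" if "1 \<le> j" for j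
    unfolding lev[OF that] using seg_bound_levelD[OF bdd] that by auto
  then have "bdd_above ((\<lambda>j. level_norm x f N (ks j) a) ` {1..})"
    by (intro bdd_aboveI2[where M = B0]) auto
  moreover have "{1 :: nat..} \<noteq> {}" by simp
  ultimately have "(SUP j\<in>{1..}. level_norm x f N (ks j) a) \<le> B \<longleftrightarrow> (\<forall>j\<in>{1..}. level_norm x f N (ks j) a \<le> B)"
    by (intro cSUP_le_iff)
  then show ?thesis
    unfolding Z_norm_def max.bounded_iff min_norm_le_iff[OF a, of x B f N] using lev[where B = B]
    by (auto simp: seg_bound_def)
qed

subsection \<open>Completions inside the space of bounded sequences\<close>

text \<open>The value \<open>k = 0\<close>, which is never a level, encodes the terms of the minimal norm.\<close>

definition level_row :: "(nat \<Rightarrow> 'a::banach) \<Rightarrow> (nat \<Rightarrow> 'a \<Rightarrow>\<^sub>L real) \<Rightarrow> (nat \<Rightarrow> nat) \<Rightarrow> nat set \<Rightarrow>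
    nat \<times> nat \<times> nat \<times> nat \<times> nat \<Rightarrow> (nat \<Rightarrow> real) \<Rightarrow> 'a" where
  "level_row x f N L t a = (case t of (k, m0, n0, m, n) \<Rightarrow>
     if k = 0 then (if 1 \<le> m \<and> m \<le> n then seg x m n a else 0)
     else if k \<in> L \<and> 1 \<le> m0 \<and> m0 \<le> n0 \<and> n0 \<le> k \<and> N k \<le> m \<and> m \<le> n
       then 2 ^ k *\<^sub>R frame_proj x f m0 n0 (seg x m n a) else 0)"

lemma level_row_sum: "level_row x f N L t (\<lambda>j. \<Sum>i\<in>A. c i * u i j) = (\<Sum>i\<in>A. c i *\<^sub>R level_row x f N L t (u i))"
  unfolding level_row_def
  by (cases t) (auto simp: seg_sum linear_sum[OF linear_frame_proj] linear_scale[OF linear_frame_proj] scaleR_sum_right mult.commute)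

lemma level_row_bound_iff:
  assumes "0 \<notin> L"
  shows "(\<forall>t. norm (level_row x f N L t a) \<le> B) \<longleftrightarrow> seg_bound x f N L B a"
proof
  assume rows: "\<forall>t. norm (level_row x f N L t a) \<le> B"
  have "norm (seg x m n a) \<le> B" if "1 \<le> m" "m \<le> n" for m n
    using rows[rule_format, of "(0, 0, 0, m, n)"] that by (simp add: level_row_def)
  moreover have "2 ^ k * norm (frame_proj x f m0 n0 (seg x m n a)) \<le> B"
    if "k \<in> L" "1 \<le> m0" "m0 \<le> n0" "n0 \<le> k" "N k \<le> m" "m \<le> n" for k m0 n0 m n
    using rows[rule_format, of "(k, m0, n0, m, n)"] that assms by (cases "k = 0") (auto simp: level_row_def)
  ultimately show "seg_bound x f N L B a" by (auto simp: seg_bound_def)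
next
  assume b: "seg_bound x f N L B a"
  show "\<forall>t. norm (level_row x f N L t a) \<le> B"
  proof
    fix t :: "nat \<times> nat \<times> nat \<times> nat \<times> nat"
    obtain k m0 n0 m n where "t = (k, m0, n0, m, n)" by (cases t) auto
    then show "norm (level_row x f N L t a) \<le> B"
      using b seg_bound_nonneg[OF b] by (auto simp: level_row_def seg_bound_def)
  qed
qed

lemma apply_bcontfun_sum: "apply_bcontfun (\<Sum>i\<in>A. g i) t = (\<Sum>i\<in>A. apply_bcontfun (g i) t)"
  by (induction A rule: infinite_finite_induct) (auto simp: plus_bcontfun.rep_eq zero_bcontfun.rep_eq)

definition unit_seq :: "nat \<Rightarrow> nat \<Rightarrow> real" where
  "unit_seq i j = of_bool (j = i)"

lemma unit_seq_c00: "1 \<le> i \<Longrightarrow> unit_seq i \<in> c00"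
  by (rule c00I[of _ i]) (auto simp: unit_seq_def)

lemma c00_eq_sum_unit_seq:
  assumes "a \<in> c00"
  shows "a = (\<lambda>j. \<Sum>i | a i \<noteq> 0. a i * unit_seq i j)"
proof
  fix j
  have "(\<Sum>i | a i \<noteq> 0. a i * unit_seq i j) = (\<Sum>i | a i \<noteq> 0. if j = i then a i else 0)"
    by (intro sum.cong) (auto simp: unit_seq_def)
  also have "\<dots> = a j" using assms by (simp add: c00_def)
  finally show "a j = (\<Sum>i | a i \<noteq> 0. a i * unit_seq i j)" by simp
qed

text \<open>\<open>z i\<close> lists the countably many terms of the norm, evaluated at the i-th
  unit sequence. By linearity \<open>lin_comb a z\<close> lists them at \<open>a\<close>, so its
  supremum norm is at most \<open>B\<close> exactly if all terms are.\<close>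

theorem segment_completion_exists:
  fixes x :: "nat \<Rightarrow> 'a::banach"
  assumes L: "0 \<notin> L" and bdd: "\<And>a. a \<in> c00 \<Longrightarrow> \<exists>B. seg_bound x f N L B a"
  shows "\<exists>z :: nat \<Rightarrow> (nat \<Rightarrow>\<^sub>C 'a). \<forall>a\<in>c00. \<forall>B. norm (lin_comb a z) \<le> B \<longleftrightarrow> seg_bound x f N L B a"
proof -
  define z :: "nat \<Rightarrow> (nat \<Rightarrow>\<^sub>C 'a)" where "z i = Bcontfun (\<lambda>t. level_row x f N L (from_nat t) (unit_seq i))" for i
  have z: "apply_bcontfun (z i) t = level_row x f N L (from_nat t) (unit_seq i)" if i: "1 \<le> i" for i t
  proof -
    obtain B where "seg_bound x f N L B (unit_seq i)" using bdd[OF unit_seq_c00[OF i]] by blast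
    then have B: "norm (level_row x f N L t (unit_seq i)) \<le> B" for t
      using level_row_bound_iff[OF L] by blast
    have "(\<lambda>t. level_row x f N L (from_nat t) (unit_seq i)) \<in> bcontfun"
      by (rule bcontfun_normI[OF _ B]) simp
    then show ?thesis unfolding z_def by (simp add: Bcontfun_inverse)
  qed
  have "norm (lin_comb a z) \<le> B \<longleftrightarrow> seg_bound x f N L B a" if a: "a \<in> c00" for a B
  proof -
    have eq: "apply_bcontfun (lin_comb a z) t = level_row x f N L (from_nat t) a" for t
    proof -
      have "apply_bcontfun (lin_comb a z) t = (\<Sum>i | a i \<noteq> 0. a i *\<^sub>R apply_bcontfun (z i) t)"
        by (simp add: lin_comb_def apply_bcontfun_sum scaleR_bcontfun.rep_eq)
      also have "\<dots> = (\<Sum>i | a i \<noteq> 0. a i *\<^sub>R level_row x f N L (from_nat t) (unit_seq i))"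
      proof (rule sum.cong)
        fix i assume "i \<in> {i. a i \<noteq> 0}"
        then have "1 \<le> i" using c00_0[OF a] by (cases "i = 0") auto
        then show "a i *\<^sub>R apply_bcontfun (z i) t = a i *\<^sub>R level_row x f N L (from_nat t) (unit_seq i)"
          by (simp add: z)
      qed simp
      also have "\<dots> = level_row x f N L (from_nat t) (\<lambda>j. \<Sum>i | a i \<noteq> 0. a i * unit_seq i j)" by (rule level_row_sum[symmetric])
      also have "\<dots> = level_row x f N L (from_nat t) a" using c00_eq_sum_unit_seq[OF a] by simp
      finally show ?thesis .
    qed
    have "norm (lin_comb a z) \<le> B \<longleftrightarrow> (\<forall>t. norm (apply_bcontfun (lin_comb a z) t) \<le> B)"
      using norm_bounded[of "lin_comb a z"] norm_bound[of "lin_comb a z" B] order_trans by blast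
    also have "\<dots> \<longleftrightarrow> (\<forall>t. norm (level_row x f N L t a) \<le> B)"
      unfolding eq by (metis from_nat_to_nat)
    finally show ?thesis unfolding level_row_bound_iff[OF L] .
  qed
  then show ?thesis by blast
qed

subsection \<open>Domination\<close>

text \<open>Domination, applied to differences of partial sums, transfers the Cauchy property. It
  carries expansions from \<open>w\<close> to \<open>z\<close> for the analysis operator and from
  \<open>z\<close> to \<open>x\<close> for the synthesis operator.\<close>

lemma dominated_convergence:
  fixes z :: "nat \<Rightarrow> 'b::banach"
  assumes dom: "\<And>a. a \<in> c00 \<Longrightarrow> norm (lin_comb a z) \<le> K * norm (lin_comb a w)" and K: "0 \<le> K"
    and lim: "(\<lambda>n. \<Sum>i=1..n. a i *\<^sub>R w i) \<longlonglongrightarrow> v"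
  shows "\<exists>u. (\<lambda>n. \<Sum>i=1..n. a i *\<^sub>R z i) \<longlonglongrightarrow> u \<and> norm u \<le> K * norm v"
proof -
  have diff: "norm ((\<Sum>i=1..n. a i *\<^sub>R z i) - (\<Sum>i=1..m. a i *\<^sub>R z i)) \<le>
      K * norm ((\<Sum>i=1..n. a i *\<^sub>R w i) - (\<Sum>i=1..m. a i *\<^sub>R w i))" for m n
    using dom[OF lin_comb_diff(1)[OF trunc_c00 trunc_c00], of 1 1 n a m a]
    by (simp add: lin_comb_diff(2)[OF trunc_c00 trunc_c00] lin_comb_trunc)
  have "Cauchy (\<lambda>n. \<Sum>i=1..n. a i *\<^sub>R z i)"
  proof (rule CauchyI)
    fix e :: real assume e: "0 < e"
    have "0 < e / (K + 1)" using e K by simp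
    from CauchyD[OF LIMSEQ_imp_Cauchy[OF lim] this] obtain M where
      M: "\<And>m n. M \<le> m \<Longrightarrow> M \<le> n \<Longrightarrow> norm ((\<Sum>i=1..m. a i *\<^sub>R w i) - (\<Sum>i=1..n. a i *\<^sub>R w i)) < e / (K + 1)" by blast
    have "norm ((\<Sum>i=1..m. a i *\<^sub>R z i) - (\<Sum>i=1..n. a i *\<^sub>R z i)) < e" if "M \<le> m" "M \<le> n" for m n
    proof -
      have "norm ((\<Sum>i=1..m. a i *\<^sub>R z i) - (\<Sum>i=1..n. a i *\<^sub>R z i)) \<le> K * (e / (K + 1))"
        using diff[of m n] mult_left_mono[OF less_imp_le[OF M[OF that]] K] by linarith
      also have "\<dots> < e" using e K by (simp add: field_simps)
      finally show ?thesis .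
    qed
    then show "\<exists>M. \<forall>m\<ge>M. \<forall>n\<ge>M. norm ((\<Sum>i=1..m. a i *\<^sub>R z i) - (\<Sum>i=1..n. a i *\<^sub>R z i)) < e" by blast
  qed
  then obtain u where u: "(\<lambda>n. \<Sum>i=1..n. a i *\<^sub>R z i) \<longlonglongrightarrow> u"
    unfolding Cauchy_convergent_iff convergent_def by (rule exE)
  have "norm u \<le> K * norm v"
  proof (rule LIMSEQ_le)
    show "(\<lambda>n. norm (\<Sum>i=1..n. a i *\<^sub>R z i)) \<longlonglongrightarrow> norm u" using u by (rule tendsto_norm)
    show "(\<lambda>n. K * norm (\<Sum>i=1..n. a i *\<^sub>R w i)) \<longlonglongrightarrow> K * norm v"
      using lim by (intro tendsto_intros)
    show "\<exists>n0. \<forall>n\<ge>n0. norm (\<Sum>i=1..n. a i *\<^sub>R z i) \<le> K * norm (\<Sum>i=1..n. a i *\<^sub>R w i)"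
      using diff[of _ 0] by simp
  qed
  with u show ?thesis by blast
qed

lemma (in segment_basis) associated_basisI:
  fixes w :: "nat \<Rightarrow> 'w::banach" and T :: "'x \<Rightarrow> 'w"
  assumes dom: "\<And>a. a \<in> c00 \<Longrightarrow> norm (lin_comb a z) \<le> K * norm (lin_comb a w)" and K: "0 \<le> K"
    and T: "bounded_linear T" "\<And>v. (\<lambda>n. \<Sum>i=1..n. f i v *\<^sub>R w i) \<longlonglongrightarrow> T v"
  shows "associated_basis x f Z z"
proof -
  have Z: "subspace Z" "closed Z" and zZ: "\<And>i. 1 \<le> i \<Longrightarrow> z i \<in> Z"
    using schauder_basis by (auto simp: schauder_basis_def)
  have "\<exists>R. \<forall>v. (\<lambda>n. \<Sum>i=1..n. f i v *\<^sub>R z i) \<longlonglongrightarrow> R v \<and> norm (R v) \<le> K * norm (T v)"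
    by (rule choice) (use dominated_convergence[OF dom K T(2)] in blast)
  then obtain R where R: "\<And>v. (\<lambda>n. \<Sum>i=1..n. f i v *\<^sub>R z i) \<longlonglongrightarrow> R v" "\<And>v. norm (R v) \<le> K * norm (T v)" by blast
  obtain KT where KT: "\<And>v. norm (T v) \<le> norm v * KT" using bounded_linear.bounded[OF T(1)] by blast
  have "bounded_linear R"
  proof (rule bounded_linear_intro[where K = "K * KT"])
    fix u v
    have "(\<lambda>n. \<Sum>i=1..n. f i (u + v) *\<^sub>R z i) \<longlonglongrightarrow> R u + R v"
      using tendsto_add[OF R(1)[of u] R(1)[of v]] by (simp add: blinfun.add_right algebra_simps sum.distrib)
    then show "R (u + v) = R u + R v" using R(1)[of "u + v"] LIMSEQ_unique by blast
  next
    fix c v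
    have "(\<lambda>n. \<Sum>i=1..n. f i (c *\<^sub>R v) *\<^sub>R z i) \<longlonglongrightarrow> c *\<^sub>R R v"
      using tendsto_scaleR[OF tendsto_const R(1)[of v], of c] by (simp add: blinfun.scaleR_right scaleR_sum_right)
    then show "R (c *\<^sub>R v) = c *\<^sub>R R v" using R(1)[of "c *\<^sub>R v"] LIMSEQ_unique by blast
  next
    fix v show "norm (R v) \<le> norm v * (K * KT)"
      using R(2)[of v] mult_left_mono[OF KT[of v] K] by (simp add: mult_ac)
  qed
  moreover have "R v \<in> Z" for v
  proof (rule closed_sequentially[OF Z(2) _ R(1)])
    show "(\<Sum>i=1..n. f i v *\<^sub>R z i) \<in> Z" for n
      using zZ by (intro subspace_sum[OF Z(1)] subspace_scale[OF Z(1)]) auto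
  qed
  ultimately have "\<exists>T. bounded_linear T \<and> (\<forall>v. T v \<in> Z \<and> (\<lambda>n. \<Sum>i=1..n. f i v *\<^sub>R z i) \<longlonglongrightarrow> T v)"
    using R(1) by blast
  moreover have "\<exists>S. bounded_linear_on Z S \<and>
        (\<forall>v\<in>Z. \<forall>a. basis_expansion z v a \<longrightarrow> (\<lambda>n. \<Sum>i=1..n. a i *\<^sub>R x i) \<longlonglongrightarrow> S v)"
  proof -
    have "\<exists>S. \<forall>v. v \<in> Z \<longrightarrow> (\<lambda>n. \<Sum>i=1..n. biorthogonal z i v *\<^sub>R x i) \<longlonglongrightarrow> S v \<and> norm (S v) \<le> 1 * norm v"
    proof (rule choice, intro allI, subst ex_simps, rule impI)
      fix v assume v: "v \<in> Z"
      show "\<exists>u. (\<lambda>n. \<Sum>i=1..n. biorthogonal z i v *\<^sub>R x i) \<longlonglongrightarrow> u \<and> norm u \<le> 1 * norm v"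
        by (rule dominated_convergence)
          (use norm_lin_comb_le biorthogonal_expansion[OF schauder_basis v] in \<open>auto simp: basis_expansion_def\<close>)
    qed
    then obtain S where S: "\<And>v. v \<in> Z \<Longrightarrow> (\<lambda>n. \<Sum>i=1..n. biorthogonal z i v *\<^sub>R x i) \<longlonglongrightarrow> S v"
      "\<And>v. v \<in> Z \<Longrightarrow> norm (S v) \<le> 1 * norm v" by blast
    have "S (u + v) = S u + S v" if "u \<in> Z" "v \<in> Z" for u v
    proof -
      have "(\<lambda>n. \<Sum>i=1..n. biorthogonal z i (u + v) *\<^sub>R x i) \<longlonglongrightarrow> S u + S v"
        using tendsto_add[OF S(1)[OF that(1)] S(1)[OF that(2)]]
        by (simp add: biorthogonal_add[OF schauder_basis that] algebra_simps sum.distrib)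
      then show ?thesis using S(1)[OF subspace_add[OF Z(1) that]] LIMSEQ_unique by blast
    qed
    moreover have "S (c *\<^sub>R v) = c *\<^sub>R S v" if "v \<in> Z" for c v
    proof -
      have "(\<lambda>n. \<Sum>i=1..n. biorthogonal z i (c *\<^sub>R v) *\<^sub>R x i) \<longlonglongrightarrow> c *\<^sub>R S v"
        using tendsto_scaleR[OF tendsto_const S(1)[OF that], of c]
        by (simp add: biorthogonal_scale[OF schauder_basis that] scaleR_sum_right)
      then show ?thesis using S(1)[OF subspace_scale[OF Z(1) that]] LIMSEQ_unique by blast
    qed
    ultimately have "bounded_linear_on Z S" using S(2) unfolding bounded_linear_on_def by blast
    moreover have "(\<lambda>n. \<Sum>i=1..n. a i *\<^sub>R x i) \<longlonglongrightarrow> S v" if "v \<in> Z" "basis_expansion z v a" for v a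
      using S(1)[OF that(1)] biorthogonal_eq[OF schauder_basis that] by simp
    ultimately show ?thesis by blast
  qed
  ultimately show ?thesis unfolding associated_basis_def using schauder_basis by blast
qed

text \<open>Level \<open>k\<close> contains the projection onto any single index
  \<open>i \<le> k\<close>, and a vector supported from \<open>N k\<close> on is itself a segment.
  Hence its i-th coordinate is at most \<open>1 / (2 ^ k * norm (x i))\<close> on the unit ball, and
  \<open>k\<close> can be taken large.\<close>

lemma (in segment_basis) coordinates_small:
  assumes L: "L \<noteq> {}" and i: "1 \<le> i" and d: "0 < d"
  shows "\<exists>M. \<forall>a\<in>c00. (\<forall>j<M. a j = 0) \<longrightarrow> norm (lin_comb a z) \<le> 1 \<longrightarrow> \<bar>f i (lin_comb a x)\<bar> \<le> d"
proof -
  obtain n where n: "1 / (d * norm (x i)) < real n" using reals_Archimedean2 by blast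
  obtain k where k: "k \<in> L" "n + i < k" using L_unbounded[OF L] by blast
  have nx: "0 < norm (x i)" using x_nonzero[OF i] by simp
  have "real n \<le> 2 ^ n" by (intro less_imp_le of_nat_less_two_power)
  also have "\<dots> \<le> (2::real) ^ k" using k by (intro power_increasing) auto
  finally have "real n * (d * norm (x i)) \<le> 2 ^ k * (d * norm (x i))"
    using d by (intro mult_right_mono) auto
  moreover have "1 < real n * (d * norm (x i))" using n d nx by (simp add: pos_divide_less_eq)
  ultimately have big: "1 < 2 ^ k * (d * norm (x i))" by linarith
  have "\<bar>f i (lin_comb a x)\<bar> \<le> d" if a: "a \<in> c00" "\<forall>j<N k. a j = 0" "norm (lin_comb a z) \<le> 1" for a
  proof -
    obtain n' where n': "\<And>j. n' < j \<Longrightarrow> a j = 0" using c00_bound[OF a(1)] by blast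
    have "seg x (N k) n' a = lin_comb a x"
      by (rule seg_eq_lin_comb) (use n' a(2) in \<open>force simp: not_less[symmetric]\<close>)
    then have "2 ^ k * norm (frame_proj x f i i (lin_comb a x)) \<le> 1"
      using frame_proj_seg_le[OF a(1) k(1) i order_refl, of "N k" n'] k(2) a(3) by simp
    then have "2 ^ k * norm (x i) * \<bar>f i (lin_comb a x)\<bar> \<le> 2 ^ k * norm (x i) * d"
      using big by (simp add: frame_proj_def mult_ac)
    then show ?thesis using nx by simp
  qed
  then show ?thesis by blast
qed

subsection \<open>The choice of the admissible sequence\<close>

locale shrinking_associated =
  fixes x :: "nat \<Rightarrow> 'x::banach" and f :: "nat \<Rightarrow> 'x \<Rightarrow>\<^sub>L real" and w :: "nat \<Rightarrow> 'w::banach"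
  assumes shrinking_frame: "shrinking_frame x f"
    and associated: "associated_basis x f UNIV w"
    and shrinking_w: "shrinking_basis UNIV w"
begin

lemma basis_w: "schauder_basis UNIV w"
  using associated by (simp add: associated_basis_def)

lemma synthesis:
  obtains S where "bounded_linear S" "\<And>a. a \<in> c00 \<Longrightarrow> S (lin_comb a w) = lin_comb a x"
proof -
  obtain S where S: "bounded_linear_on UNIV S"
      "\<And>v a. basis_expansion w v a \<Longrightarrow> (\<lambda>n. \<Sum>i=1..n. a i *\<^sub>R x i) \<longlonglongrightarrow> S v"
    using associated unfolding associated_basis_def by blast
  have "bounded_linear S"
  proof -
    obtain K where "\<And>v. norm (S v) \<le> K * norm v" using S(1) unfolding bounded_linear_on_def by blast
    then show ?thesis
      using S(1) by (intro bounded_linear_intro[where K = K]) (auto simp: bounded_linear_on_def mult.commute)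
  qed
  moreover have "S (lin_comb a w) = lin_comb a x" if a: "a \<in> c00" for a
    using S(2)[OF basis_expansion_lin_comb[OF a]] basis_expansion_lin_comb[OF a, of x]
    by (auto simp: basis_expansion_def intro: LIMSEQ_unique)
  ultimately show thesis by (rule that)
qed

lemma analysis:
  obtains T where "bounded_linear T" "\<And>v. (\<lambda>n. \<Sum>i=1..n. f i v *\<^sub>R w i) \<longlonglongrightarrow> T v"
  using associated unfolding associated_basis_def by blast

lemma norm_trunc_le:
  obtains K where "0 < K"
    "\<And>v a m n. basis_expansion w v a \<Longrightarrow> 1 \<le> m \<Longrightarrow> norm (lin_comb (trunc m n a) w) \<le> K * norm v"
proof -
  obtain K where K: "0 < K" "\<And>v n. norm (\<Sum>i=1..n. biorthogonal w i v *\<^sub>R w i) \<le> K * norm v"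
    using schauder_basis_constant[OF basis_w] by blast
  have "norm (lin_comb (trunc m n a) w) \<le> (2 * K) * norm v"
    if v: "basis_expansion w v a" and m: "1 \<le> m" for v a m n
  proof (cases "m \<le> n")
    case True
    have b: "biorthogonal w i v = a i" for i using biorthogonal_eq[OF basis_w _ v] by simp
    have "(\<Sum>i=1..m - 1 + (n - (m - 1)). a i *\<^sub>R w i) =
        (\<Sum>i=1..m - 1. a i *\<^sub>R w i) + (\<Sum>i=m - 1 + 1..m - 1 + (n - (m - 1)). a i *\<^sub>R w i)"
      by (rule sum.ub_add_nat) (use m in simp)
    then have "lin_comb (trunc m n a) w = (\<Sum>i=1..n. a i *\<^sub>R w i) - (\<Sum>i=1..m - 1. a i *\<^sub>R w i)"
      using True m by (simp add: lin_comb_trunc)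
    then have "norm (lin_comb (trunc m n a) w) \<le> norm (\<Sum>i=1..n. a i *\<^sub>R w i) + norm (\<Sum>i=1..m - 1. a i *\<^sub>R w i)"
      by (simp add: norm_triangle_ineq4)
    then show ?thesis using K(2)[where n = n and v = v] K(2)[where n = "m - 1" and v = v] unfolding b by linarith
  next
    case False
    then show ?thesis using K(1) by (simp add: lin_comb_trunc)
  qed
  then show thesis using that[of "2 * K"] K(1) by simp
qed

text \<open>The value at 0 is reset because expansions are normalised to vanish there.\<close>

lemma frame_coefficients_expansion:
  assumes "(\<lambda>n. \<Sum>i=1..n. f i v *\<^sub>R w i) \<longlonglongrightarrow> u"
  shows "basis_expansion w u (\<lambda>i. if i = 0 then 0 else f i v)"
proof -
  have "(\<Sum>i=1..n. (if i = 0 then 0 else f i v) *\<^sub>R w i) = (\<Sum>i=1..n. f i v *\<^sub>R w i)" for n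
    by (rule sum.cong) auto
  then show ?thesis using assms by (simp add: basis_expansion_def)
qed

lemma frame_proj_eq_seg: "1 \<le> m \<Longrightarrow> frame_proj x f m n v = seg x m n (\<lambda>i. if i = 0 then 0 else f i v)"
  unfolding frame_proj_def seg_def by (rule sum.cong) auto

lemma segments_bounded:
  obtains K where "0 < K" "\<And>v a m n. basis_expansion w v a \<Longrightarrow> 1 \<le> m \<Longrightarrow> norm (seg x m n a) \<le> K * norm v"
proof -
  obtain S where S: "bounded_linear S" "\<And>a. a \<in> c00 \<Longrightarrow> S (lin_comb a w) = lin_comb a x" by (rule synthesis) blast
  obtain K where K: "0 < K"
    "\<And>v a m n. basis_expansion w v a \<Longrightarrow> 1 \<le> m \<Longrightarrow> norm (lin_comb (trunc m n a) w) \<le> K * norm v" by (rule norm_trunc_le) blast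
  obtain KS where KS: "0 < KS" "\<And>v. norm (S v) \<le> norm v * KS" using bounded_linear.pos_bounded[OF S(1)] by blast
  have "norm (seg x m n a) \<le> (KS * K) * norm v" if "basis_expansion w v a" "1 \<le> m" for v a m n
  proof -
    have "seg x m n a = S (lin_comb (trunc m n a) w)"
      using S(2)[OF trunc_c00[OF that(2)]] by (simp add: lin_comb_trunc seg_def)
    then have "norm (seg x m n a) \<le> norm (lin_comb (trunc m n a) w) * KS" using KS(2) by simp
    also have "\<dots> \<le> K * norm v * KS" using K(2)[OF that] KS(1) by (intro mult_right_mono) auto
    finally show ?thesis by (simp add: mult_ac)
  qed
  then show thesis using that[of "KS * K"] KS(1) K(1) by simp
qed

text \<open>A frame projection of \<open>v\<close> is the synthesis operator applied to a truncation
  of \<open>T v\<close>, so the basis constant of \<open>w\<close> bounds all of them at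
  once.\<close>

lemma frame_exists: "\<exists>C. frame x f C"
proof -
  obtain T where T: "bounded_linear T" "\<And>v. (\<lambda>n. \<Sum>i=1..n. f i v *\<^sub>R w i) \<longlonglongrightarrow> T v" by (rule analysis) blast
  obtain K where K: "0 < K" "\<And>v a m n. basis_expansion w v a \<Longrightarrow> 1 \<le> m \<Longrightarrow> norm (seg x m n a) \<le> K * norm v"
    by (rule segments_bounded) blast
  obtain KT where KT: "0 < KT" "\<And>v. norm (T v) \<le> norm v * KT" using bounded_linear.pos_bounded[OF T(1)] by blast
  have "norm (frame_proj x f m n v) \<le> (K * KT) * norm v" if "1 \<le> m" for m n v
  proof -
    have "norm (frame_proj x f m n v) \<le> K * norm (T v)"
      unfolding frame_proj_eq_seg[OF that] by (rule K(2)[OF frame_coefficients_expansion[OF T(2)] that])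
    also have "\<dots> \<le> K * (norm v * KT)" using KT(2) K(1) by (intro mult_left_mono) auto
    finally show ?thesis by (simp add: mult_ac)
  qed
  then have "frame x f (K * KT)" using shrinking_frame K(1) KT(1) by unfold_locales auto
  then show ?thesis by blast
qed

lemma level_threshold:
  assumes c: "0 < c"
  shows "\<exists>M. \<forall>m0 n0 m n v a. 1 \<le> m0 \<and> m0 \<le> n0 \<and> n0 \<le> k \<and> 1 \<le> m \<and> M \<le> m \<and> basis_expansion w v a \<longrightarrow>
    2 ^ k * norm (frame_proj x f m0 n0 (seg x m n a)) \<le> c * norm v"
proof -
  obtain S where S: "bounded_linear S" "\<And>a. a \<in> c00 \<Longrightarrow> S (lin_comb a w) = lin_comb a x" by (rule synthesis) blast
  obtain K where K: "0 < K"
    "\<And>v a m n. basis_expansion w v a \<Longrightarrow> 1 \<le> m \<Longrightarrow> norm (lin_comb (trunc m n a) w) \<le> K * norm v" by (rule norm_trunc_le) blast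
  define D where "D = (\<Sum>i=1..k. norm (x i)) + 1"
  have D: "0 < D" by (auto simp: D_def intro!: add_nonneg_pos sum_nonneg)
  \<comment> \<open>The denominator absorbs the weight of the level, the norms of the
    \<open>x i\<close> and the truncation constant of \<open>w\<close>.\<close>
  define e where "e = c / (2 ^ k * D * K)"
  have e: "0 < e" using c D K(1) by (simp add: e_def)
  have "\<exists>M. \<forall>a. a \<in> c00 \<longrightarrow> (\<forall>j<M. a j = 0) \<longrightarrow> \<bar>f i (lin_comb a x)\<bar> \<le> e * norm (lin_comb a w)" for i
  proof -
    have "bounded_linear (\<lambda>v. f i (S v))"
      by (rule bounded_linear_compose[OF blinfun.bounded_linear_right S(1)])
    then interpret fS: bounded_linear "\<lambda>v. f i (S v)" .
    obtain KS where "\<And>v. norm (f i (S v)) \<le> norm v * KS" using fS.bounded by blast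
    then have "bounded_linear_on UNIV (\<lambda>v. f i (S v))"
      unfolding bounded_linear_on_def
      by (intro conjI ballI allI exI[of _ KS] fS.add fS.scale) (auto simp: mult.commute)
    from shrinking_basis_tail[OF shrinking_w this e] obtain M where
      "\<And>a. a \<in> c00 \<Longrightarrow> (\<And>j. j < M \<Longrightarrow> a j = 0) \<Longrightarrow> \<bar>f i (S (lin_comb a w))\<bar> \<le> e * norm (lin_comb a w)" by blast
    then show ?thesis using S(2) by (intro exI[of _ M]) auto
  qed
  then have "\<exists>M. \<forall>i a. a \<in> c00 \<longrightarrow> (\<forall>j<M i. a j = 0) \<longrightarrow> \<bar>f i (lin_comb a x)\<bar> \<le> e * norm (lin_comb a w)"
    by (intro choice) blast
  then obtain M where M: "\<And>i a. a \<in> c00 \<Longrightarrow> (\<And>j. j < M i \<Longrightarrow> a j = 0) \<Longrightarrow> \<bar>f i (lin_comb a x)\<bar> \<le> e * norm (lin_comb a w)"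
    by blast
  define M' where "M' = (\<Sum>i=1..k. M i)"
  have M': "M i \<le> M'" if "1 \<le> i" "i \<le> k" for i
    using member_le_sum[of i "{1..k}" M] that by (simp add: M'_def)
  have "2 ^ k * norm (frame_proj x f m0 n0 (seg x m n a)) \<le> c * norm v"
    if m0: "1 \<le> m0" "n0 \<le> k" and m: "1 \<le> m" "M' \<le> m" and v: "basis_expansion w v a" for m0 n0 m n v a
  proof -
    let ?b = "trunc m n a"
    have seg: "seg x m n a = lin_comb ?b x" by (simp add: seg_def lin_comb_trunc)
    have "norm (frame_proj x f m0 n0 (seg x m n a)) \<le> (\<Sum>i=m0..n0. e * norm (lin_comb ?b w) * norm (x i))"
      unfolding frame_proj_def seg
    proof (rule sum_norm_le)
      fix i assume i: "i \<in> {m0..n0}"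
      have "\<bar>f i (lin_comb ?b x)\<bar> \<le> e * norm (lin_comb ?b w)"
        using i m0 m M'[of i] by (intro M trunc_c00) (auto simp: trunc_def)
      from mult_right_mono[OF this norm_ge_zero[of "x i"]]
      show "norm (f i (lin_comb ?b x) *\<^sub>R x i) \<le> e * norm (lin_comb ?b w) * norm (x i)" by simp
    qed
    also have "\<dots> = e * norm (lin_comb ?b w) * (\<Sum>i=m0..n0. norm (x i))" by (simp add: sum_distrib_left)
    also have "(\<Sum>i=m0..n0. norm (x i)) \<le> (\<Sum>i=1..k. norm (x i))" using m0 by (intro sum_mono2) auto
    then have "(\<Sum>i=m0..n0. norm (x i)) \<le> D" by (simp add: D_def)
    then have "e * norm (lin_comb ?b w) * (\<Sum>i=m0..n0. norm (x i)) \<le> e * (K * norm v) * D"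
      using e K(2)[OF v m(1), of n] K(1) by (intro mult_mono) (auto intro!: sum_nonneg)
    finally have "2 ^ k * norm (frame_proj x f m0 n0 (seg x m n a)) \<le> 2 ^ k * (e * (K * norm v) * D)"
      by (intro mult_left_mono) auto
    also have "\<dots> = c * norm v" using D K(1) by (simp add: e_def)
    finally show ?thesis .
  qed
  then show ?thesis by blast
qed

lemma admissible_sequence:
  obtains N K where "increasing_seq N" "admissible x f N" "0 < K"
    "\<And>L a. L \<subseteq> {1..} \<Longrightarrow> a \<in> c00 \<Longrightarrow> seg_bound x f N L (K * norm (lin_comb a w)) a"
proof -
  obtain T where T: "bounded_linear T" "\<And>v. (\<lambda>n. \<Sum>i=1..n. f i v *\<^sub>R w i) \<longlonglongrightarrow> T v" by (rule analysis) blast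
  obtain K where K: "0 < K" "\<And>v a m n. basis_expansion w v a \<Longrightarrow> 1 \<le> m \<Longrightarrow> norm (seg x m n a) \<le> K * norm v"
    by (rule segments_bounded) blast
  obtain KT where KT: "0 < KT" "\<And>v. norm (T v) \<le> norm v * KT" using bounded_linear.pos_bounded[OF T(1)] by blast
  \<comment> \<open>Chosen so that the level bound at \<open>T v\<close> is at most
    \<open>norm v\<close>, as admissibility requires.\<close>
  define c where "c = 1 / KT"
  have c: "0 < c" using KT(1) by (simp add: c_def)
  have "\<exists>M. \<forall>k. \<forall>m0 n0 m n v a. 1 \<le> m0 \<and> m0 \<le> n0 \<and> n0 \<le> k \<and> 1 \<le> m \<and> M k \<le> m \<and> basis_expansion w v a \<longrightarrow>
    2 ^ k * norm (frame_proj x f m0 n0 (seg x m n a)) \<le> c * norm v"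
    by (rule choice) (use level_threshold[OF c] in blast)
  then obtain M where M: "\<And>k m0 n0 m n v a. 1 \<le> m0 \<Longrightarrow> m0 \<le> n0 \<Longrightarrow> n0 \<le> k \<Longrightarrow> 1 \<le> m \<Longrightarrow> M k \<le> m \<Longrightarrow> basis_expansion w v a \<Longrightarrow>
    2 ^ k * norm (frame_proj x f m0 n0 (seg x m n a)) \<le> c * norm v" by blast
  \<comment> \<open>The sum dominates the threshold \<open>M k\<close>; the extra \<open>k\<close>
    makes \<open>N\<close> strictly increasing.\<close>
  define N where "N k = k + (\<Sum>j\<le>k. M j)" for k
  have MN: "M k \<le> N k" for k using member_le_sum[of k "{..k}" M] by (simp add: N_def)
  have "strict_mono N" by (rule strict_mono_Suc_iff[THEN iffD2]) (simp add: N_def)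
  then have inc: "increasing_seq N"
    by (auto simp: increasing_seq_def N_def strict_mono_on_def strict_mono_def)
  have lev: "2 ^ k * norm (frame_proj x f m0 n0 (seg x m n a)) \<le> c * norm v"
    if "1 \<le> k" "1 \<le> m0" "m0 \<le> n0" "n0 \<le> k" "N k \<le> m" "basis_expansion w v a" for k m0 n0 m n v a
  proof -
    have "1 \<le> m" "M k \<le> m" using MN[of k] that by (auto simp: N_def)
    then show ?thesis using M that by blast
  qed
  have "norm (frame_proj x f m0 n0 (frame_proj x f m n v)) \<le> 1 / 2 ^ k * norm v"
    if k: "1 \<le> k" "1 \<le> m0" "m0 < n0" "n0 \<le> k" "N k \<le> m" for k v m0 n0 m n
  proof -
    have m: "1 \<le> m" using k by (simp add: N_def)
    have "2 ^ k * norm (frame_proj x f m0 n0 (frame_proj x f m n v)) \<le> c * norm (T v)"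
      unfolding frame_proj_eq_seg[OF m] using k by (intro lev frame_coefficients_expansion T(2)) auto
    also have "\<dots> \<le> c * (norm v * KT)" using KT(2) c by (intro mult_left_mono) auto
    also have "\<dots> = norm v" using KT(1) by (simp add: c_def)
    finally show ?thesis by (simp add: field_simps)
  qed
  then have "admissible x f N" unfolding admissible_def using inc by blast
  moreover have "seg_bound x f N L (max K c * norm (lin_comb a w)) a" if L: "L \<subseteq> {1..}" and a: "a \<in> c00" for L a
    unfolding seg_bound_def
  proof (intro conjI allI ballI impI)
    fix m n :: nat assume "1 \<le> m \<and> m \<le> n"
    then have "norm (seg x m n a) \<le> K * norm (lin_comb a w)" using K(2)[OF basis_expansion_lin_comb[OF a]] by blast
    also have "\<dots> \<le> max K c * norm (lin_comb a w)" by (intro mult_right_mono) auto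
    finally show "norm (seg x m n a) \<le> max K c * norm (lin_comb a w)" .
  next
    fix k m0 n0 m n assume "k \<in> L" "1 \<le> m0 \<and> m0 \<le> n0 \<and> n0 \<le> k \<and> N k \<le> m \<and> m \<le> n"
    then have "2 ^ k * norm (frame_proj x f m0 n0 (seg x m n a)) \<le> c * norm (lin_comb a w)"
      using L by (intro lev basis_expansion_lin_comb a) auto
    also have "\<dots> \<le> max K c * norm (lin_comb a w)" by (intro mult_right_mono) auto
    finally show "2 ^ k * norm (frame_proj x f m0 n0 (seg x m n a)) \<le> max K c * norm (lin_comb a w)" .
  qed
  ultimately show thesis using that[of N "max K c"] inc K(1) by auto
qed

end

text \<open>Contrapositive of \<open>shrinking_basis\<close> for \<open>L = {}\<close>: without
  levels, the failure must come from some coordinate that does not become small on tails.\<close>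

lemma min_norm_witnesses:
  assumes frame: "frame x f C" and compl: "completion_of (min_norm x) Zmin zmin"
    and not_shrinking: "\<not> shrinking_basis Zmin zmin"
  obtains i d where "1 \<le> i" "0 < d"
    "\<And>M. \<exists>a\<in>c00. (\<forall>j<M. a j = 0) \<and> seg_bound x f N {} 1 a \<and> d < \<bar>f i (lin_comb a x)\<bar>"
proof -
  have norm: "norm (lin_comb a zmin) \<le> B \<longleftrightarrow> seg_bound x f N {} B a" if "a \<in> c00" for a B N
    using compl that by (simp add: completion_of_def min_norm_le_iff[OF that])
  interpret frame x f C by (rule frame)
  interpret segment_basis x f C N "{}" zmin
    by unfold_locales (use norm in auto)
  have "Zmin = Z" using compl by (simp add: completion_of_def)
  then obtain i d where id: "1 \<le> i" "0 < d"
    "\<not> (\<exists>M. \<forall>a\<in>c00. (\<forall>j<M. a j = 0) \<longrightarrow> norm (lin_comb a zmin) \<le> 1 \<longrightarrow> \<bar>f i (lin_comb a x)\<bar> \<le> d)"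
    using shrinking_basis not_shrinking by blast
  have "\<exists>a\<in>c00. (\<forall>j<M. a j = 0) \<and> seg_bound x f N {} 1 a \<and> d < \<bar>f i (lin_comb a x)\<bar>" for M
    using id(3) norm by (metis not_le)
  with id(1,2) show thesis by (rule that)
qed

subsection \<open>An almost disjoint family of size continuum\<close>

text \<open>Two reals agree only in finitely many of their dyadic approximations from below.\<close>

definition real_code :: "real \<Rightarrow> nat set" where
  "real_code \<alpha> = range (\<lambda>n. to_nat (n, \<lfloor>\<alpha> * 2 ^ n\<rfloor>))"

lemma infinite_real_code: "infinite (real_code \<alpha>)"
  unfolding real_code_def by (rule range_inj_infinite) (auto simp: inj_def)

text \<open>The code records \<open>n\<close>, so a common element comes from the same
  \<open>n\<close> for both reals; equal floors then give
  \<open>\<bar>\<alpha> - \<beta>\<bar> * 2 ^ n < 1\<close>, which bounds \<open>n\<close>.\<close>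

lemma finite_real_code_Int:
  assumes "\<alpha> \<noteq> \<beta>"
  shows "finite (real_code \<alpha> \<inter> real_code \<beta>)"
proof -
  obtain n0 where n0: "1 / \<bar>\<alpha> - \<beta>\<bar> < real n0" using reals_Archimedean2 by blast
  have "n < n0" if "\<lfloor>\<alpha> * 2 ^ n\<rfloor> = \<lfloor>\<beta> * 2 ^ n\<rfloor>" for n
  proof (rule ccontr)
    assume "\<not> n < n0"
    have "\<bar>\<alpha> * 2 ^ n - \<beta> * 2 ^ n\<bar> < 1" using that by linarith
    then have "\<bar>\<alpha> - \<beta>\<bar> * 2 ^ n < 1" by (simp add: left_diff_distrib[symmetric] abs_mult)
    moreover have "real n0 \<le> 2 ^ n" using \<open>\<not> n < n0\<close> of_nat_less_two_power[of n, where 'a = real] by linarith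
    then have "\<bar>\<alpha> - \<beta>\<bar> * real n0 \<le> \<bar>\<alpha> - \<beta>\<bar> * 2 ^ n" by (intro mult_left_mono) auto
    moreover have "1 < \<bar>\<alpha> - \<beta>\<bar> * real n0" using n0 assms by (simp add: field_simps)
    ultimately show False by linarith
  qed
  then have "real_code \<alpha> \<inter> real_code \<beta> \<subseteq> (\<lambda>n. to_nat (n, \<lfloor>\<alpha> * 2 ^ n\<rfloor>)) ` {..<n0}"
    by (auto simp: real_code_def)
  then show ?thesis using finite_subset by blast
qed

text \<open>Argument and value are shifted because sequences start at 1. Thus m in
  \<open>real_code \<alpha>\<close> stands for the level \<open>k (Suc m)\<close>, with
  \<open>k m\<close> always available below it for comparison.\<close>

definition code_seq :: "real \<Rightarrow> nat \<Rightarrow> nat" where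
  "code_seq \<alpha> i = Suc (enumerate (real_code \<alpha>) (i - 1))"

lemma increasing_code_seq: "increasing_seq (code_seq \<alpha>)"
  using strict_mono_enumerate[OF infinite_real_code[of \<alpha>]]
  by (auto simp: increasing_seq_def code_seq_def strict_mono_on_def strict_mono_def)

lemma code_seq_image: "code_seq \<alpha> ` {1..} = Suc ` real_code \<alpha>"
proof -
  have "(\<lambda>i. i - 1) ` {1 :: nat..} = UNIV"
  proof (intro set_eqI iffI)
    fix n show "n \<in> (\<lambda>i. i - 1) ` {1 :: nat..}" by (rule image_eqI[of _ _ "Suc n"]) auto
  qed simp
  then have "code_seq \<alpha> ` {1..} = Suc ` enumerate (real_code \<alpha>) ` UNIV"
    unfolding code_seq_def by (metis (no_types, lifting) image_cong image_image)
  then show ?thesis using range_enumerate[OF infinite_real_code[of \<alpha>]] by simp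
qed

section \<open>Realising the norms and separating them\<close>

lemma Z_norm_completion:
  fixes x :: "nat \<Rightarrow> 'x::banach"
  assumes ks: "\<And>j. 1 \<le> j \<Longrightarrow> 1 \<le> ks j"
    and bdd: "\<And>a. a \<in> c00 \<Longrightarrow> \<exists>B. seg_bound x f N (ks ` {1..}) B a"
  obtains z :: "nat \<Rightarrow> (nat \<Rightarrow>\<^sub>C 'x)" where
    "\<And>a B. a \<in> c00 \<Longrightarrow> norm (lin_comb a z) \<le> B \<longleftrightarrow> seg_bound x f N (ks ` {1..}) B a"
    "completion_of (Z_norm x f ks N) (closure (span (z ` {1..}))) z"
proof -
  have "0 \<notin> ks ` {1..}" using ks by force
  from segment_completion_exists[OF this bdd] obtain z :: "nat \<Rightarrow> (nat \<Rightarrow>\<^sub>C 'x)" where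
    z: "\<And>a B. a \<in> c00 \<Longrightarrow> norm (lin_comb a z) \<le> B \<longleftrightarrow> seg_bound x f N (ks ` {1..}) B a" by blast
  have "norm (lin_comb a z) = Z_norm x f ks N a" if a: "a \<in> c00" for a
  proof -
    obtain B0 where "seg_bound x f N (ks ` {1..}) B0 a" using bdd[OF a] by blast
    from Z_norm_le_iff[OF a this ks] z[OF a]
    have "norm (lin_comb a z) \<le> B \<longleftrightarrow> Z_norm x f ks N a \<le> B" for B by blast
    \<comment> \<open>Two reals with the same upper bounds are equal.\<close>
    then show ?thesis by (meson order_antisym order_refl)
  qed
  then have "completion_of (Z_norm x f ks N) (closure (span (z ` {1..}))) z" by (simp add: completion_of_def)
  with z show thesis by (rule that)
qed

text \<open>
  The vector \<open>a\<close> only sees the levels up to \<open>\<kappa>\<close>: it is large at level \<open>\<kappa>\<close> itself, but the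
  contribution of a lower level \<open>l \<le> \<kappa>'\<close> is at most \<open>C * 2 ^ \<kappa>'\<close>.
\<close>

lemma level_gap:
  assumes A: "segment_basis x f C N L zA" and B: "segment_basis x f C N L' zB"
    and dom: "\<And>a. a \<in> c00 \<Longrightarrow> norm (lin_comb a zA) \<le> K * norm (lin_comb a zB)" and K: "0 < K"
    and a: "a \<in> c00" "\<And>j. j < N \<kappa> \<Longrightarrow> a j = 0" "\<And>j. M < j \<Longrightarrow> a j = 0"
    and min: "seg_bound x f N {} 1 a"
    and large: "d < \<bar>f i (lin_comb a x)\<bar>" and i: "1 \<le> i" "i \<le> \<kappa>" and \<kappa>: "\<kappa> \<in> L"
    and L': "\<And>l. l \<in> L' \<Longrightarrow> l \<le> \<kappa>' \<or> M < N l"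
  shows "2 ^ \<kappa> * (d * norm (x i)) \<le> K * (max 1 C * 2 ^ \<kappa>')"
proof -
  interpret A: segment_basis x f C N L zA by (rule A)
  interpret B: segment_basis x f C N L' zB by (rule B)
  have "seg x (N \<kappa>) M a = lin_comb a x"
    by (rule seg_eq_lin_comb) (use a in \<open>force simp: not_less[symmetric]\<close>)
  then have "2 ^ \<kappa> * norm (frame_proj x f i i (lin_comb a x)) \<le> norm (lin_comb a zA)"
    using A.frame_proj_seg_le[OF a(1) \<kappa> i(1) order_refl i(2) order_refl, of M] by simp
  then have "2 ^ \<kappa> * (\<bar>f i (lin_comb a x)\<bar> * norm (x i)) \<le> norm (lin_comb a zA)" by (simp add: frame_proj_def)
  moreover have "2 ^ \<kappa> * (d * norm (x i)) \<le> 2 ^ \<kappa> * (\<bar>f i (lin_comb a x)\<bar> * norm (x i))"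
    using large by (intro mult_left_mono mult_right_mono) auto
  ultimately have lower: "2 ^ \<kappa> * (d * norm (x i)) \<le> norm (lin_comb a zA)" by linarith
  \<comment> \<open>In \<open>max 1 C\<close> the 1 covers plain segments, the \<open>C\<close>
    their projections.\<close>
  have "seg_bound x f N L' (max 1 C * 2 ^ \<kappa>') a"
    unfolding seg_bound_def
  proof (intro conjI allI ballI impI)
    fix m n :: nat assume "1 \<le> m \<and> m \<le> n"
    then have "norm (seg x m n a) \<le> 1 * 1" using seg_bound_segD[OF min] by simp
    also have "\<dots> \<le> max 1 C * 2 ^ \<kappa>'" by (intro mult_mono) auto
    finally show "norm (seg x m n a) \<le> max 1 C * 2 ^ \<kappa>'" .
  next
    fix l m0 n0 m n assume l: "l \<in> L'" and *: "1 \<le> m0 \<and> m0 \<le> n0 \<and> n0 \<le> l \<and> N l \<le> m \<and> m \<le> n"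
    have m: "1 \<le> m" using B.N_ge[OF l] * by simp
    show "2 ^ l * norm (frame_proj x f m0 n0 (seg x m n a)) \<le> max 1 C * 2 ^ \<kappa>'"
    proof (cases "l \<le> \<kappa>'")
      case True
      have "norm (frame_proj x f m0 n0 (seg x m n a)) \<le> C * norm (seg x m n a)" using * by (intro A.proj_le) simp
      also have "\<dots> \<le> C * 1" using A.C seg_bound_segD[OF min m] by (intro mult_left_mono)
      finally have "norm (frame_proj x f m0 n0 (seg x m n a)) \<le> max 1 C" by simp
      then have "2 ^ l * norm (frame_proj x f m0 n0 (seg x m n a)) \<le> 2 ^ \<kappa>' * max 1 C"
        using True by (intro mult_mono power_increasing) auto
      then show ?thesis by (simp add: mult.commute)
    next
      case False
      \<comment> \<open>A level above \<open>\<kappa>'\<close> only looks beyond \<open>M\<close>,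
        where \<open>a\<close> vanishes.\<close>
      then have "seg x m n a = 0" using L'[OF l] * a(3) by (intro seg_eq_0) auto
      then show ?thesis by (simp add: linear_0[OF linear_frame_proj])
    qed
  qed
  then have "K * norm (lin_comb a zB) \<le> K * (max 1 C * 2 ^ \<kappa>')"
    using B.norm_le_iff[OF a(1)] K by (intro mult_left_mono) auto
  then show ?thesis using lower dom[OF a(1)] by linarith
qed

theorem corollary4p4:
  fixes x :: "nat \<Rightarrow> 'x::banach"
    and f :: "nat \<Rightarrow> 'x \<Rightarrow>\<^sub>L real"
    and Zmin :: "'m::banach set" and zmin :: "nat \<Rightarrow> 'm"
    and w :: "nat \<Rightarrow> 'w::banach"
  assumes "separable_space (euclidean :: 'x topology)"
    and "infinite_dimensional TYPE('x)"
    and "shrinking_frame x f"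
    and "completion_of (min_norm x) Zmin zmin"
    and "\<not> shrinking_basis Zmin zmin"
    and "associated_basis x f UNIV w"
    and "shrinking_basis UNIV w"
  shows "\<exists>k N. increasing_seq k \<and> admissible x f N \<and>
    (\<exists>(\<Delta> :: real set) (M :: real \<Rightarrow> nat \<Rightarrow> nat)
       (Z :: real \<Rightarrow> (nat \<Rightarrow>\<^sub>C 'x) set) (z :: real \<Rightarrow> nat \<Rightarrow> (nat \<Rightarrow>\<^sub>C 'x)).
       \<Delta> \<approx> (UNIV :: real set) \<and>
       (\<forall>\<alpha>\<in>\<Delta>. increasing_seq (M \<alpha>) \<and>
          completion_of (Z_norm x f (k \<circ> M \<alpha>) N) (Z \<alpha>) (z \<alpha>)) \<and>
       (\<forall>\<alpha>\<in>\<Delta>. associated_basis x f (Z \<alpha>) (z \<alpha>) \<and> shrinking_basis (Z \<alpha>) (z \<alpha>) \<and>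
          dominates w (z \<alpha>)) \<and>
       (\<forall>\<alpha>\<in>\<Delta>. \<forall>\<beta>\<in>\<Delta>. \<alpha> \<noteq> \<beta> \<longrightarrow> incomparable (z \<alpha>) (z \<beta>)))"
proof -
  interpret shrinking_associated x f w using assms by unfold_locales
  obtain C where frame: "frame x f C" using frame_exists by blast
  interpret frame x f C by (rule frame)
  obtain N K where N: "increasing_seq N" "admissible x f N" and K: "0 < K"
    and bound: "\<And>L a. L \<subseteq> {1..} \<Longrightarrow> a \<in> c00 \<Longrightarrow> seg_bound x f N L (K * norm (lin_comb a w)) a"
    by (rule admissible_sequence) blast
  have N_mono: "N l \<le> N l'" if "1 \<le> l" "l \<le> l'" for l l'
    using N(1) that by (cases "l = l'") (auto simp: increasing_seq_def strict_mono_on_def intro: less_imp_le)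
  have N_ge: "l \<le> N l" if "1 \<le> l" for l
    using that
  proof (induction l rule: nat_induct_at_least)
    case base
    then show ?case using N(1) by (simp add: increasing_seq_def)
  next
    case (Suc l)
    have "N l < N (Suc l)" using N(1) Suc(1) by (simp add: increasing_seq_def strict_mono_on_def)
    then show ?case using Suc by simp
  qed
  obtain i0 d where i0: "1 \<le> i0" "0 < d"
    and wit: "\<And>M. \<exists>a\<in>c00. (\<forall>j<M. a j = 0) \<and> seg_bound x f N {} 1 a \<and> d < \<bar>f i0 (lin_comb a x)\<bar>"
    using min_norm_witnesses[OF frame assms(4,5)] by blast
  have "\<exists>u. \<forall>\<kappa>. u \<kappa> \<in> c00 \<and> (\<forall>j<N \<kappa>. u \<kappa> j = 0) \<and> seg_bound x f N {} 1 (u \<kappa>) \<and> d < \<bar>f i0 (lin_comb (u \<kappa>) x)\<bar>"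
    by (rule choice) (use wit in blast)
  then obtain u where u: "\<And>\<kappa>. u \<kappa> \<in> c00" "\<And>\<kappa> j. j < N \<kappa> \<Longrightarrow> u \<kappa> j = 0"
    "\<And>\<kappa>. seg_bound x f N {} 1 (u \<kappa>)" "\<And>\<kappa>. d < \<bar>f i0 (lin_comb (u \<kappa>) x)\<bar>" by blast
  have "\<exists>E. \<forall>\<kappa>. \<forall>j>E \<kappa>. u \<kappa> j = 0"
    by (rule choice) (use c00_bound[OF u(1)] in blast)
  then obtain E where E: "\<And>\<kappa> j. E \<kappa> < j \<Longrightarrow> u \<kappa> j = 0" by blast
  \<comment> \<open>Starting at \<open>i0\<close> lets every level see the coordinate
    \<open>i0\<close>. Doubling makes the weights of consecutive levels differ by a factor of at
    least \<open>2 ^ n\<close>, and \<open>E \<kappa>\<close> moves the next level past the support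
    of \<open>u \<kappa>\<close>.\<close>
  define k where "k = rec_nat i0 (\<lambda>_ \<kappa>. 2 * \<kappa> + E \<kappa> + 1)"
  have k0: "k 0 = i0" and kS: "k (Suc n) = 2 * k n + E (k n) + 1" for n by (simp_all add: k_def)
  have k_strict: "strict_mono k" by (rule strict_mono_Suc_iff[THEN iffD2]) (simp add: kS)
  have k_ge: "i0 \<le> k n" for n using k0 strict_mono_less_eq[OF k_strict, of 0 n] by simp
  have n_le_k: "n \<le> k n" for n using k_strict by (rule strict_mono_imp_increasing)
  have k_inc: "increasing_seq k"
    using k_strict k_ge i0 by (auto simp: increasing_seq_def strict_mono_on_def strict_mono_def intro: order_trans)
  define ks where "ks \<alpha> = k \<circ> code_seq \<alpha>" for \<alpha>
  have ks1: "1 \<le> ks \<alpha> j" for \<alpha> j using k_ge[of "code_seq \<alpha> j"] i0 by (simp add: ks_def)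
  have ks_image: "ks \<alpha> ` {1..} = k ` Suc ` real_code \<alpha>" for \<alpha>
    unfolding ks_def code_seq_image[symmetric] by (simp add: image_comp)
  have ks_sub: "ks \<alpha> ` {1..} \<subseteq> {1..}" for \<alpha> using ks1 by auto
  have "\<exists>z :: nat \<Rightarrow> (nat \<Rightarrow>\<^sub>C 'x). (\<forall>a\<in>c00. \<forall>B. norm (lin_comb a z) \<le> B \<longleftrightarrow> seg_bound x f N (ks \<alpha> ` {1..}) B a) \<and>
      completion_of (Z_norm x f (ks \<alpha>) N) (closure (span (z ` {1..}))) z" for \<alpha>
    by (rule Z_norm_completion[of "ks \<alpha>" x f N]) (use ks1 bound[OF ks_sub] in blast)+
  then obtain z :: "real \<Rightarrow> nat \<Rightarrow> (nat \<Rightarrow>\<^sub>C 'x)" where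
    z: "\<And>\<alpha> a B. a \<in> c00 \<Longrightarrow> norm (lin_comb a (z \<alpha>)) \<le> B \<longleftrightarrow> seg_bound x f N (ks \<alpha> ` {1..}) B a"
    and compl: "\<And>\<alpha>. completion_of (Z_norm x f (ks \<alpha>) N) (closure (span (z \<alpha> ` {1..}))) (z \<alpha>)" by metis
  have unbounded: "\<exists>l\<in>ks \<alpha> ` {1..}. n < l" for \<alpha> n
  proof -
    obtain m where "m \<in> real_code \<alpha>" "n < m"
      using infinite_real_code[of \<alpha>] unfolding infinite_nat_iff_unbounded by blast
    then show ?thesis using n_le_k[of "Suc m"] unfolding ks_image by (intro bexI[of _ "k (Suc m)"]) auto
  qed
  have sb: "segment_basis x f C N (ks \<alpha> ` {1..}) (z \<alpha>)" for \<alpha>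
  proof
    fix l assume "l \<in> ks \<alpha> ` {1..}"
    then have "1 \<le> l" using ks_sub by auto
    then show "1 \<le> N l \<and> l \<le> N l" using N_ge[of l] by simp
  qed (use unbounded z in auto)
  have dom: "norm (lin_comb a (z \<alpha>)) \<le> K * norm (lin_comb a w)" if "a \<in> c00" for a \<alpha>
    unfolding z[OF that] by (rule bound[OF ks_sub that])
  obtain T where T: "bounded_linear T" "\<And>v. (\<lambda>n. \<Sum>i=1..n. f i v *\<^sub>R w i) \<longlonglongrightarrow> T v" by (rule analysis) blast
  have not_dom: "\<not> dominates (z \<beta>) (z \<alpha>)" if "\<alpha> \<noteq> \<beta>" for \<alpha> \<beta>
  proof
    assume "dominates (z \<beta>) (z \<alpha>)"
    then obtain D where D: "0 < D" "\<And>a. a \<in> c00 \<Longrightarrow> norm (lin_comb a (z \<alpha>)) \<le> D * norm (lin_comb a (z \<beta>))"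
      unfolding dominates_def by blast
    have nx: "0 < d * norm (x i0)" using x_nonzero[OF i0(1)] i0(2) by simp
    obtain n0 where n0: "D * max 1 C / (d * norm (x i0)) < real n0" using reals_Archimedean2 by blast
    \<comment> \<open>Almost disjointness leaves infinitely many \<open>n\<close> in the first code
      only, so one can be taken beyond \<open>n0\<close>.\<close>
    have "infinite (real_code \<alpha> - (real_code \<alpha> \<inter> real_code \<beta>))"
      using infinite_real_code finite_real_code_Int[OF that] by (rule Diff_infinite_finite[rotated])
    then obtain n where n: "n0 < n" "n \<in> real_code \<alpha>" "n \<notin> real_code \<beta>"
      unfolding infinite_nat_iff_unbounded by blast
    \<comment> \<open>The test vector is \<open>u (k (Suc n))\<close>. A level of \<beta> comes from
      some \<open>m \<noteq> n\<close>: for \<open>m < n\<close> it is at most \<open>k n\<close>,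
      for \<open>m > n\<close> its threshold lies past the support.\<close>
    have "2 ^ k (Suc n) * (d * norm (x i0)) \<le> D * (max 1 C * 2 ^ k n)"
    proof (rule level_gap[OF sb sb D(2,1) u(1) u(2) E u(3) u(4) i0(1) k_ge])
      show "k (Suc n) \<in> ks \<alpha> ` {1..}" unfolding ks_image using n by auto
      fix l assume "l \<in> ks \<beta> ` {1..}"
      then obtain m where m: "m \<in> real_code \<beta>" "l = k (Suc m)" unfolding ks_image by auto
      then consider "m < n" | "n < m" using n by (cases m n rule: linorder_cases) auto
      then show "l \<le> k n \<or> E (k (Suc n)) < N l"
      proof cases
        case 1
        then show ?thesis using m strict_mono_less_eq[OF k_strict, of "Suc m" n] by simp
      next
        case 2
        then have "k (Suc (Suc n)) \<le> l" using m strict_mono_less_eq[OF k_strict, of "Suc (Suc n)" "Suc m"] by simp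
        then have "E (k (Suc n)) < l" using kS[of "Suc n"] by simp
        moreover have "l \<le> N l" using m k_ge[of "Suc m"] i0(1) by (intro N_ge) simp
        ultimately show ?thesis by simp
      qed
    qed
    moreover have "k n + n \<le> k (Suc n)" using kS[of n] n_le_k[of n] by simp
    then have "(2::real) ^ k n * 2 ^ n \<le> 2 ^ k (Suc n)" unfolding power_add[symmetric] by (rule power_increasing) simp
    then have "2 ^ k n * 2 ^ n * (d * norm (x i0)) \<le> 2 ^ k (Suc n) * (d * norm (x i0))"
      using nx by (intro mult_right_mono) auto
    ultimately have "2 ^ k n * 2 ^ n * (d * norm (x i0)) \<le> D * (max 1 C * 2 ^ k n)" by linarith
    \<comment> \<open>The weight \<open>2 ^ k n\<close> cancels, leaving a bound on
      \<open>2 ^ n\<close> that contradicts the choice of \<open>n0\<close>.\<close>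
    then have "2 ^ k n * (2 ^ n * (d * norm (x i0))) \<le> 2 ^ k n * (D * max 1 C)"
      by (simp only: mult.assoc mult.commute[of _ "2 ^ k n"] mult.left_commute[of _ "2 ^ k n"])
    then have "2 ^ n * (d * norm (x i0)) \<le> D * max 1 C" by simp
    moreover have "real n0 \<le> 2 ^ n" using n(1) of_nat_less_two_power[of n, where 'a = real] by linarith
    then have "real n0 * (d * norm (x i0)) \<le> 2 ^ n * (d * norm (x i0))" using nx by (intro mult_right_mono) auto
    moreover have "D * max 1 C < real n0 * (d * norm (x i0))" using n0 nx by (simp only: pos_divide_less_eq)
    ultimately show False by linarith
  qed
  have "associated_basis x f (closure (span (z \<alpha> ` {1..}))) (z \<alpha>)
      \<and> shrinking_basis (closure (span (z \<alpha> ` {1..}))) (z \<alpha>) \<and> dominates w (z \<alpha>)" for \<alpha>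
  proof -
    interpret segment_basis x f C N "ks \<alpha> ` {1..}" "z \<alpha>" by (rule sb)
    have "associated_basis x f Z (z \<alpha>)"
      using dom K T by (intro associated_basisI[of K w T]) auto
    moreover have "shrinking_basis Z (z \<alpha>)"
      by (rule shrinking_basis) (rule coordinates_small; simp)
    moreover have "dominates w (z \<alpha>)" unfolding dominates_def using dom K by blast
    ultimately show ?thesis by blast
  qed
  moreover have "incomparable (z \<alpha>) (z \<beta>)" if "\<alpha> \<noteq> \<beta>" for \<alpha> \<beta>
    unfolding incomparable_def using not_dom that by metis
  \<comment> \<open>Every real serves as an index, so the index set is all of
    \<open>UNIV\<close>.\<close>
  ultimately show ?thesis
    using k_inc N(2) increasing_code_seq compl unfolding ks_def
    by (intro exI[of _ k] exI[of _ N] exI[of _ UNIV] exI[of _ code_seq]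
        exI[of _ "\<lambda>\<alpha>. closure (span (z \<alpha> ` {1..}))"] exI[of _ z] conjI ballI impI eqpoll_refl) blast+
qed

end
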